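(* Let $R>0$ be fixed. For $2\le\sqrt{x}\le y\le x$ and real $r$ with $0<r\le R$, with $\alpha=\frac{\log x}{\log y}$, $$ S_{r}(x,y)=m_{r}(\alpha)\frac{x}{\log^{1-r}y}+O\!\left(\frac{x}{\log^{2-r}y}+\frac{x}{\log x}\right), $$ where for $1\le\alpha\le2$, $m_{r}(\alpha)=\frac{g(1,r)}{\Gamma(r)}\left(\alpha^{r-1}+(1-r)\alpha^{r-1}\int_{1}^{\alpha}\frac{du}{u^{r}(u-1)^{1-r}}\right)$.
   Context: For $y>1$ and a positive integer $n$, $\omega_y(n)$ denotes the number of distinct primes $p<y$ dividing $n$; $S_r(x,y)=\sum_{n\le x}r^{\omega_y(n)}$. $g(1,r)=\prod_p\left(1+\frac{r}{p-1}\right)\left(1-\frac1p\right)^{r}$ (product over all primes) and $\Gamma$ is the Gamma function. *)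

theory Defs
  imports "HOL-Analysis.Analysis" "HOL-Computational_Algebra.Primes"
begin

definition omega_below :: "real \<Rightarrow> nat \<Rightarrow> nat" where
  "omega_below y n = card {p::nat. prime p \<and> real p < y \<and> p dvd n}"

definition S_sum :: "real \<Rightarrow> real \<Rightarrow> real \<Rightarrow> real" where
  "S_sum r x y = (\<Sum>n\<in>{n::nat. 1 \<le> n \<and> real n \<le> x}. r ^ omega_below y n)"

text \<open>The product over all primes is taken in increasing order, non-primes contributing
  the factor 1. It converges absolutely for \<open>r > 0\<close>, with all factors positive.\<close>

definition g_one :: "real \<Rightarrow> real" where
  "g_one r = (\<Prod>p. if prime p then (1 + r / (real p - 1)) * (1 - 1 / real p) powr r else 1)"

text \<open>For \<open>r < 1\<close> the integrand is unbounded near \<open>u = 1\<close>; being nonnegative, its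
  Henstock--Kurzweil integral agrees with the improper and the Lebesgue integral.
  The junk value of the integrand at the endpoint \<open>u = 1\<close> is irrelevant.\<close>

definition m_fun :: "real \<Rightarrow> real \<Rightarrow> real" where
  "m_fun r \<alpha> = g_one r / Gamma r *
     (\<alpha> powr (r - 1) + (1 - r) * \<alpha> powr (r - 1) *
        integral {1..\<alpha>} (\<lambda>u. 1 / (u powr r * (u - 1) powr (1 - r))))"

end

(*
  Write r^omega = sum of coefficients of F(s) = zeta(s)^r G_r(s), where the Euler product G_r converges
  absolutely to the left of Re s = 1.  The Laplace transform of the error
  A(v) = (sum over n <= e^v of r^omega(n)) - g(1,r)/Gamma(r) e^v v^(r-1)
  is F(s)/s - g(1,r) (s-1)^(-r).  Its third derivative, the transform of -v^3 A(v), is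
  O(|s-1|^(-2-r)) near the pole and, by the classical lower bound for zeta near the line Re s = 1,
  O(|s|^(-1/2)) away from it; Fourier inversion of short averages of v^3 A(v) on the line
  Re s = 1 + 1/v then gives A(v) = O(e^v (v^(r-2) + v^(-2))), uniformly for r <= R.

  Since y >= sqrt x, an n <= x has at most one prime factor p >= y, so
  S_r(x,y) = S_r(x) + (1-r) * (sum over y <= p <= x of S_r(x/p)), up to O(1).  Inserting the asymptotics for
  S_r(x/p), the sum over p is compared by Abel summation with an integral, for which Mertens'
  estimate for the sum of log p / p suffices; the integral is the one in m_r.  The error terms
  (log x/p)^(r-2) are harmless because of the factor 1-r.
*)
theory Submission
  imports
    Defs
    "HOL-Number_Theory.Number_Theory"
    "HOL-Complex_Analysis.Complex_Analysis"
    "HOL-Probability.Probability"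
    "HOL-Real_Asymp.Real_Asymp"
begin

text \<open>The remainder dictates three derivatives. On Re s = 1 + 1/u the averaging over a window
  of length 1/u gains a factor 1/u near the pole, and |s-1|^(-2-r) integrates to O(u^(1+r)) with no
  factor 1/r; dividing by the window length and by u^3 leaves e^u u^(r-2). The rest of the line
  contributes e^u times a constant, hence e^u u^(-2) after the same divisions, and with this
  exponent the sum over p of (log x/p)^(-2)/p is still O(1/log x).

  Away from the pole the derivatives come from Cauchy's estimate on discs of radius about |t|^(-10a)
  on which zeta has no zero. The exponent a is taken so small, depending on R, that all losses
  together stay below half of the factor 1/|s|.

  Uniformity as r tends to 0 shapes many statements. The integral in m_r can be of size 1/r and is
  compensated by 1/Gamma(r) = O(r). The exponents r-1 and r-2 may pass through 0 and -1, so
  integrals of (log x/p)^b are estimated through total variation, in a form that never divides by b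
  or b+1.\<close>

section \<open>The zeta function near the line Re s = 1\<close>

text \<open>This is (s-1) times the difference of n^(-s) and the integral of u^(-s) over [n, n+1].
  The integral is evaluated in advance, so that no division by s-1 remains and every term is
  entire.\<close>

definition zeta_term :: "nat \<Rightarrow> complex \<Rightarrow> complex" where
  "zeta_term n s = (s - 1) * of_nat n powr (-s) + of_nat (Suc n) powr (1 - s) - of_nat n powr (1 - s)"

lemma norm_diff_powr_le:
  fixes u n :: real and s :: complex
  assumes "0 < n" "n \<le> u" "u \<le> n + 1" "Re s \<ge> 0"
  shows "norm (of_real n powr (-s) - of_real u powr (-s)) \<le> norm s * n powr (- Re s - 1)"
proof -
  let ?S = "closed_segment (of_real n) (of_real u) :: complex set"
  have S: "\<exists>v. w = of_real v \<and> n \<le> v \<and> v \<le> u" if "w \<in> ?S" for w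
    using that assms by (auto simp: closed_segment_of_real closed_segment_eq_real_ivl)
  have "norm (of_real n powr (-s) - of_real u powr (-s)) \<le> (norm s * n powr (- Re s - 1)) * norm (complex_of_real n - of_real u)"
  proof (rule field_differentiable_bound[where S = ?S and f' = "\<lambda>w. (-s) * w powr (-s - 1)"])
    fix w assume "w \<in> ?S"
    then obtain v where v: "w = of_real v" "n \<le> v" "v \<le> u" using S by blast
    have "w \<notin> \<real>\<^sub>\<le>\<^sub>0" using v assms by (auto simp: complex_nonpos_Reals_iff)
    then show "((\<lambda>w. w powr (-s)) has_field_derivative (-s) * w powr (-s - 1)) (at w within ?S)"
      by (auto intro!: derivative_eq_intros)
    have "v powr (- Re s - 1) \<le> n powr (- Re s - 1)"
      using v assms by (intro powr_mono2') auto
    then show "norm ((-s) * w powr (-s - 1)) \<le> norm s * n powr (- Re s - 1)"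
      using v assms by (simp add: norm_mult norm_powr_real_powr mult_left_mono)
  qed auto
  also have "\<dots> \<le> (norm s * n powr (- Re s - 1)) * 1"
    using assms by (intro mult_left_mono) (auto simp flip: of_real_diff)
  finally show ?thesis by simp
qed

text \<open>The difference n^(-s) - v^(-s) has two bounds: |s| n^(-Re s - 1) from the mean value
  inequality and 2 n^(-Re s) trivially. Their geometric mean with weights 2a and 1-2a grows only
  like |s|^(2a) and still leaves a convergent sum over n.\<close>

lemma norm_zeta_term_le:
  fixes s :: complex and a :: real
  assumes n: "n > 0" and a: "0 < a" "a \<le> 1/4" and s: "Re s \<ge> 1 - a"
  shows "norm (zeta_term n s) \<le> norm (s - 1) * (2 * norm s powr (2 * a)) * real n powr (- 1 - a)"
proof -
  let ?S = "closed_segment (of_nat n) (of_nat (Suc n)) :: complex set"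
  define M where "M = 2 * norm s powr (2 * a) * real n powr (- 1 - a)"
  have n1: "real n \<ge> 1" using n by linarith
  have S: "\<exists>v. w = of_real v \<and> real n \<le> v \<and> v \<le> real n + 1" if "w \<in> ?S" for w
  proof -
    have "w \<in> of_real ` closed_segment (real n) (real (Suc n))"
      using that closed_segment_of_real[of "real n" "real (Suc n)", where 'a = complex] by simp
    then show ?thesis by (auto simp: closed_segment_eq_real_ivl)
  qed
  have M: "norm (complex_of_real (real n) powr (-s) - of_real v powr (-s)) \<le> M" if v: "real n \<le> v" "v \<le> real n + 1" for v
  proof -
    let ?x = "norm (complex_of_real (real n) powr (-s) - of_real v powr (-s))"
    have 1: "?x \<le> norm s * real n powr (- Re s - 1)"
      by (rule norm_diff_powr_le) (use v n1 s a in auto)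
    have "?x \<le> real n powr (-Re s) + v powr (- Re s)"
      using norm_triangle_ineq4[of "complex_of_real (real n) powr (-s)" "of_real v powr (-s)"] v n1
      by (simp add: norm_powr_real_powr)
    also have "v powr (- Re s) \<le> real n powr (-Re s)"
      using v n1 s a by (intro powr_mono2') auto
    finally have 2: "?x \<le> 2 * real n powr (- Re s)" by simp
    have "?x = ?x powr (2*a) * ?x powr (1 - 2*a)"
      by (simp flip: powr_add)
    also have "\<dots> \<le> (norm s * real n powr (- Re s - 1)) powr (2*a) * (2 * real n powr (- Re s)) powr (1 - 2*a)"
      by (intro mult_mono powr_mono2 1 2) (use a in auto)
    also have "\<dots> = 2 powr (1 - 2*a) * norm s powr (2*a) * (real n powr ((- Re s - 1) * (2*a)) * real n powr (- Re s * (1 - 2*a)))"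
      by (simp add: powr_mult powr_powr mult_ac)
    also have "real n powr ((- Re s - 1) * (2*a)) * real n powr (- Re s * (1 - 2*a)) = real n powr (- Re s - 2 * a)"
      by (simp flip: powr_add add: algebra_simps)
    also have "2 powr (1 - 2*a) * norm s powr (2*a) * real n powr (- Re s - 2 * a) \<le> 2 powr 1 * norm s powr (2*a) * real n powr (-1-a)"
      by (intro mult_mono order_refl powr_mono) (use a n1 s in auto)
    finally show ?thesis by (simp add: M_def)
  qed
  \<comment> \<open>The map w -> (s-1) n^(-s) w + w^(1-s) has \<open>zeta_term n s\<close> as its
    increment over [n, n+1], and its derivative is (s-1)(n^(-s) - w^(-s)), which \<open>M\<close>
    controls.\<close>
  have "norm (((s - 1) * of_nat n powr (-s) * of_nat (Suc n) + of_nat (Suc n) powr (1 - s))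
            - ((s - 1) * of_nat n powr (-s) * of_nat n + of_nat n powr (1 - s)))
      \<le> (norm (s - 1) * M) * norm (of_nat (Suc n) - of_nat n :: complex)"
  proof (rule field_differentiable_bound[where S = ?S and f' = "\<lambda>w. (s - 1) * of_nat n powr (-s) + (1 - s) * w powr (-s)"
        and f = "\<lambda>w. (s - 1) * of_nat n powr (-s) * w + w powr (1 - s)"])
    fix w assume "w \<in> ?S"
    then obtain v where v: "w = of_real v" "real n \<le> v" "v \<le> real n + 1" using S by blast
    have "w \<notin> \<real>\<^sub>\<le>\<^sub>0" using v n1 by (auto simp: complex_nonpos_Reals_iff)
    then show "((\<lambda>w. (s - 1) * of_nat n powr (-s) * w + w powr (1 - s)) has_field_derivative 
        (s - 1) * of_nat n powr (-s) + (1 - s) * w powr (-s)) (at w within ?S)"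
      by (auto intro!: derivative_eq_intros)
    have "(s - 1) * of_nat n powr (-s) + (1 - s) * w powr (-s) = (s - 1) * (complex_of_real (real n) powr (-s) - of_real v powr (-s))"
      by (simp add: v algebra_simps)
    then show "norm ((s - 1) * of_nat n powr (-s) + (1 - s) * w powr (-s)) \<le> norm (s - 1) * M"
      using M[OF v(2,3)] by (simp add: norm_mult mult_left_mono)
  qed auto
  moreover have "((s - 1) * of_nat n powr (-s) * of_nat (Suc n) + of_nat (Suc n) powr (1 - s))
            - ((s - 1) * of_nat n powr (-s) * of_nat n + of_nat n powr (1 - s)) = zeta_term n s"
    by (simp add: zeta_term_def algebra_simps)
  moreover have "norm (of_nat (Suc n) - of_nat n :: complex) = 1" by simp
  ultimately show ?thesis by (simp add: M_def mult_ac)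
qed

lemma summable_Suc_powr: "b > 1 \<Longrightarrow> summable (\<lambda>n. real (Suc n) powr (-b))"
  using summable_real_powr_iff[of "-b"] summable_Suc_iff[of "\<lambda>n. real n powr (-b)"] by simp

text \<open>\<open>zeta_num s\<close> is \<open>(s - 1) \<zeta>(s)\<close>, continued to the left of the line \<open>Re s = 1\<close>.\<close>

definition zeta_num :: "complex \<Rightarrow> complex" where
  "zeta_num s = 1 + (\<Sum>n. zeta_term (Suc n) s)"

lemma summable_zeta_term:
  assumes "Re s \<ge> 3/4"
  shows "summable (\<lambda>n. norm (zeta_term (Suc n) s))"
proof (rule summable_comparison_test')
  show "summable (\<lambda>n. norm (s - 1) * (2 * norm s powr (2 * (1/4))) * real (Suc n) powr (- (1 + 1/4)))"
    by (intro summable_mult summable_Suc_powr) simp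
  show "norm (norm (zeta_term (Suc n) s)) \<le> norm (s - 1) * (2 * norm s powr (2 * (1/4))) * real (Suc n) powr (- (1 + 1/4))" for n
    using norm_zeta_term_le[of "Suc n" "1/4" s] assms by (simp del: of_nat_Suc)
qed

text \<open>The point is the freedom in \<open>a\<close>: zeta grows more slowly than any given
  positive power of |s| on a strip that reaches a little beyond Re s = 1. Dividing by s - 1 later
  removes the factor \<open>norm (s - 1)\<close>.\<close>

lemma norm_zeta_num_minus_1_le:
  assumes "0 < a" "a \<le> 1/4"
  shows "\<exists>C>0. \<forall>s. Re s \<ge> 1 - a \<longrightarrow> norm (zeta_num s - 1) \<le> C * norm (s - 1) * norm s powr (2 * a)"
proof -
  define K where "K = (\<Sum>n. real (Suc n) powr (- (1 + a)))"
  have K: "K > 0" unfolding K_def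
    by (intro suminf_pos summable_Suc_powr) (use assms in auto)
  show ?thesis
  proof (intro exI[of _ "2 * K"] conjI allI impI)
    fix s assume s: "Re s \<ge> 1 - a"
    have "norm (zeta_num s - 1) \<le> (\<Sum>n. norm (zeta_term (Suc n) s))"
      unfolding zeta_num_def using assms s by (auto intro!: summable_norm summable_zeta_term)
    also have "\<dots> \<le> (\<Sum>n. norm (s - 1) * (2 * norm s powr (2 * a)) * real (Suc n) powr (- (1 + a)))"
    proof (rule suminf_le)
      show "norm (zeta_term (Suc n) s) \<le> norm (s - 1) * (2 * norm s powr (2 * a)) * real (Suc n) powr (- (1 + a))" for n
        using norm_zeta_term_le[of "Suc n" a s] assms s by (simp del: of_nat_Suc)
      show "summable (\<lambda>n. norm (zeta_term (Suc n) s))" by (rule summable_zeta_term) (use assms s in auto)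
    qed (intro summable_mult summable_Suc_powr, use assms in auto)
    also have "\<dots> = 2 * K * norm (s - 1) * norm s powr (2 * a)"
      unfolding K_def using assms by (subst suminf_mult[OF summable_Suc_powr]) auto
    finally show "norm (zeta_num s - 1) \<le> 2 * K * norm (s - 1) * norm s powr (2 * a)" .
  qed (use K in auto)
qed

lemma holomorphic_zeta_num: "zeta_num holomorphic_on {s. Re s > 3/4}"
proof -
  have hol: "zeta_term (Suc n) holomorphic_on A" for n A
    unfolding zeta_term_def by (intro holomorphic_intros) (auto simp del: of_nat_Suc)
  have "(\<lambda>s. \<Sum>n. zeta_term (Suc n) s) holomorphic_on {s. Re s > 3/4}"
  proof (rule holomorphic_uniform_sequence[where f = "\<lambda>n s. \<Sum>i<n. zeta_term (Suc i) s"])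
    show "open {s. Re s > 3/4}" by (rule open_halfspace_Re_gt)
    show "(\<lambda>s. \<Sum>i<n. zeta_term (Suc i) s) holomorphic_on {s. Re s > 3/4}" for n
      by (intro holomorphic_intros hol)
    fix s0 :: complex assume "s0 \<in> {s. Re s > 3/4}"
    then obtain d where d: "d > 0" "cball s0 d \<subseteq> {s. Re s > 3/4}"
      using open_halfspace_Re_gt[of "3/4"] open_contains_cball by blast
    define B where "B = norm s0 + d"
    have B: "norm s \<le> B" if "s \<in> cball s0 d" for s
      using that norm_triangle_ineq2[of s s0] by (simp add: B_def dist_norm norm_minus_commute)
    show "\<exists>d>0. cball s0 d \<subseteq> {s. Re s > 3/4} \<and> uniform_limit (cball s0 d) (\<lambda>n s. \<Sum>i<n. zeta_term (Suc i) s) (\<lambda>s. \<Sum>n. zeta_term (Suc n) s) sequentially"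
    proof (intro exI[of _ d] conjI d)
      show "uniform_limit (cball s0 d) (\<lambda>n s. \<Sum>i<n. zeta_term (Suc i) s) (\<lambda>s. \<Sum>n. zeta_term (Suc n) s) sequentially"
      proof (rule Weierstrass_m_test)
        show "summable (\<lambda>n. (B + 1) * (2 * B powr (2 * (1/4))) * real (Suc n) powr (- (1 + 1/4)))"
          by (intro summable_mult summable_Suc_powr) simp
        fix n s assume s: "s \<in> cball s0 d"
        have "norm (zeta_term (Suc n) s) \<le> norm (s - 1) * (2 * norm s powr (2 * (1/4))) * real (Suc n) powr (- (1 + 1/4))"
          using norm_zeta_term_le[of "Suc n" "1/4" s] s d by (force simp del: of_nat_Suc)
        also have "\<dots> \<le> (B + 1) * (2 * B powr (2 * (1/4))) * real (Suc n) powr (- (1 + 1/4))"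
          using B[OF s] norm_triangle_ineq4[of s 1] order_trans[OF norm_ge_zero B[OF s]]
          by (intro mult_right_mono mult_mono mult_left_mono powr_mono2) auto
        finally show "norm (zeta_term (Suc n) s) \<le> (B + 1) * (2 * B powr (2 * (1/4))) * real (Suc n) powr (- (1 + 1/4))" .
      qed
    qed
  qed
  then show ?thesis unfolding zeta_num_def by (intro holomorphic_intros)
qed

lemma zeta_num_1 [simp]: "zeta_num 1 = 1"
  by (simp add: zeta_num_def zeta_term_def del: of_nat_Suc)

lemma norm_nat_powr: "n > 0 \<Longrightarrow> norm (of_nat n powr s :: complex) = real n powr Re s"
  using norm_powr_real_powr[of "of_nat n" s] by simp

lemma sums_zeta_num:
  assumes "Re s > 1"
  shows "(\<lambda>n. of_nat (Suc n) powr (-s)) sums (zeta_num s / (s - 1))"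
proof -
  have s1: "s \<noteq> 1" using assms by auto
  \<comment> \<open>The integral parts telescope; the boundary term that they leave tends to 0 for
    Re s > 1.\<close>
  have eq: "(\<Sum>i<n. zeta_term (Suc i) s) = (s - 1) * (\<Sum>i<n. of_nat (Suc i) powr (-s)) + of_nat (Suc n) powr (1 - s) - 1" for n
    by (induction n) (simp_all add: zeta_term_def algebra_simps del: of_nat_Suc, simp)
  have "(\<lambda>n. \<Sum>i<n. zeta_term (Suc i) s) \<longlonglongrightarrow> zeta_num s - 1"
    unfolding zeta_num_def using summable_norm_cancel[OF summable_zeta_term[of s]] assms
    by (simp add: summable_LIMSEQ)
  moreover have "(\<lambda>n. of_nat (Suc n) powr (1 - s)) \<longlonglongrightarrow> 0"
  proof (rule tendsto_norm_zero_cancel)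
    have "(\<lambda>n. real (Suc n) powr (1 - Re s)) \<longlonglongrightarrow> 0"
      using assms by real_asymp
    then show "(\<lambda>n. norm (of_nat (Suc n) powr (1 - s) :: complex)) \<longlonglongrightarrow> 0"
      by (simp add: norm_nat_powr del: of_nat_Suc)
  qed
  ultimately have "(\<lambda>n. ((\<Sum>i<n. zeta_term (Suc i) s) - of_nat (Suc n) powr (1 - s) + 1) / (s - 1)) \<longlonglongrightarrow> (zeta_num s - 1 - 0 + 1) / (s - 1)"
    using s1 by (intro tendsto_intros) auto
  then show ?thesis unfolding sums_def eq using s1 by simp
qed

section \<open>Euler products\<close>

definition omega :: "nat \<Rightarrow> nat" where "omega n = card (prime_factors n)"

lemma omega_1 [simp]: "omega (Suc 0) = 0"
  by (simp add: omega_def)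

lemma omega_prime_mult:
  assumes "prime p" "m > 0"
  shows "omega (p * m) = (if p dvd m then omega m else Suc (omega m))"
proof -
  have "prime_factors (p * m) = insert p (prime_factors m)"
    using assms by (subst prime_factors_product) (auto simp: prime_prime_factors)
  moreover have "p \<in> prime_factors m \<longleftrightarrow> p dvd m"
    using assms by (auto simp: prime_factors_dvd)
  ultimately show ?thesis
    by (auto simp: omega_def insert_absorb)
qed

text \<open>With m = max 1 R, only the primes p \<le> K violate m \<le> p^e. There are at most K of
  them and each costs a factor m, whence the constant m^K, uniform in r. The other prime factors are
  absorbed by the radical of n raised to the power e.\<close>

lemma power_omega_le:
  fixes R e :: real
  assumes "R > 0" "e > 0"
  shows "\<exists>C>0. \<forall>r n. 0 \<le> r \<longrightarrow> r \<le> R \<longrightarrow> n > 0 \<longrightarrow> r ^ omega n \<le> C * real n powr e"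
proof -
  define m where "m = max 1 R"
  define K where "K = nat \<lceil>m powr (1 / e)\<rceil>"
  have m: "m \<ge> 1" "m \<ge> R" "m > 0" by (auto simp: m_def)
  have K: "real k powr e \<ge> m" if "k > K" for k
  proof -
    have "m = (m powr (1/e)) powr e" using assms m by (simp add: powr_powr)
    also have "\<dots> \<le> real k powr e"
      using that assms by (intro powr_mono2) (auto simp: K_def, linarith)
    finally show ?thesis .
  qed
  show ?thesis
  proof (intro exI[of _ "m ^ K"] conjI allI impI)
    fix r :: real and n :: nat assume r: "0 \<le> r" "r \<le> R" and n: "n > 0"
    let ?P = "prime_factors n"
    have P: "p \<ge> 1" if "p \<in> ?P" for p using that prime_ge_1_nat by auto
    have "r ^ omega n = (\<Prod>p\<in>?P. r)" by (simp add: omega_def)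
    also have "\<dots> \<le> (\<Prod>p\<in>?P. (if p \<le> K then m else 1) * real p powr e)"
    proof (intro prod_mono conjI r)
      fix p assume p: "p \<in> ?P"
      have "1 \<le> real p powr e" using P[OF p] assms by (intro ge_one_powr_ge_zero) auto
      then have "m * 1 \<le> m * real p powr e" using m by (intro mult_left_mono) auto
      then show "r \<le> (if p \<le> K then m else 1) * real p powr e"
        using K[of p] r m by (cases "p \<le> K") (auto intro: order_trans)
    qed
    also have "\<dots> = (\<Prod>p\<in>?P. (if p \<le> K then m else 1)) * (\<Prod>p\<in>?P. real p powr e)"
      by (rule prod.distrib)
    finally have 0: "r ^ omega n \<le> (\<Prod>p\<in>?P. (if p \<le> K then m else 1)) * (\<Prod>p\<in>?P. real p powr e)" .
    have "(\<Prod>p\<in>?P. (if p \<le> K then m else 1)) = m ^ card (?P \<inter> {p. p \<le> K})"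
      by (simp add: prod.If_cases)
    also have "\<dots> \<le> m ^ K"
    proof (rule power_increasing)
      have "card (?P \<inter> {p. p \<le> K}) \<le> card {1..K}"
        using P by (intro card_mono) auto
      then show "card (?P \<inter> {p. p \<le> K}) \<le> K" by simp
    qed (use m in auto)
    finally have "(\<Prod>p\<in>?P. (if p \<le> K then m else 1)) * (\<Prod>p\<in>?P. real p powr e) \<le> m ^ K * (\<Prod>p\<in>?P. real p powr e)"
      by (intro mult_right_mono prod_nonneg) auto
    with 0 have 1: "r ^ omega n \<le> m ^ K * (\<Prod>p\<in>?P. real p) powr e"
      by (simp add: prod_powr_distrib)
    have "(\<Prod>p\<in>?P. real p) \<le> (\<Prod>p\<in>?P. real p ^ multiplicity p n)"
    proof (intro prod_mono conjI)
      fix p assume p: "p \<in> ?P"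
      have "multiplicity p n \<ge> 1"
        using p n by (auto simp: prime_factors_multiplicity)
      then have "real p ^ 1 \<le> real p ^ multiplicity p n"
        using P[OF p] by (intro power_increasing) auto
      then show "real p \<le> real p ^ multiplicity p n" by simp
    qed auto
    also have "(\<Prod>p\<in>?P. real p ^ multiplicity p n) = real n"
      using prod_prime_factors[of n] n by (simp flip: of_nat_power of_nat_prod)
    finally have "(\<Prod>p\<in>?P. real p) powr e \<le> real n powr e"
      using assms by (intro powr_mono2 prod_nonneg) auto
    then have "m ^ K * (\<Prod>p\<in>?P. real p) powr e \<le> m ^ K * real n powr e"
      using m by (intro mult_left_mono) auto
    then show "r ^ omega n \<le> m ^ K * real n powr e" using 1 by linarith
  qed (use m in auto)
qed

definition omega_dterm :: "real \<Rightarrow> complex \<Rightarrow> nat \<Rightarrow> complex" where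
  "omega_dterm r s n = of_real (r ^ omega n) * of_nat n powr (-s)"

definition rough :: "nat \<Rightarrow> nat set" where
  "rough N = {n. n > 0 \<and> (\<forall>p. prime p \<longrightarrow> p dvd n \<longrightarrow> N \<le> p)}"

lemma norm_omega_dterm: "n > 0 \<Longrightarrow> r \<ge> 0 \<Longrightarrow> norm (omega_dterm r s n) = r ^ omega n * real n powr (- Re s)"
  by (simp add: omega_dterm_def norm_mult norm_nat_powr norm_power)

lemma omega_dterm_summable_norm:
  assumes "Re s > 1" "r \<ge> 0"
  shows "summable (\<lambda>n. norm (omega_dterm r s n))"
proof -
  define e where "e = (Re s - 1) / 2"
  have e: "e > 0" using assms by (simp add: e_def)
  have "max r 1 > 0" by simp
  then obtain C where C: "C > 0" "\<And>r' n. 0 \<le> r' \<Longrightarrow> r' \<le> max r 1 \<Longrightarrow> n > 0 \<Longrightarrow> r' ^ omega n \<le> C * real n powr e"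
    using power_omega_le[OF _ e] by meson
  show ?thesis
  proof (rule summable_comparison_test')
    show "summable (\<lambda>n. C * real n powr (- (1 + e)))"
      by (intro summable_mult) (use e in \<open>simp add: summable_real_powr_iff\<close>)
    fix n :: nat assume n: "n \<ge> 1"
    have "norm (omega_dterm r s n) \<le> C * real n powr e * real n powr (- Re s)"
      using C(2)[of r n] assms n by (simp add: norm_omega_dterm mult_right_mono)
    also have "\<dots> = C * real n powr (-(1 + e))"
      using n by (simp add: e_def mult.assoc flip: powr_add) (simp add: field_simps)
    finally show "norm (norm (omega_dterm r s n)) \<le> C * real n powr (-(1 + e))" by simp
  qed
qed

lemma omega_dterm_summable_on:
  assumes "Re s > 1" "r \<ge> 0"
  shows "omega_dterm r s summable_on A"
  using norm_summable_imp_summable_on[OF omega_dterm_summable_norm[OF assms]]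
  by (rule summable_on_subset_banach) auto

definition euler_factor :: "real \<Rightarrow> nat \<Rightarrow> complex \<Rightarrow> complex" where
  "euler_factor r p s = (if prime p then 1 + of_real r * of_nat p powr (-s) / (1 - of_nat p powr (-s)) else 1)"

lemma norm_prime_powr_lt:
  assumes "prime (p::nat)" "Re s \<ge> 3/4"
  shows "norm (of_nat p powr (-s) :: complex) \<le> 3/5"
proof -
  have p: "p \<ge> 2" using assms prime_ge_2_nat by auto
  have "norm (of_nat p powr (-s) :: complex) = real p powr (- Re s)"
    using p by (simp add: norm_nat_powr)
  also have "\<dots> \<le> 2 powr (- Re s)" using p assms by (intro powr_mono2') auto
  also have "\<dots> \<le> 2 powr (- (3/4))" using assms by (intro powr_mono) auto
  \<comment> \<open>Fourth powers: 2^(-3) = 1/8 is below 81/625.\<close>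
  also have "\<dots> \<le> 3/5"
  proof (rule power_le_imp_le_base)
    have "(2 powr (-(3/4)) :: real) ^ Suc 3 = 2 powr (-3)"
      by (simp add: powr_powr flip: powr_realpow powr_add)
    also have "\<dots> = 1 / 8" by (simp add: powr_minus_divide)
    finally show "(2 powr (-(3/4)) :: real) ^ Suc 3 \<le> (3/5) ^ Suc 3" by (simp add: power_numeral_reduce)
  qed auto
  finally show ?thesis .
qed

text \<open>Sieving by one number \<open>N\<close>. If \<open>N\<close> is prime and z = N^(-s),
  split the sum into the part B not divisible by N and the part P of the multiples N m. Passing from
  m to N m adds to omega only if N does not divide m, so P = r z B + z P; solving for P produces the
  Euler factor.\<close>

lemma infsum_rough_step:
  assumes s: "Re s > 1" and r: "r \<ge> 0"
  shows "infsum (omega_dterm r s) (rough N) = euler_factor r N s * infsum (omega_dterm r s) (rough (Suc N))"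
proof (cases "prime N")
  case False
  have "rough N = rough (Suc N)"
    using False unfolding rough_def by (metis Suc_leD Suc_leI order_le_less)
  then show ?thesis using False by (simp add: euler_factor_def)
next
  case True
  define z :: complex where "z = of_nat N powr (-s)"
  have "norm z < 1" using norm_prime_powr_lt[of N s] True s by (simp add: z_def)
  then have z1: "1 - z \<noteq> 0" by (metis eq_iff_diff_eq_0 norm_one order_less_irrefl)
  note sm = omega_dterm_summable_on[OF s r]
  let ?t = "omega_dterm r s"
  define P where "P = infsum ?t {n\<in>rough N. N dvd n}"
  define B where "B = infsum ?t (rough (Suc N))"
  have R: "rough (Suc N) = {n \<in> rough N. \<not> N dvd n}"
  proof (intro equalityI subsetI)
    fix n assume "n \<in> rough (Suc N)"
    then have n: "n > 0" "\<And>p. prime p \<Longrightarrow> p dvd n \<Longrightarrow> Suc N \<le> p" unfolding rough_def by blast+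
    have "\<not> N dvd n" using n(2)[OF True] by linarith
    moreover have "N \<le> p" if "prime p" "p dvd n" for p using n(2)[OF that] by linarith
    ultimately show "n \<in> {n \<in> rough N. \<not> N dvd n}" using n(1) unfolding rough_def by blast
  next
    fix n assume "n \<in> {n \<in> rough N. \<not> N dvd n}"
    then have n: "n > 0" "\<And>p. prime p \<Longrightarrow> p dvd n \<Longrightarrow> N \<le> p" "\<not> N dvd n" unfolding rough_def by blast+
    have "Suc N \<le> p" if "prime p" "p dvd n" for p using n(2)[OF that] n(3) that by (metis Suc_leI le_neq_implies_less)
    then show "n \<in> rough (Suc N)" using n(1) unfolding rough_def by blast
  qed
  have N0: "N > 0" using True prime_gt_0_nat by blast
  have "infsum ?t (rough N) = infsum ?t (rough (Suc N) \<union> {n\<in>rough N. N dvd n})"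
    by (rule arg_cong[where f = "infsum ?t"]) (auto simp: R)
  also have "\<dots> = B + P"
    unfolding B_def P_def by (rule infsum_Un_disjoint) (auto simp: R sm)
  finally have 1: "infsum ?t (rough N) = B + P" .
  have bij: "bij_betw (\<lambda>m. N * m) (rough N) {n\<in>rough N. N dvd n}"
    unfolding bij_betw_def
  proof
    show "inj_on ((*) N) (rough N)" using N0 by (auto intro: inj_onI)
    show "(*) N ` rough N = {n \<in> rough N. N dvd n}"
    proof safe
      fix m assume m: "m \<in> rough N"
      have "N \<le> q" if "prime q" "q dvd N * m" for q
        using that True m primes_dvd_imp_eq[of q N] by (auto simp: rough_def prime_dvd_mult_iff)
      then show "N * m \<in> rough N" using m N0 by (auto simp: rough_def)
    next
      fix n assume n: "n \<in> rough N" "N dvd n"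
      then obtain m where m: "n = N * m" by auto
      then have "m \<in> rough N" using n(1) N0 by (auto simp: rough_def)
      then show "n \<in> (*) N ` rough N" using m by auto
    qed auto
  qed
  have "P = infsum (\<lambda>m. ?t (N * m)) (rough N)"
    unfolding P_def by (rule infsum_reindex_bij_betw[OF bij, symmetric])
  also have "\<dots> = infsum (\<lambda>m. ?t (N * m)) (rough (Suc N) \<union> {n\<in>rough N. N dvd n})"
    by (rule arg_cong[where f = "infsum _"]) (auto simp: R)
  also have "\<dots> = infsum (\<lambda>m. ?t (N * m)) (rough (Suc N)) + infsum (\<lambda>m. ?t (N * m)) {n\<in>rough N. N dvd n}"
  proof (rule infsum_Un_disjoint)
    have *: "(\<lambda>m. ?t (N * m)) summable_on (rough N)"
      using summable_on_reindex_bij_betw[OF bij, of ?t] sm by simp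
    show "(\<lambda>m. ?t (N * m)) summable_on (rough (Suc N))" "(\<lambda>m. ?t (N * m)) summable_on {n\<in>rough N. N dvd n}"
      by (rule summable_on_subset_banach[OF *]; auto simp: R)+
  qed (auto simp: R)
  also have "infsum (\<lambda>m. ?t (N * m)) (rough (Suc N)) = infsum (\<lambda>m. (of_real r * z) * ?t m) (rough (Suc N))"
    using True by (intro infsum_cong) (auto simp: R rough_def omega_dterm_def omega_prime_mult z_def powr_times_real)
  also have "\<dots> = of_real r * z * B" unfolding B_def by (intro infsum_cmult_right sm)
  also have "infsum (\<lambda>m. ?t (N * m)) {n\<in>rough N. N dvd n} = infsum (\<lambda>m. z * ?t m) {n\<in>rough N. N dvd n}"
    using True by (intro infsum_cong) (auto simp: rough_def omega_dterm_def omega_prime_mult z_def powr_times_real)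
  also have "\<dots> = z * P" unfolding P_def by (intro infsum_cmult_right sm)
  finally have "P * (1 - z) = of_real r * z * B" by (simp add: algebra_simps)
  then have "P = of_real r * z * B / (1 - z)" using z1 by (simp add: field_simps)
  then show ?thesis using 1 z1 True
    by (simp add: euler_factor_def B_def[symmetric] z_def[symmetric] field_simps)
qed

definition omega_dseries :: "real \<Rightarrow> complex \<Rightarrow> complex" where
  "omega_dseries r s = (\<Sum>n. omega_dterm r s (Suc n))"

lemma omega_dseries_infsum:
  assumes "Re s > 1" "r \<ge> 0"
  shows "omega_dseries r s = infsum (omega_dterm r s) (rough 0)"
proof -
  have "((\<lambda>n. omega_dterm r s (Suc n)) has_sum omega_dseries r s) UNIV"
    unfolding omega_dseries_def
    using omega_dterm_summable_norm[OF assms] summable_Suc_iff[of "\<lambda>n. norm (omega_dterm r s n)"]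
    by (intro norm_summable_imp_has_sum summable_sums) (auto intro: summable_norm_cancel)
  moreover have "bij_betw Suc UNIV (rough 0)"
    by (auto simp: bij_betw_def rough_def image_iff gr0_conv_Suc)
  ultimately show ?thesis
    using has_sum_reindex_bij_betw[of Suc UNIV "rough 0" "omega_dterm r s" "omega_dseries r s"] by (simp add: infsumI)
qed

text \<open>Apart from 1, a number without prime factors below N is at least N, so what remains is
  bounded by a tail of an absolutely convergent series.\<close>

lemma infsum_rough_tendsto:
  assumes "Re s > 1" "r \<ge> 0"
  shows "(\<lambda>N. infsum (omega_dterm r s) (rough N)) \<longlonglongrightarrow> 1"
proof (rule LIM_zero_cancel, rule Lim_null_comparison)
  note sm = omega_dterm_summable_on[OF assms]
  let ?g = "\<lambda>n. norm (omega_dterm r s n)"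
  note sg = omega_dterm_summable_norm[OF assms]
  have gon: "?g summable_on A" for A
    using norm_summable_imp_summable_on[of ?g] sg
    by (rule_tac summable_on_subset_banach[of ?g UNIV]) simp_all
  show "\<forall>\<^sub>F N in sequentially. norm (infsum (omega_dterm r s) (rough N) - 1) \<le> suminf ?g - sum ?g {..<N}"
  proof (rule eventually_mono[OF eventually_ge_at_top[of 2]])
    fix N :: nat assume N: "N \<ge> 2"
    have 1: "1 \<in> rough N" using N by (auto simp: rough_def)
    have "infsum (omega_dterm r s) (rough N) = infsum (omega_dterm r s) ({1} \<union> (rough N - {1}))"
      using 1 by (simp add: insert_absorb)
    also have "\<dots> = 1 + infsum (omega_dterm r s) (rough N - {1})"
      by (subst infsum_Un_disjoint) (auto simp: sm omega_dterm_def)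
    finally have "norm (infsum (omega_dterm r s) (rough N) - 1) = norm (infsum (omega_dterm r s) (rough N - {1}))" by simp
    also have "\<dots> \<le> infsum ?g (rough N - {1})"
      by (rule norm_infsum_bound) (rule gon)
    also have "\<dots> \<le> infsum ?g {N..}"
    proof (rule infsum_mono2[OF gon gon])
      show "rough N - {1} \<subseteq> {N..}"
      proof
        fix n assume n: "n \<in> rough N - {1}"
        then obtain p where p: "prime p" "p dvd n" using prime_factor_nat[of n] by auto
        then have "N \<le> p" "p \<le> n" using n by (auto simp: rough_def dvd_imp_le)
        then show "n \<in> {N..}" by simp
      qed
    qed auto
    also have "\<dots> = suminf ?g - sum ?g {..<N}"
    proof -
      have "infsum ?g UNIV = suminf ?g"
        using norm_summable_imp_has_sum[of ?g] sg by (simp add: infsumI summable_sums)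
      moreover have "infsum ?g UNIV = infsum ?g ({..<N} \<union> {N..})"
        by (rule arg_cong[where f = "infsum _"]) auto
      moreover have "\<dots> = infsum ?g {..<N} + infsum ?g {N..}"
        by (rule infsum_Un_disjoint) (auto intro: gon)
      ultimately show ?thesis by simp
    qed
    finally show "norm (infsum (omega_dterm r s) (rough N) - 1) \<le> suminf ?g - sum ?g {..<N}" .
  qed
  have "(\<lambda>N. suminf ?g - sum ?g {..<N}) \<longlonglongrightarrow> suminf ?g - suminf ?g"
    by (intro tendsto_intros summable_LIMSEQ sg)
  then show "(\<lambda>N. suminf ?g - sum ?g {..<N}) \<longlonglongrightarrow> 0" by simp
qed

text \<open>After N sieving steps the series equals the partial product times a sum over rough
  numbers. That sum tends to 1, so it is nonzero for large N and can be divided out.\<close>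

lemma euler_product_tendsto:
  assumes "Re s > 1" "r \<ge> 0"
  shows "(\<lambda>N. \<Prod>p<N. euler_factor r p s) \<longlonglongrightarrow> omega_dseries r s"
proof -
  let ?D = "\<lambda>N. infsum (omega_dterm r s) (rough N)"
  have eq: "omega_dseries r s = (\<Prod>p<N. euler_factor r p s) * ?D N" for N
  proof (induction N)
    case 0
    then show ?case by (simp add: omega_dseries_infsum assms)
  next
    case (Suc N)
    then show ?case using infsum_rough_step[OF assms, of N] by (simp add: mult_ac)
  qed
  note lim = infsum_rough_tendsto[OF assms]
  have "(\<lambda>N. omega_dseries r s / ?D N) \<longlonglongrightarrow> omega_dseries r s / 1"
    by (intro tendsto_intros lim) auto
  moreover have "\<forall>\<^sub>F N in sequentially. omega_dseries r s / ?D N = (\<Prod>p<N. euler_factor r p s)"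
  proof (rule eventually_mono[OF tendsto_imp_eventually_ne[OF lim, of 0]])
    fix N assume "?D N \<noteq> 0"
    then show "omega_dseries r s / ?D N = (\<Prod>p<N. euler_factor r p s)"
      by (simp add: eq[of N])
  qed simp
  ultimately show ?thesis
    using Lim_transform_eventually by fastforce
qed

lemma omega_dseries_1:
  assumes "Re s > 1"
  shows "omega_dseries 1 s = zeta_num s / (s - 1)"
  using sums_zeta_num[OF assms] by (simp add: omega_dseries_def omega_dterm_def sums_iff)

section \<open>The logarithm of zeta for Re s > 1 and the 3-4-1 inequality\<close>

definition log_zeta_term :: "nat \<Rightarrow> complex \<Rightarrow> complex" where
  "log_zeta_term p s = (if prime p then - Ln (1 - of_nat p powr (-s)) else 0)"

text \<open>Adding the principal logarithms of the Euler factors selects a continuous branch of the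
  logarithm of zeta on the whole half-plane Re s > 1. Real powers of zeta are formed with this
  branch; \<open>Ln\<close> of zeta itself could jump.\<close>

definition log_zeta :: "complex \<Rightarrow> complex" where
  "log_zeta s = (\<Sum>p. log_zeta_term p s)"

lemma norm_log_zeta_term_le:
  assumes "b > 1" "Re s \<ge> b"
  shows "norm (log_zeta_term p s) \<le> 2 * real p powr (-b)"
proof (cases "prime p")
  case True
  then have p: "p \<ge> 2" using prime_ge_2_nat by auto
  have eq: "norm (of_nat p powr (-s) :: complex) = real p powr (- Re s)"
    using p by (simp add: norm_nat_powr)
  have "real p powr (- Re s) \<le> real p powr (-b)" using assms p by (intro powr_mono) auto
  moreover have "real p powr (-b) < real p powr (-1)" using assms p by (intro powr_less_mono) auto
  moreover have "real p powr (-1) \<le> 1/2" using p by (simp add: powr_minus_divide)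
  ultimately have *: "real p powr (- Re s) \<le> real p powr (-b)" "real p powr (- Re s) < 1/2" by linarith+
  then have "norm (Ln (1 + - (of_nat p powr (-s)))) \<le> 2 * norm (- (of_nat p powr (-s)) :: complex)"
    by (intro norm_Ln_le) (simp add: eq)
  then have "norm (Ln (1 - of_nat p powr (-s))) \<le> 2 * real p powr (- Re s)"
    by (simp add: eq)
  then show ?thesis using * True by (simp add: log_zeta_term_def)
qed (auto simp: log_zeta_term_def)

lemma summable_log_zeta_term:
  assumes "Re s > 1"
  shows "summable (\<lambda>p. log_zeta_term p s)"
proof (rule summable_comparison_test')
  show "summable (\<lambda>p. 2 * real p powr (- Re s))"
    by (intro summable_mult) (use assms in \<open>simp add: summable_real_powr_iff\<close>)
  show "norm (log_zeta_term p s) \<le> 2 * real p powr (- Re s)" for p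
    by (rule norm_log_zeta_term_le) (use assms in auto)
qed

lemma continuous_on_log_zeta: "continuous_on {s. Re s > 1} log_zeta"
proof -
  have "continuous_on {s. Re s > b} log_zeta" if b: "b > 1" for b
    unfolding log_zeta_def
  proof (rule uniform_limit_theorem)
    show "uniform_limit {s. Re s > b} (\<lambda>N s. \<Sum>p<N. log_zeta_term p s) (\<lambda>s. \<Sum>p. log_zeta_term p s) sequentially"
    proof (rule Weierstrass_m_test)
      show "summable (\<lambda>p. 2 * real p powr (- b))"
        by (intro summable_mult) (use b in \<open>simp add: summable_real_powr_iff\<close>)
      show "norm (log_zeta_term p s) \<le> 2 * real p powr (- b)" if "s \<in> {s. Re s > b}" for p s
        by (rule norm_log_zeta_term_le) (use that b in auto)
    qed
    have "continuous_on {s. Re s > b} (log_zeta_term p)" for p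
    proof (cases "prime p")
      case True
      then have p: "p > 0" by (rule prime_gt_0_nat)
      have "1 - of_nat p powr (-s) \<notin> \<real>\<^sub>\<le>\<^sub>0" if "s \<in> {s. Re s > b}" for s
      proof -
        have "norm (of_nat p powr (-s) :: complex) < 1"
          using norm_prime_powr_lt[OF True, of s] that b by auto
        then have "Re (of_nat p powr (-s)) < 1" using complex_Re_le_cmod[of "of_nat p powr (-s)"] by linarith
        then show ?thesis by (auto simp: complex_nonpos_Reals_iff)
      qed
      then have "continuous_on {s. Re s > b} (\<lambda>s. - Ln (1 - of_nat p powr (-s)))"
        using p by (intro continuous_intros) auto
      then show ?thesis using True by (simp add: log_zeta_term_def[abs_def])
    qed (auto simp: log_zeta_term_def[abs_def])
    then show "\<forall>\<^sub>F N in sequentially. continuous_on {s. Re s > b} (\<lambda>s. \<Sum>p<N. log_zeta_term p s)"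
      by (intro always_eventually allI continuous_on_sum)
  qed auto
  then have "continuous_on (\<Union>b\<in>{1<..}. {s. Re s > b}) log_zeta"
    by (intro continuous_on_open_UN) (auto simp: open_halfspace_Re_gt)
  also have "(\<Union>b\<in>{1<..}. {s. Re s > b}) = {s. Re s > 1}"
    using dense[of 1] by auto
  finally show ?thesis .
qed

lemma exp_log_zeta:
  assumes s: "Re s > 1"
  shows "exp (log_zeta s) = zeta_num s / (s - 1)"
proof -
  have "exp (log_zeta_term p s) = euler_factor 1 p s" for p
  proof (cases "prime p")
    case True
    have "norm (of_nat p powr (-s) :: complex) < 1"
      using norm_prime_powr_lt[OF True, of s] s by auto
    then have "1 - of_nat p powr (-s) \<noteq> (0::complex)" by (metis eq_iff_diff_eq_0 norm_one order_less_irrefl)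
    then show ?thesis using True by (simp add: log_zeta_term_def euler_factor_def exp_minus field_simps)
  qed (auto simp: log_zeta_term_def euler_factor_def)
  then have eq: "(\<Prod>p<N. euler_factor 1 p s) = exp (\<Sum>p<N. log_zeta_term p s)" for N
    by (simp add: exp_sum)
  have "(\<lambda>N. exp (\<Sum>p<N. log_zeta_term p s)) \<longlonglongrightarrow> exp (log_zeta s)"
    unfolding log_zeta_def by (intro tendsto_intros summable_LIMSEQ summable_log_zeta_term s)
  moreover have "(\<lambda>N. exp (\<Sum>p<N. log_zeta_term p s)) \<longlonglongrightarrow> omega_dseries 1 s"
    using euler_product_tendsto[OF s, of 1] by (simp add: eq)
  ultimately show ?thesis using omega_dseries_1[OF s] LIMSEQ_unique by metis
qed

text \<open>Expanding the logarithms, the coefficient of q^n/n is 3 + 4 cos(n x) + cos(2 n x) = 2 (1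
  + cos(n x))^2.\<close>

lemma Re_log_341_nonneg:
  fixes q x :: real
  assumes "0 \<le> q" "q < 1"
  shows "Re (3 * (- Ln (1 - of_real q)) + 4 * (- Ln (1 - of_real q * cis x)) + (- Ln (1 - of_real q * cis (2 * x)))) \<ge> 0"
proof -
  \<comment> \<open>The series runs from n = 0, where the term is 0 because division by zero gives
    0.\<close>
  have L: "(\<lambda>n. z ^ n / of_nat n) sums (- Ln (1 - z))" if "norm z < 1" for z :: complex
    using sums_minus[OF Ln_series'[of "-z"]] that by simp
  have "norm (of_real q * cis y) < 1" for y using assms by (simp add: norm_mult)
  note L2 = L[OF this]
  have S: "(\<lambda>n. Re (3 * ((of_real q * cis 0) ^ n / of_nat n) + 4 * ((of_real q * cis x) ^ n / of_nat n) + ((of_real q * cis (2 * x)) ^ n / of_nat n)))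
     sums Re (3 * (- Ln (1 - of_real q * cis 0)) + 4 * (- Ln (1 - of_real q * cis x)) + (- Ln (1 - of_real q * cis (2 * x))))"
    by (intro sums_Re sums_add sums_mult L2)
  have N: "Re (3 * ((of_real q * cis 0) ^ n / of_nat n) + 4 * ((of_real q * cis x) ^ n / of_nat n) + ((of_real q * cis (2 * x)) ^ n / of_nat n)) \<ge> 0" for n
  proof -
    have cis: "(of_real q * cis y) ^ n / of_nat n = of_real (q ^ n / real n) * cis (real n * y)" for y
      by (simp add: power_mult_distrib Complex.DeMoivre)
    have "real n * (2 * x) = 2 * (real n * x)" by simp
    then have "cos (real n * (2 * x)) = 2 * (cos (real n * x))\<^sup>2 - 1" by (metis cos_double_cos)
    then have "3 + 4 * cos (real n * x) + cos (real n * (2 * x)) = 2 * (1 + cos (real n * x))\<^sup>2"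
      by (simp only:) (simp add: power2_eq_square algebra_simps)
    then have "3 + 4 * cos (real n * x) + cos (real n * (2 * x)) \<ge> 0" by simp
    then have "(q ^ n / real n) * (3 + 4 * cos (real n * x) + cos (real n * (2 * x))) \<ge> 0"
      using assms by (intro mult_nonneg_nonneg) auto
    then show ?thesis unfolding cis by (simp add: algebra_simps)
  qed
  have "0 \<le> Re (3 * (- Ln (1 - of_real q * cis 0)) + 4 * (- Ln (1 - of_real q * cis x)) + (- Ln (1 - of_real q * cis (2 * x))))"
    by (rule sums_le[OF N sums_zero S])
  then show ?thesis by simp
qed

lemma zeta_341:
  fixes \<sigma> t :: real
  assumes "\<sigma> > 1"
  shows "norm (exp (log_zeta \<sigma>)) ^ 3 * norm (exp (log_zeta (Complex \<sigma> t))) ^ 4 * norm (exp (log_zeta (Complex \<sigma> (2 * t)))) \<ge> 1"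
proof -
  have R: "Re (of_real \<sigma>) > 1" "Re (Complex \<sigma> t) > 1" "Re (Complex \<sigma> (2 * t)) > 1" using assms by auto
  note sm = R[THEN summable_log_zeta_term, THEN summable_sums, folded log_zeta_def]
  have S: "(\<lambda>p. Re (3 * log_zeta_term p \<sigma> + 4 * log_zeta_term p (Complex \<sigma> t) + log_zeta_term p (Complex \<sigma> (2 * t)))) sums
       Re (3 * log_zeta \<sigma> + 4 * log_zeta (Complex \<sigma> t) + log_zeta (Complex \<sigma> (2 * t)))"
    by (intro sums_Re sums_add sums_mult sm)
  have N: "Re (3 * log_zeta_term p \<sigma> + 4 * log_zeta_term p (Complex \<sigma> t) + log_zeta_term p (Complex \<sigma> (2 * t))) \<ge> 0" for p
  proof (cases "prime p")
    case True
    then have p: "p \<ge> 2" using prime_ge_2_nat by auto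
    define q where "q = real p powr (-\<sigma>)"
    have "q < real p powr 0" unfolding q_def using p assms by (intro powr_less_mono) auto
    then have q: "0 \<le> q" "q < 1" using p by (auto simp: q_def)
    have pw: "of_nat p powr (- Complex \<sigma> y) = of_real q * cis (- (y * ln (real p)))" for y
    proof -
      have "of_nat p powr (- Complex \<sigma> y) = exp (- Complex \<sigma> y * of_real (ln (real p)))"
        using p Ln_of_real[of "real p"] by (simp add: powr_def)
      also have "- Complex \<sigma> y * of_real (ln (real p)) = Complex (- \<sigma> * ln (real p)) (- (y * ln (real p)))"
        by (simp add: complex_eq_iff)
      also have "exp \<dots> = of_real q * cis (- (y * ln (real p)))"
        using p by (simp add: exp_eq_polar q_def powr_def)
      finally show ?thesis .
    qed
    have pw0: "of_nat p powr (- of_real \<sigma>) = (of_real q :: complex)"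
      using pw[of 0] by (simp add: complex_of_real_def)
    have "- (2 * t * ln (real p)) = 2 * (- (t * ln (real p)))" by simp
    with Re_log_341_nonneg[OF q, of "- (t * ln (real p))"] True
    show ?thesis unfolding log_zeta_term_def pw pw0 by (simp only: if_True)
  qed (auto simp: log_zeta_term_def)
  have "0 \<le> Re (3 * log_zeta \<sigma> + 4 * log_zeta (Complex \<sigma> t) + log_zeta (Complex \<sigma> (2 * t)))"
    by (rule sums_le[OF N sums_zero S])
  then have "1 \<le> exp (3 * Re (log_zeta \<sigma>) + 4 * Re (log_zeta (Complex \<sigma> t)) + Re (log_zeta (Complex \<sigma> (2 * t))))"
    by simp
  also have "\<dots> = exp (Re (log_zeta \<sigma>)) ^ 3 * exp (Re (log_zeta (Complex \<sigma> t))) ^ 4 * exp (Re (log_zeta (Complex \<sigma> (2 * t))))"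
    by (simp add: exp_add flip: exp_of_nat_mult)
  finally show ?thesis by simp
qed

section \<open>The absolutely convergent factor \<open>G_r\<close>\<close>

lemma norm_exp_Ln: "z \<noteq> 0 \<Longrightarrow> norm (exp (of_real a * Ln z)) = norm z powr a"
  by (simp add: powr_def)

text \<open>The product equals h(z) = (1 + (r-1) z)(1-z)^(r-1), whose linear terms cancel: h'(w) =
  -(r-1) r w (1-w)^(r-2) carries a factor w. One power of |z| thus comes from h' and a second one
  from the length of the path from 0 to z.\<close>

lemma euler_factor_mult_le:
  fixes z :: complex and r R :: real
  assumes r: "0 \<le> r" "r \<le> R" and z: "norm z \<le> 3/5"
  shows "norm ((1 + of_real r * z / (1 - z)) * exp (of_real r * Ln (1 - z)) - 1) \<le> R * (R + 1) * (5/2) powr (R + 2) * norm z ^ 2"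
proof -
  define h where "h w = (1 + of_real (r - 1) * w) * exp (of_real (r - 1) * Ln (1 - w))" for w :: complex
  let ?K = "R * (R + 1) * (5/2) powr (R + 2)"
  have nz: "2/5 \<le> norm (1 - w)" "norm (1 - w) \<le> 8/5" "1 - w \<noteq> 0" "1 - w \<notin> \<real>\<^sub>\<le>\<^sub>0" if "norm w \<le> 3/5" for w :: complex
  proof -
    show 1: "2/5 \<le> norm (1 - w)" using norm_triangle_ineq2[of 1 w] that by simp
    show "norm (1 - w) \<le> 8/5" using norm_triangle_ineq4[of 1 w] that by simp
    show "1 - w \<noteq> 0" using 1 by (metis norm_zero not_numeral_le_zero divide_le_0_iff zero_le_numeral)
    show "1 - w \<notin> \<real>\<^sub>\<le>\<^sub>0" using complex_Re_le_cmod[of w] that by (auto simp: complex_nonpos_Reals_iff)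
  qed
  have "norm (h z - h 0) \<le> (?K * norm z) * norm (z - 0)"
  proof (rule field_differentiable_bound[where S = "cball 0 (norm z)" and f' = "\<lambda>w. - of_real (r - 1) * of_real r * w * exp (of_real (r - 1) * Ln (1 - w)) / (1 - w)"])
    fix w :: complex assume "w \<in> cball 0 (norm z)"
    then have wz: "norm w \<le> norm z" by simp
    then have w: "norm w \<le> 3/5" using z by simp
    note n = nz[OF w]
    have "(h has_field_derivative of_real (r - 1) * exp (of_real (r - 1) * Ln (1 - w)) + (1 + of_real (r - 1) * w) * (exp (of_real (r - 1) * Ln (1 - w)) * (of_real (r - 1) * (- 1 / (1 - w))))) (at w within cball 0 (norm z))"
      unfolding h_def using n by (auto intro!: derivative_eq_intros) (simp add: divide_inverse mult_ac)
    moreover have "of_real (r - 1) * exp (of_real (r - 1) * Ln (1 - w)) + (1 + of_real (r - 1) * w) * (exp (of_real (r - 1) * Ln (1 - w)) * (of_real (r - 1) * (- 1 / (1 - w)))) = - of_real (r - 1) * of_real r * w * exp (of_real (r - 1) * Ln (1 - w)) / (1 - w)"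
      using n(3) by (simp add: divide_simps) (simp add: algebra_simps)
    ultimately show "(h has_field_derivative - of_real (r - 1) * of_real r * w * exp (of_real (r - 1) * Ln (1 - w)) / (1 - w)) (at w within cball 0 (norm z))"
      by simp
    \<comment> \<open>The exponent r - 2 may have either sign; 5/2 bounds both |1-w| and its
      reciprocal.\<close>
    have e: "norm (1 - w) powr (r - 2) \<le> (5/2) powr (R + 2)"
    proof (cases "norm (1 - w) \<ge> 1")
      case True
      have "norm (1 - w) powr (r - 2) \<le> norm (1 - w) powr (R + 2)" using True r by (intro powr_mono) auto
      also have "\<dots> \<le> (5/2) powr (R + 2)" using n r by (intro powr_mono2) auto
      finally show ?thesis .
    next
      case False
      have "norm (1 - w) powr (r - 2) \<le> norm (1 - w) powr (- (R + 2))" using False r n by (intro powr_mono') auto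
      also have "\<dots> \<le> (2/5) powr (- (R + 2))" using n r by (intro powr_mono2') auto
      also have "\<dots> = (5/2) powr (R + 2)" by (subst powr_minus) (simp flip: inverse_powr)
      finally show ?thesis .
    qed
    have "norm (- of_real (r - 1) * of_real r * w * exp (of_real (r - 1) * Ln (1 - w)) / (1 - w)) = \<bar>r - 1\<bar> * r * norm w * (norm (1 - w) powr (r - 1) / norm (1 - w) powr 1)"
      using r n(3) by (simp only: norm_mult norm_divide norm_exp_Ln norm_minus_cancel norm_of_real powr_one norm_ge_zero) (simp add: powr_def)
    also have "norm (1 - w) powr (r - 1) / norm (1 - w) powr 1 = norm (1 - w) powr (r - 2)"
      by (subst powr_diff[symmetric]) simp
    also have "\<bar>r - 1\<bar> * r * norm w * norm (1 - w) powr (r - 2) \<le> (R + 1) * R * norm z * (5/2) powr (R + 2)"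
      by (intro mult_mono e wz) (use r in auto)
    finally show "norm (- of_real (r - 1) * of_real r * w * exp (of_real (r - 1) * Ln (1 - w)) / (1 - w)) \<le> ?K * norm z"
      by (simp add: mult_ac)
  qed auto
  moreover have "h z = (1 + of_real r * z / (1 - z)) * exp (of_real r * Ln (1 - z))"
  proof -
    define e where "e = exp (of_real (r - 1) * Ln (1 - z))"
    have "exp (of_real r * Ln (1 - z)) = e * (1 - z)"
      using nz[OF z] by (simp add: e_def left_diff_distrib exp_diff)
    moreover have "(1 + of_real r * z / (1 - z)) * (e * (1 - z)) = (1 + of_real (r - 1) * z) * e"
      using nz(3)[OF z] by (simp add: divide_simps) (simp add: algebra_simps)
    ultimately show ?thesis by (simp add: h_def e_def)
  qed
  ultimately show ?thesis by (simp add: h_def power2_eq_square mult_ac)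
qed

definition conv_factor :: "real \<Rightarrow> nat \<Rightarrow> complex \<Rightarrow> complex" where
  "conv_factor r p s = (if prime p then euler_factor r p s * exp (of_real r * Ln (1 - of_nat p powr (-s))) else 1)"

text \<open>This is \<open>G_r\<close>. Each factor differs from 1 by O(p^(-2 Re s)), which is
  O(p^(-3/2)) for Re s \<ge> 3/4, uniformly for r \<le> R.\<close>

definition conv_prod :: "real \<Rightarrow> complex \<Rightarrow> complex" where
  "conv_prod r s = (\<Prod>p. conv_factor r p s)"

lemma norm_conv_factor_minus_1_le:
  assumes r: "0 \<le> r" "r \<le> R" and s: "Re s \<ge> 3/4"
  shows "norm (conv_factor r p s - 1) \<le> R * (R + 1) * (5/2) powr (R + 2) * real p powr (-(3/2))"
proof (cases "prime p")
  case True
  then have p: "p \<ge> 1" using prime_ge_1_nat by auto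
  have "norm (conv_factor r p s - 1) \<le> R * (R + 1) * (5/2) powr (R + 2) * norm (of_nat p powr (-s) :: complex) ^ 2"
    using euler_factor_mult_le[OF r norm_prime_powr_lt[OF True s]] True by (simp add: conv_factor_def euler_factor_def)
  also have "norm (of_nat p powr (-s) :: complex) ^ 2 = real p powr (- Re s * 2)"
    using p by (simp add: norm_nat_powr powr_powr flip: powr_numeral)
  also have "R * (R + 1) * (5/2) powr (R + 2) * \<dots> \<le> R * (R + 1) * (5/2) powr (R + 2) * real p powr (-(3/2))"
    using p s r by (intro mult_left_mono powr_mono) auto
  finally show ?thesis .
qed (use r in \<open>auto simp: conv_factor_def\<close>)

lemma holomorphic_conv_factor: "conv_factor r p holomorphic_on {s. Re s \<ge> 3/4}"
proof (cases "prime p")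
  case True
  have *: "1 - of_nat p powr (-s) \<notin> \<real>\<^sub>\<le>\<^sub>0 \<and> 1 - of_nat p powr (-s) \<noteq> (0::complex)" if "Re s \<ge> 3/4" for s
  proof -
    have "Re (of_nat p powr (-s)) < 1"
      using norm_prime_powr_lt[OF True that] complex_Re_le_cmod[of "of_nat p powr (-s)"] by linarith
    then show ?thesis by (auto simp: complex_nonpos_Reals_iff)
  qed
  have "(\<lambda>s. (1 + of_real r * of_nat p powr (-s) / (1 - of_nat p powr (-s))) * exp (of_real r * Ln (1 - of_nat p powr (-s)))) holomorphic_on {s. Re s \<ge> 3/4}"
    using * True prime_gt_0_nat[of p] by (intro holomorphic_intros) auto
  then show ?thesis using True by (simp add: conv_factor_def[abs_def] euler_factor_def)
qed (auto simp: conv_factor_def[abs_def])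

lemma summable_three_halves: "summable (\<lambda>p. K * real p powr (-(3/2)))"
  by (intro summable_mult) (simp add: summable_real_powr_iff)

lemma conv_prod_tendsto:
  assumes r: "0 \<le> r" and s: "Re s \<ge> 3/4"
  shows "convergent_prod (\<lambda>p. conv_factor r p s)"
    "(\<lambda>N. \<Prod>p<N. conv_factor r p s) \<longlonglongrightarrow> conv_prod r s"
proof -
  have "summable (\<lambda>p. norm (conv_factor r p s - 1))"
    by (rule summable_comparison_test'[OF summable_three_halves[of "r * (r + 1) * (5/2) powr (r + 2)"]])
      (use norm_conv_factor_minus_1_le[OF r order_refl s] in simp)
  then show 1: "convergent_prod (\<lambda>p. conv_factor r p s)"
    by (intro abs_convergent_prod_imp_convergent_prod) (simp add: abs_convergent_prod_conv_summable)
  show "(\<lambda>N. \<Prod>p<N. conv_factor r p s) \<longlonglongrightarrow> conv_prod r s"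
    unfolding conv_prod_def
    using convergent_prod_LIMSEQ[OF 1] by (subst (asm) LIMSEQ_lessThan_iff_atMost[symmetric]) 
qed

lemma norm_conv_prod_le:
  assumes "R > 0"
  shows "\<exists>C>0. \<forall>r s. 0 \<le> r \<longrightarrow> r \<le> R \<longrightarrow> Re s \<ge> 3/4 \<longrightarrow> norm (conv_prod r s) \<le> C"
proof (intro exI conjI allI impI)
  define K where "K = R * (R + 1) * (5/2) powr (R + 2)"
  let ?C = "exp (\<Sum>p. K * real p powr (-(3/2)))"
  show "0 < ?C" by simp
  fix r s assume r: "0 \<le> r" "r \<le> R" and s: "Re s \<ge> 3/4"
  have "norm (\<Prod>p<N. conv_factor r p s) \<le> ?C" for N
  proof -
    have "norm (\<Prod>p<N. conv_factor r p s) = (\<Prod>p<N. norm (conv_factor r p s))" by (rule prod_norm[symmetric])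
    also have "\<dots> \<le> (\<Prod>p<N. exp (K * real p powr (-(3/2))))"
    proof (intro prod_mono conjI)
      fix p
      have "norm (conv_factor r p s) \<le> 1 + norm (conv_factor r p s - 1)"
        using norm_triangle_ineq[of 1 "conv_factor r p s - 1"] by simp
      also have "\<dots> \<le> 1 + K * real p powr (-(3/2))"
        unfolding K_def using norm_conv_factor_minus_1_le[OF r s] by simp
      also have "\<dots> \<le> exp (K * real p powr (-(3/2)))" by (rule exp_ge_add_one_self)
      finally show "norm (conv_factor r p s) \<le> exp (K * real p powr (-(3/2)))" .
    qed auto
    also have "\<dots> = exp (\<Sum>p<N. K * real p powr (-(3/2)))" by (simp add: exp_sum)
    also have "\<dots> \<le> ?C"
      unfolding exp_le_cancel_iff using assms
      by (intro sum_le_suminf summable_three_halves) (auto simp: K_def)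
    finally show ?thesis .
  qed
  then show "norm (conv_prod r s) \<le> ?C"
    using tendsto_norm[OF conv_prod_tendsto(2)[OF r(1) s]] by (intro LIMSEQ_le_const2) auto
qed

lemma holomorphic_conv_prod:
  assumes r: "0 \<le> r"
  shows "conv_prod r holomorphic_on {s. Re s > 3/4}"
proof (rule holomorphic_uniform_sequence[where f = "\<lambda>N s. \<Prod>p<N. conv_factor r p s"])
  show "open {s. Re s > 3/4}" by (rule open_halfspace_Re_gt)
  show "(\<lambda>s. \<Prod>p<N. conv_factor r p s) holomorphic_on {s. Re s > 3/4}" for N
    by (intro holomorphic_intros holomorphic_on_subset[OF holomorphic_conv_factor]) auto
  fix s0 :: complex assume "s0 \<in> {s. Re s > 3/4}"
  then obtain d where d: "d > 0" "cball s0 d \<subseteq> {s. Re s > 3/4}"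
    using open_halfspace_Re_gt[of "3/4"] open_contains_cball by blast
  have "uniformly_convergent_on (cball s0 d) (\<lambda>N s. \<Prod>p<N. conv_factor r p s)"
  proof (rule uniformly_convergent_on_prod')
    show "continuous_on (cball s0 d) (conv_factor r p)" for p
      by (rule holomorphic_on_imp_continuous_on[OF holomorphic_on_subset[OF holomorphic_conv_factor]]) (use d in force)
    show "uniformly_convergent_on (cball s0 d) (\<lambda>N s. \<Sum>p<N. norm (conv_factor r p s - 1))"
      by (rule Weierstrass_m_test'[OF _ summable_three_halves[of "r * (r + 1) * (5/2) powr (r + 2)"]])
        (use norm_conv_factor_minus_1_le[OF r order_refl] d in force)
  qed simp
  then have "uniform_limit (cball s0 d) (\<lambda>N s. \<Prod>p<N. conv_factor r p s) (\<lambda>s. lim (\<lambda>N. \<Prod>p<N. conv_factor r p s)) sequentially"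
    by (simp add: uniformly_convergent_uniform_limit_iff)
  moreover have "lim (\<lambda>N. \<Prod>p<N. conv_factor r p s) = conv_prod r s" if "s \<in> cball s0 d" for s
    using conv_prod_tendsto(2)[OF r, of s] that d by (intro limI) force
  moreover from this have "uniform_limit (cball s0 d) (\<lambda>N s. \<Prod>p<N. conv_factor r p s) (\<lambda>s. lim (\<lambda>N. \<Prod>p<N. conv_factor r p s)) sequentially \<longleftrightarrow> 
      uniform_limit (cball s0 d) (\<lambda>N s. \<Prod>p<N. conv_factor r p s) (conv_prod r) sequentially"
    by (intro uniform_limit_cong') auto
  ultimately have "uniform_limit (cball s0 d) (\<lambda>N s. \<Prod>p<N. conv_factor r p s) (conv_prod r) sequentially"
    by blast
  then show "\<exists>d>0. cball s0 d \<subseteq> {s. Re s > 3/4} \<and> uniform_limit (cball s0 d) (\<lambda>N s. \<Prod>p<N. conv_factor r p s) (conv_prod r) sequentially"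
    using d by blast
qed

lemma omega_dseries_eq:
  assumes s: "Re s > 1" and r: "0 \<le> r"
  shows "omega_dseries r s = exp (of_real r * log_zeta s) * conv_prod r s"
proof -
  have "conv_factor r p s * exp (of_real r * log_zeta_term p s) = euler_factor r p s" for p
    by (simp add: conv_factor_def log_zeta_term_def euler_factor_def exp_minus)
  then have eq: "(\<Prod>p<N. euler_factor r p s) = exp (of_real r * (\<Sum>p<N. log_zeta_term p s)) * (\<Prod>p<N. conv_factor r p s)" for N
    by (simp add: exp_sum sum_distrib_left mult.commute flip: prod.distrib)
  have "(\<lambda>N. exp (of_real r * (\<Sum>p<N. log_zeta_term p s)) * (\<Prod>p<N. conv_factor r p s)) \<longlonglongrightarrow> exp (of_real r * log_zeta s) * conv_prod r s"
    unfolding log_zeta_def using s r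
    by (intro tendsto_intros summable_LIMSEQ summable_log_zeta_term conv_prod_tendsto) auto
  then show ?thesis using euler_product_tendsto[OF s r] LIMSEQ_unique unfolding eq by blast
qed

text \<open>Here the constant g(1,r) of the statement enters. Since \<open>g_one\<close> is an
  infinite product with a default value in case of divergence, convergence of the real product is
  carried over from the complex one.\<close>

lemma conv_prod_1:
  assumes r: "0 \<le> r"
  shows "conv_prod r 1 = of_real (g_one r)"
proof -
  define f where "f p = (if prime p then (1 + r / (real p - 1)) * (1 - 1 / real p) powr r else 1)" for p :: nat
  have eq: "conv_factor r p 1 = of_real (f p)" for p
  proof (cases "prime p")
    case True
    then have p: "real p > 1" using prime_gt_1_nat by auto
    then have p': "1 - 1 / real p > 0" by simp
    have 1: "of_nat p powr (-1) = (of_real (1 / real p) :: complex)"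
      using p by (simp add: powr_minus_divide)
    have "euler_factor r p 1 = of_real (1 + r / (real p - 1))"
      using True p unfolding euler_factor_def 1 by (simp add: field_simps)
    moreover have "exp (of_real r * Ln (1 - of_nat p powr (-1))) = of_real ((1 - 1 / real p) powr r)"
      unfolding 1 using Ln_of_real[OF p'] p p' by (simp add: powr_def exp_of_real[symmetric] del: exp_of_real)
    ultimately show ?thesis using True by (simp add: conv_factor_def f_def)
  qed (auto simp: conv_factor_def f_def)
  have "convergent_prod (complex_of_real \<circ> f)"
    using conv_prod_tendsto(1)[OF r, of 1] by (simp add: eq o_def)
  then have "f has_prod g_one r"
    unfolding g_one_def f_def[symmetric] convergent_prod_of_real_iff by blast
  then have "(\<lambda>p. complex_of_real (f p)) has_prod of_real (g_one r)" by simp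
  then show ?thesis unfolding conv_prod_def eq by (rule has_prod_unique[symmetric])
qed

section \<open>Fourier and Laplace transforms\<close>

text \<open>The Gaussian is its own Fourier transform up to scaling; this is read off from the
  characteristic function of the standard normal distribution.\<close>

lemma std_normal_fourier:
  "complex_of_real (std_normal_density y) = of_real (1 / sqrt (2 * pi)) * (LINT t|lborel. of_real (std_normal_density t) * iexp (y * t))"
proof -
  have "char std_normal_distribution y = (LINT t|lborel. std_normal_density t *\<^sub>R iexp (y * t))"
    unfolding char_def by (subst integral_density) (auto simp: normal_density_nonneg)
  then have "(LINT t|lborel. of_real (std_normal_density t) * iexp (y * t)) = complex_of_real (exp (- (y\<^sup>2) / 2))"
    by (simp add: char_std_normal_distribution scaleR_conv_of_real)
  then show ?thesis
    by (simp only:) (simp add: std_normal_density_def flip: of_real_mult)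
qed

text \<open>Convolving with a narrow Gaussian makes Fourier inversion a matter of Fubini; letting the
  width tend to 0 recovers the function itself.\<close>

lemma norm_le_integral_fourier:
  fixes \<psi> :: "real \<Rightarrow> complex"
  assumes int: "integrable lborel \<psi>" and cont: "isCont \<psi> u" and bd: "\<And>x. norm (\<psi> x) \<le> B"
    and inth: "integrable lborel (\<lambda>t. LINT x|lborel. \<psi> x * iexp (- (t * x)))"
  shows "norm (\<psi> u) \<le> (1 / (2 * pi)) * (LINT t|lborel. norm (LINT x|lborel. \<psi> x * iexp (- (t * x))))"
proof -
  define h where "h t = (LINT x|lborel. \<psi> x * iexp (- (t * x)))" for t
  have [measurable]: "\<psi> \<in> borel_measurable borel" using int by auto
  have inth': "integrable lborel h" using inth by (simp add: h_def[abs_def])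
  then have [measurable]: "h \<in> borel_measurable borel" by auto
  let ?n = "std_normal_density"
  have intn: "integrable lborel ?n" by (rule integrable_normal_density) simp
  have n_le: "?n t \<le> 1 / sqrt (2 * pi)" for t by (simp add: std_normal_density_def divide_right_mono)
  \<comment> \<open>The Gaussian average of \<open>\<psi>\<close> around u at scale d. Writing the
    density as a Fourier integral and exchanging the integrals expresses \<open>I d\<close> through
    the transform \<open>h\<close>.\<close>
  define I where "I d = (LINT y|lborel. \<psi> (u + d * y) * of_real (?n y))" for d
  have bound: "norm (I d) \<le> (1 / (2 * pi)) * (LINT t|lborel. norm (h t))" if d: "d > 0" for d
  proof -
    have intd: "integrable lborel (\<lambda>y. \<psi> (u + d * y))"
      using lborel_integrable_real_affine_iff[of d \<psi> u] d int by simp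
    have swap: "(LINT y|lborel. (LINT t|lborel. \<psi> (u + d * y) * (of_real (?n t) * iexp (y * t)))) =
        (LINT t|lborel. (LINT y|lborel. \<psi> (u + d * y) * (of_real (?n t) * iexp (y * t))))"
    proof (rule lborel_pair.Fubini_integral[symmetric])
      show "integrable (lborel \<Otimes>\<^sub>M lborel) (\<lambda>(y, t). \<psi> (u + d * y) * (of_real (?n t) * iexp (y * t)))"
      proof (rule lborel_pair.Fubini_integrable)
        show "integrable lborel (\<lambda>y. LINT t|lborel. norm (case (y, t) of (y, t) \<Rightarrow> \<psi> (u + d * y) * (of_real (?n t) * iexp (y * t))))"
          using intd by (simp add: norm_mult normal_density_nonneg integral_normal_density)
        show "AE y in lborel. integrable lborel (\<lambda>t. case (y, t) of (y, t) \<Rightarrow> \<psi> (u + d * y) * (of_real (?n t) * iexp (y * t)))"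
        proof (rule AE_I2)
          fix y :: real
          show "integrable lborel (\<lambda>t. case (y, t) of (y, t) \<Rightarrow> \<psi> (u + d * y) * (of_real (?n t) * iexp (y * t)))"
            by (rule Bochner_Integration.integrable_bound[of _ "\<lambda>t. norm (\<psi> (u + d * y)) * ?n t"])
              (auto simp: norm_mult normal_density_nonneg intn)
        qed
      qed measurable
    qed
    have "I d = (LINT y|lborel. \<psi> (u + d * y) * (of_real (1 / sqrt (2 * pi)) * (LINT t|lborel. of_real (?n t) * iexp (y * t))))"
      unfolding I_def by (subst std_normal_fourier) simp
    also have "\<dots> = (LINT y|lborel. of_real (1 / sqrt (2 * pi)) * (LINT t|lborel. \<psi> (u + d * y) * (of_real (?n t) * iexp (y * t))))"
    proof (rule Bochner_Integration.integral_cong[OF refl])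
      fix y :: real
      have "(LINT t|lborel. \<psi> (u + d * y) * (of_real (?n t) * iexp (y * t))) = \<psi> (u + d * y) * (LINT t|lborel. of_real (?n t) * iexp (y * t))"
        by (rule integral_mult_right_zero)
      then show "\<psi> (u + d * y) * (of_real (1 / sqrt (2 * pi)) * (LINT t|lborel. of_real (?n t) * iexp (y * t))) =
        of_real (1 / sqrt (2 * pi)) * (LINT t|lborel. \<psi> (u + d * y) * (of_real (?n t) * iexp (y * t)))"
        by (simp only: mult.left_commute)
    qed
    also have "\<dots> = of_real (1 / sqrt (2 * pi)) * (LINT t|lborel. (LINT y|lborel. \<psi> (u + d * y) * (of_real (?n t) * iexp (y * t))))"
      by (subst integral_mult_right_zero) (simp only: swap)
    finally have I1: "I d = of_real (1 / sqrt (2 * pi)) * (LINT t|lborel. (LINT y|lborel. \<psi> (u + d * y) * (of_real (?n t) * iexp (y * t))))" .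
    have inner: "(LINT y|lborel. \<psi> (u + d * y) * (of_real (?n t) * iexp (y * t))) =
        of_real (?n t) * (iexp (- (u * t / d)) * h (- t / d) / of_real d)" for t
    proof -
      have "h (- t / d) = (LINT x|lborel. \<psi> x * iexp (t / d * x))" by (simp add: h_def)
      also have "\<dots> = \<bar>d\<bar> *\<^sub>R (LINT y|lborel. \<psi> (u + d * y) * iexp (t / d * (u + d * y)))"
        by (rule lborel_integral_real_affine) (use d in auto)
      also have "(\<lambda>y. \<psi> (u + d * y) * iexp (t / d * (u + d * y))) = (\<lambda>y. iexp (u * t / d) * (\<psi> (u + d * y) * iexp (y * t)))"
        using d by (auto simp: fun_eq_iff field_simps simp flip: exp_add)
      also have "(LINT y|lborel. iexp (u * t / d) * (\<psi> (u + d * y) * iexp (y * t))) = iexp (u * t / d) * (LINT y|lborel. \<psi> (u + d * y) * iexp (y * t))"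
        by (rule integral_mult_right_zero)
      finally have "(LINT y|lborel. \<psi> (u + d * y) * iexp (y * t)) = iexp (- (u * t / d)) * h (- t / d) / of_real d"
        using d by (simp add: scaleR_conv_of_real exp_minus field_simps)
      moreover have "(LINT y|lborel. \<psi> (u + d * y) * (of_real (?n t) * iexp (y * t))) = of_real (?n t) * (LINT y|lborel. \<psi> (u + d * y) * iexp (y * t))"
        by (subst integral_mult_right_zero[symmetric]) (simp add: mult_ac)
      ultimately show ?thesis by simp
    qed
    have Ieq: "I d = of_real (1 / sqrt (2 * pi)) * (LINT t|lborel. of_real (?n t) * (iexp (- (u * t / d)) * h (- t / d) / of_real d))"
      unfolding I1 inner ..
    have inthd: "integrable lborel (\<lambda>t. norm (h (- t / d)))"
      using lborel_integrable_real_affine_iff[of "-1/d" "\<lambda>t. norm (h t)" 0] d inth' by simp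
    \<comment> \<open>The density is replaced by its maximum; the substitution t -> -d t then
      cancels the 1/d, which makes the bound independent of d.\<close>
    have "norm (LINT t|lborel. of_real (?n t) * (iexp (- (u * t / d)) * h (- t / d) / of_real d)) \<le> (LINT t|lborel. (1 / sqrt (2 * pi) / d) * norm (h (- t / d)))"
    proof (rule order_trans[OF integral_norm_bound], rule integral_mono')
      show "integrable lborel (\<lambda>t. (1 / sqrt (2 * pi) / d) * norm (h (- t / d)))"
        using inthd by (rule integrable_mult_right)
      show "0 \<le> (1 / sqrt (2 * pi) / d) * norm (h (- t / d))" for t using d by simp
      show "norm (of_real (?n t) * (iexp (- (u * t / d)) * h (- t / d) / of_real d)) \<le> (1 / sqrt (2 * pi) / d) * norm (h (- t / d))" for t
      proof -
        have "norm (of_real (?n t) * (iexp (- (u * t / d)) * h (- t / d) / of_real d)) = ?n t * (norm (h (- t / d)) / d)"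
          using d by (simp add: norm_mult norm_divide normal_density_nonneg)
        also have "\<dots> \<le> 1 / sqrt (2 * pi) * (norm (h (- t / d)) / d)"
          using d by (intro mult_right_mono n_le) auto
        finally show "norm (of_real (?n t) * (iexp (- (u * t / d)) * h (- t / d) / of_real d)) \<le> (1 / sqrt (2 * pi) / d) * norm (h (- t / d))"
          by simp
      qed
    qed
    also have "\<dots> = (1 / sqrt (2 * pi) / d) * (LINT t|lborel. norm (h (- t / d)))"
      by (rule integral_mult_right_zero)
    also have "(LINT t|lborel. norm (h (- t / d))) = d * (LINT t|lborel. norm (h t))"
      using lborel_integral_real_affine[of "-1/d" "\<lambda>t. norm (h t)" 0] d by simp
    finally have "norm (I d) \<le> (1 / sqrt (2 * pi)) * ((1 / sqrt (2 * pi) / d) * (d * (LINT t|lborel. norm (h t))))"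
      unfolding Ieq norm_mult by (intro mult_mono) (auto simp: norm_divide)
    also have "\<dots> = (1 / (2 * pi)) * (LINT t|lborel. norm (h t))"
      using d by (simp add: field_simps)
    finally show ?thesis .
  qed
  \<comment> \<open>Letting d tend to 0: continuity at u gives the pointwise limit, and the bound B
    on \<open>\<psi>\<close> gives the dominating function.\<close>
  have "(\<lambda>k. I (1 / real (Suc k))) \<longlonglongrightarrow> (LINT y|lborel. \<psi> u * of_real (?n y))"
    unfolding I_def
  proof (rule integral_dominated_convergence[where w = "\<lambda>y. B * ?n y"])
    show "AE y in lborel. (\<lambda>k. \<psi> (u + 1 / real (Suc k) * y) * of_real (?n y)) \<longlonglongrightarrow> \<psi> u * of_real (?n y)"
    proof (rule AE_I2, intro tendsto_intros)
      fix y :: real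
      have "(\<lambda>k. u + 1 / real (Suc k) * y) \<longlonglongrightarrow> u" by real_asymp
      then show "(\<lambda>k. \<psi> (u + 1 / real (Suc k) * y)) \<longlonglongrightarrow> \<psi> u"
        by (rule isCont_tendsto_compose[OF cont])
    qed
    show "integrable lborel (\<lambda>y. B * ?n y)" by (intro integrable_mult_right intn)
    show "AE y in lborel. norm (\<psi> (u + 1 / real (Suc k) * y) * of_real (?n y)) \<le> B * ?n y" for k
      by (rule AE_I2) (auto simp: norm_mult normal_density_nonneg intro!: mult_right_mono bd)
  qed measurable
  also have "(LINT y|lborel. \<psi> u * of_real (?n y)) = \<psi> u"
    by (subst integral_mult_right_zero) (simp add: integral_complex_of_real integral_normal_density)
  finally have "(\<lambda>k. norm (I (1 / real (Suc k)))) \<longlonglongrightarrow> norm (\<psi> u)" by (rule tendsto_norm)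
  then have "norm (\<psi> u) \<le> (1 / (2 * pi)) * (LINT t|lborel. norm (h t))"
    by (rule LIMSEQ_le_const2) (intro exI allI impI bound, simp)
  then show ?thesis by (simp add: h_def)
qed

section \<open>Laplace transforms and averages over short windows\<close>

definition laplace :: "(real \<Rightarrow> real) \<Rightarrow> complex \<Rightarrow> complex" where
  "laplace a s = (LINT v|lborel. of_real (a v) * exp (- s * of_real v))"

text \<open>Integrability is required for every \<sigma> > 1 at once, because this makes the class
  closed under multiplication by v: the factor v costs an arbitrarily small part of the exponent.
  Vanishing for v < 0 makes the integral over the real line a one-sided transform.\<close>

definition exp_growth :: "(real \<Rightarrow> real) \<Rightarrow> bool" where
  "exp_growth a \<longleftrightarrow> a \<in> borel_measurable borel \<and> (\<forall>v<0. a v = 0) \<and> (\<forall>\<sigma>>1. integrable lborel (\<lambda>v. a v * exp (- \<sigma> * v)))"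

lemma exp_growthD:
  assumes "exp_growth a"
  shows "a \<in> borel_measurable borel" "v < 0 \<Longrightarrow> a v = 0" "\<sigma> > 1 \<Longrightarrow> integrable lborel (\<lambda>v. a v * exp (- \<sigma> * v))"
  using assms by (auto simp: exp_growth_def)

lemma integrable_laplace:
  assumes "exp_growth a" "Re s > 1"
  shows "integrable lborel (\<lambda>v. of_real (a v) * exp (- s * of_real v))"
proof -
  note [measurable] = exp_growthD(1)[OF assms(1)]
  show ?thesis
    by (rule Bochner_Integration.integrable_bound[OF exp_growthD(3)[OF assms]]) (auto simp: norm_mult)
qed

lemma exp_growth_mult:
  assumes a: "exp_growth a"
  shows "exp_growth (\<lambda>v. v * a v)"
  unfolding exp_growth_def
proof (intro conjI allI impI)
  note [measurable] = exp_growthD(1)[OF a]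
  show "(\<lambda>v. v * a v) \<in> borel_measurable borel" by measurable
  show "v * a v = 0" if "v < 0" for v using that a by (simp add: exp_growthD)
  fix \<sigma> :: real assume \<sigma>: "\<sigma> > 1"
  define e where "e = (\<sigma> - 1) / 2"
  have e: "e > 0" "\<sigma> - e > 1" using \<sigma> by (auto simp: e_def field_simps)
  have bd: "norm (v * a v * exp (- \<sigma> * v)) \<le> norm ((1 / e) * (a v * exp (- (\<sigma> - e) * v)))" for v
  proof (cases "v < 0")
    case False
    have "e * v \<le> exp (e * v)" using exp_ge_add_one_self[of "e * v"] by linarith
    then have "v \<le> (1 / e) * exp (e * v)" using e by (simp add: field_simps)
    then have "v * (\<bar>a v\<bar> * exp (- \<sigma> * v)) \<le> (1 / e) * exp (e * v) * (\<bar>a v\<bar> * exp (- \<sigma> * v))"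
      by (intro mult_right_mono) auto
    also have "exp (e * v) * (\<bar>a v\<bar> * exp (- \<sigma> * v)) = \<bar>a v\<bar> * exp (- (\<sigma> - e) * v)"
      by (simp add: algebra_simps flip: exp_add)
    then have "(1 / e) * exp (e * v) * (\<bar>a v\<bar> * exp (- \<sigma> * v)) = (1 / e) * (\<bar>a v\<bar> * exp (- (\<sigma> - e) * v))"
      by (simp only: mult.assoc)
    finally show ?thesis using False e by (simp add: abs_mult mult_ac)
  qed (simp add: exp_growthD[OF a])
  show "integrable lborel (\<lambda>v. v * a v * exp (- \<sigma> * v))"
    by (rule Bochner_Integration.integrable_bound[OF integrable_mult_right[OF exp_growthD(3)[OF a e(2)], of "1/e"]])
      (use bd in auto)
qed

lemma exp_growth_uminus: "exp_growth a \<Longrightarrow> exp_growth (\<lambda>v. - a v)"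
  unfolding exp_growth_def by auto

lemma norm_exp_minus_1_le: "norm (exp z - 1 :: complex) \<le> norm z * exp (norm z)"
proof -
  have "norm (exp z - exp 0) \<le> exp (norm z) * norm (z - 0)"
  proof (rule field_differentiable_bound[where S = "cball 0 (norm z)" and f' = exp])
    show "norm (exp w) \<le> exp (norm z)" if "w \<in> cball 0 (norm z)" for w :: complex
      using that complex_Re_le_cmod[of w] by (simp add: order_trans)
  qed (auto intro!: derivative_eq_intros)
  then show ?thesis by (simp add: mult.commute)
qed

lemma has_field_derivative_laplace:
  assumes a: "exp_growth a" and s: "Re s > 1"
  shows "(laplace a has_field_derivative laplace (\<lambda>v. - (v * a v)) s) (at s)"
proof -
  note [measurable] = exp_growthD(1)[OF a]
  \<comment> \<open>Half of the distance to the line Re s = 1: increments smaller than e stay in the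
    half-plane, and the difference quotients are dominated by v |a v| exp(-(Re s - e) v).\<close>
  define e where "e = (Re s - 1) / 2"
  have e: "e > 0" "Re s - e > 1" using s by (auto simp: e_def field_simps)
  have "((\<lambda>h. (laplace a (s + h) - laplace a s) / h) \<longlongrightarrow> laplace (\<lambda>v. - (v * a v)) s) (at 0)"
  proof (rule iffD2[OF tendsto_at_iff_sequentially])
  show "\<forall>X. (\<forall>i. X i \<in> UNIV - {0}) \<longrightarrow> X \<longlonglongrightarrow> 0 \<longrightarrow> ((\<lambda>h. (laplace a (s + h) - laplace a s) / h) \<circ> X) \<longlonglongrightarrow> laplace (\<lambda>v. - (v * a v)) s"
  proof (intro allI impI)
    fix X :: "nat \<Rightarrow> complex" assume X0: "\<forall>i. X i \<in> UNIV - {0}" and X: "X \<longlonglongrightarrow> 0"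
    have "\<forall>\<^sub>F n in sequentially. norm (X n) < e" using tendsto_norm_zero[OF X] e by (auto intro: order_tendstoD)
    then obtain N where N: "\<And>n. n \<ge> N \<Longrightarrow> norm (X n) < e" unfolding eventually_sequentially by blast
    have "(\<lambda>n. (laplace a (s + X (n + N)) - laplace a s) / X (n + N)) \<longlonglongrightarrow> laplace (\<lambda>v. - (v * a v)) s"
    proof -
      have eq: "(laplace a (s + X (n + N)) - laplace a s) / X (n + N) = 
        (LINT v|lborel. of_real (a v) * ((exp (- (s + X (n + N)) * of_real v) - exp (- s * of_real v)) / X (n + N)))" for n
      proof -
        have "Re (s + X (n + N)) > 1" using N[of "n + N"] e abs_Re_le_cmod[of "X (n + N)"] by simp
        note i = integrable_laplace[OF a this] integrable_laplace[OF a s]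
        have "(laplace a (s + X (n + N)) - laplace a s) / X (n + N) = 
          (LINT v|lborel. (of_real (a v) * exp (- (s + X (n + N)) * of_real v) - of_real (a v) * exp (- s * of_real v)) / X (n + N))"
          unfolding laplace_def Bochner_Integration.integral_diff[OF i, symmetric] by (rule integral_divide_zero[symmetric])
        then show ?thesis by (simp only: right_diff_distrib[symmetric] times_divide_eq_right[symmetric])
      qed
      show ?thesis unfolding eq unfolding laplace_def
      proof (rule integral_dominated_convergence[where w = "\<lambda>v. norm (v * a v * exp (- (Re s - e) * v))"])
        show "integrable lborel (\<lambda>v. norm (v * a v * exp (- (Re s - e) * v)))"
          by (intro integrable_norm exp_growthD(3)[OF exp_growth_mult[OF a]] e)
        show "AE v in lborel. (\<lambda>n. of_real (a v) * ((exp (- (s + X (n + N)) * of_real v) - exp (- s * of_real v)) / X (n + N))) \<longlonglongrightarrow> of_real (- (v * a v)) * exp (- s * of_real v)"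
        proof (rule AE_I2)
          fix v :: real
          have "((\<lambda>z. exp (- z * of_real v)) has_field_derivative (- of_real v * exp (- s * of_real v))) (at s)"
            by (auto intro!: derivative_eq_intros)
          then have "((\<lambda>h. (exp (- (s + h) * of_real v) - exp (- s * of_real v)) / h) \<longlongrightarrow> - of_real v * exp (- s * of_real v)) (at 0)"
            by (simp only: DERIV_def)
          then have "(\<lambda>n. (exp (- (s + X (n + N)) * of_real v) - exp (- s * of_real v)) / X (n + N)) \<longlonglongrightarrow> - of_real v * exp (- s * of_real v)"
            using X0 LIMSEQ_ignore_initial_segment[OF X, of N]
            unfolding tendsto_at_iff_sequentially comp_def by (drule_tac spec[of _ "\<lambda>n. X (n + N)"]) simp
          from tendsto_mult_left[OF this, of "of_real (a v)"]
          show "(\<lambda>n. of_real (a v) * ((exp (- (s + X (n + N)) * of_real v) - exp (- s * of_real v)) / X (n + N))) \<longlonglongrightarrow> of_real (- (v * a v)) * exp (- s * of_real v)"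
            by (simp add: mult_ac)
        qed
        show "AE v in lborel. norm (of_real (a v) * ((exp (- (s + X (n + N)) * of_real v) - exp (- s * of_real v)) / X (n + N))) \<le> norm (v * a v * exp (- (Re s - e) * v))" for n
        proof (rule AE_I2)
          fix v :: real
          let ?h = "X (n + N)"
          show "norm (of_real (a v) * ((exp (- (s + ?h) * of_real v) - exp (- s * of_real v)) / ?h)) \<le> norm (v * a v * exp (- (Re s - e) * v))"
          proof (cases "v < 0")
            case False
            have h: "?h \<noteq> 0" "norm ?h < e" using X0 N[of "n + N"] by auto
            have "exp (- (s + ?h) * of_real v) - exp (- s * of_real v) = exp (- s * of_real v) * (exp (- ?h * of_real v) - 1)"
              by (simp add: algebra_simps flip: exp_add)
            then have "norm (exp (- (s + ?h) * of_real v) - exp (- s * of_real v)) = exp (- Re s * v) * norm (exp (- ?h * of_real v) - 1)"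
              by (simp add: norm_mult)
            also have "\<dots> \<le> exp (- Re s * v) * (norm (- ?h * of_real v) * exp (norm (- ?h * of_real v)))"
              by (intro mult_left_mono norm_exp_minus_1_le) auto
            also have "\<dots> \<le> exp (- Re s * v) * (norm ?h * v * exp (e * v))"
              using False h by (intro mult_left_mono mult_mono) (auto simp: norm_mult intro!: mult_right_mono)
            also have "\<dots> = norm ?h * (v * exp (- (Re s - e) * v))"
              by (simp add: algebra_simps flip: exp_add)
            finally have "norm ((exp (- (s + ?h) * of_real v) - exp (- s * of_real v)) / ?h) \<le> v * exp (- (Re s - e) * v)"
              using h by (simp add: norm_divide field_simps)
            then have "\<bar>a v\<bar> * norm ((exp (- (s + ?h) * of_real v) - exp (- s * of_real v)) / ?h) \<le> \<bar>a v\<bar> * (v * exp (- (Re s - e) * v))"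
              by (intro mult_left_mono) auto
            then show ?thesis using False by (simp only: norm_mult norm_of_real) (simp add: abs_mult mult_ac)
          qed (simp add: exp_growthD[OF a])
        qed
      qed measurable
    qed
    then show "((\<lambda>h. (laplace a (s + h) - laplace a s) / h) \<circ> X) \<longlonglongrightarrow> laplace (\<lambda>v. - (v * a v)) s"
      unfolding comp_def by (rule LIMSEQ_offset)
  qed
  qed
  then show ?thesis by (simp only: DERIV_def)
qed

lemma higher_deriv_laplace:
  assumes "exp_growth a" "Re s > 1"
  shows "(deriv ^^ n) (laplace a) s = laplace (\<lambda>v. (- v) ^ n * a v) s"
  using assms
proof (induction n arbitrary: a s)
  case (Suc n)
  have ev: "\<forall>\<^sub>F z in nhds s. deriv (laplace a) z = laplace (\<lambda>v. - (v * a v)) z"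
    using eventually_nhds_in_open[OF open_halfspace_Re_gt[of 1], of s] Suc.prems
    by (auto elim!: eventually_mono intro!: DERIV_imp_deriv has_field_derivative_laplace)
  have "(deriv ^^ Suc n) (laplace a) s = (deriv ^^ n) (deriv (laplace a)) s" by (simp add: funpow_Suc_right del: funpow.simps)
  also have "\<dots> = (deriv ^^ n) (laplace (\<lambda>v. - (v * a v))) s"
    by (rule higher_deriv_cong_ev[OF ev refl])
  also have "\<dots> = laplace (\<lambda>v. (- v) ^ n * (- (v * a v))) s"
    using Suc.prems by (intro Suc.IH exp_growth_uminus exp_growth_mult)
  finally show ?case by (simp add: mult_ac)
qed simp

lemma holomorphic_laplace: "exp_growth a \<Longrightarrow> laplace a holomorphic_on {s. Re s > 1}"
  unfolding holomorphic_on_def field_differentiable_def mem_Collect_eq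
  using has_field_derivative_laplace has_field_derivative_at_within by blast

text \<open>The function x -> exp(-\<sigma> x) times the integral of a over [x, x+\<eta>] has
  Fourier transform L(\<sigma>+it) (exp(\<eta> s) - 1)/s with s = \<sigma>+it and L the Laplace
  transform of a. The window supplies the factor 1/s, which is what makes absolute convergence of
  the inversion integral attainable.\<close>

lemma box_average_le:
  fixes a :: "real \<Rightarrow> real" and \<sigma> \<eta> u :: real
  defines "K \<equiv> (\<lambda>t. norm (laplace a (Complex \<sigma> t)) * norm ((exp (of_real \<eta> * Complex \<sigma> t) - 1) / Complex \<sigma> t))"
  assumes a: "exp_growth a" and \<sigma>: "\<sigma> > 1" and \<eta>: "\<eta> > 0"
    and int: "integrable lborel K"
  shows "\<bar>LINT v|lborel. indicator {u..u+\<eta>} v * a v\<bar> \<le> exp (\<sigma> * u) / (2 * pi) * (LINT t|lborel. K t)"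
proof -
  note [measurable] = exp_growthD(1)[OF a]
  define B where "B x = (LINT v|lborel. indicator {x..x+\<eta>} v * a v)" for x
  define M where "M = (LINT v|lborel. \<bar>a v * exp (- \<sigma> * v)\<bar>)"
  define \<psi> where "\<psi> x = complex_of_real (exp (- \<sigma> * x) * B x)" for x
  have inta: "integrable lborel (\<lambda>v. a v * exp (- \<sigma> * v))" by (rule exp_growthD(3)[OF a \<sigma>])
  have ind: "\<bar>indicator {x..x+\<eta>} v * a v\<bar> \<le> exp (\<sigma> * (x + \<eta>)) * \<bar>a v * exp (- \<sigma> * v)\<bar>" for x v
  proof (cases "v \<in> {x..x+\<eta>}")
    case True
    have "1 \<le> exp (\<sigma> * (x + \<eta> - v))" using True \<sigma> by simp
    then have "1 * \<bar>a v\<bar> \<le> exp (\<sigma> * (x + \<eta> - v)) * \<bar>a v\<bar>" by (intro mult_right_mono) auto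
    then show ?thesis using True by (simp add: abs_mult right_diff_distrib exp_diff exp_minus field_simps)
  qed auto
  have intb: "integrable lborel (\<lambda>v. indicator {x..x+\<eta>} v * a v)" for x
    by (rule Bochner_Integration.integrable_bound[OF integrable_mult_right[OF integrable_abs[OF inta], of "exp (\<sigma> * (x + \<eta>))"]])
      (use ind in auto)
  have Bbound: "\<bar>B x\<bar> \<le> exp (\<sigma> * (x + \<eta>)) * M" for x
  proof -
    have "\<bar>B x\<bar> \<le> (LINT v|lborel. \<bar>indicator {x..x+\<eta>} v * a v\<bar>)"
      unfolding B_def by (rule integral_abs_bound)
    also have "\<dots> \<le> (LINT v|lborel. exp (\<sigma> * (x + \<eta>)) * \<bar>a v * exp (- \<sigma> * v)\<bar>)"
      by (intro integral_mono integrable_abs intb integrable_mult_right inta ind)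
    also have "\<dots> = exp (\<sigma> * (x + \<eta>)) * M" unfolding M_def by (rule integral_mult_right_zero)
    finally show ?thesis .
  qed
  have bd: "norm (\<psi> x) \<le> exp (\<sigma> * \<eta>) * M" for x
  proof -
    have "norm (\<psi> x) = exp (- \<sigma> * x) * \<bar>B x\<bar>" by (simp add: \<psi>_def norm_mult)
    also have "\<dots> \<le> exp (- \<sigma> * x) * (exp (\<sigma> * (x + \<eta>)) * M)" by (intro mult_left_mono Bbound) auto
    also have "\<dots> = exp (\<sigma> * \<eta>) * M" by (simp add: distrib_left flip: mult.assoc exp_add)
    finally show ?thesis .
  qed
  \<comment> \<open>The indicators of the moving windows converge except at the two endpoints of the
    limit window, a null set.\<close>
  have contB: "isCont B x" for x
    unfolding continuous_at_sequentially comp_def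
  proof (intro allI impI)
    fix X :: "nat \<Rightarrow> real" assume X: "X \<longlonglongrightarrow> x"
    have "\<forall>\<^sub>F n in sequentially. X n < x + 1" using X by (rule order_tendstoD) simp
    then obtain N where N: "\<And>n. n \<ge> N \<Longrightarrow> X n < x + 1" unfolding eventually_sequentially by blast
    have XN: "(\<lambda>n. X (n + N)) \<longlonglongrightarrow> x" by (rule LIMSEQ_ignore_initial_segment[OF X])
    have "(\<lambda>n. B (X (n + N))) \<longlonglongrightarrow> B x"
      unfolding B_def
    proof (rule integral_dominated_convergence[where w = "\<lambda>v. exp (\<sigma> * (x + 1 + \<eta>)) * \<bar>a v * exp (- \<sigma> * v)\<bar>"])
      show "integrable lborel (\<lambda>v. exp (\<sigma> * (x + 1 + \<eta>)) * \<bar>a v * exp (- \<sigma> * v)\<bar>)"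
        by (intro integrable_mult_right integrable_abs inta)
      show "AE v in lborel. norm (indicator {X (n + N)..X (n + N) + \<eta>} v * a v) \<le> exp (\<sigma> * (x + 1 + \<eta>)) * \<bar>a v * exp (- \<sigma> * v)\<bar>" for n
      proof (rule AE_I2)
        fix v :: real
        have "exp (\<sigma> * (X (n + N) + \<eta>)) \<le> exp (\<sigma> * (x + 1 + \<eta>))" using N[of "n + N"] \<sigma> by simp
        then have "exp (\<sigma> * (X (n + N) + \<eta>)) * \<bar>a v * exp (- \<sigma> * v)\<bar> \<le> exp (\<sigma> * (x + 1 + \<eta>)) * \<bar>a v * exp (- \<sigma> * v)\<bar>"
          by (intro mult_right_mono) auto
        with ind[of "X (n + N)" v] show "norm (indicator {X (n + N)..X (n + N) + \<eta>} v * a v) \<le> exp (\<sigma> * (x + 1 + \<eta>)) * \<bar>a v * exp (- \<sigma> * v)\<bar>"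
          unfolding real_norm_def by linarith
      qed
      have "AE v in lborel. v \<noteq> x \<and> v \<noteq> x + \<eta>" using AE_lborel_singleton[of x] AE_lborel_singleton[of "x + \<eta>"] by eventually_elim auto
      then show "AE v in lborel. (\<lambda>n. indicator {X (n + N)..X (n + N) + \<eta>} v * a v) \<longlonglongrightarrow> indicator {x..x+\<eta>} v * a v"
      proof eventually_elim
        case (elim v)
        have "\<forall>\<^sub>F n in sequentially. indicator {X (n + N)..X (n + N) + \<eta>} v = (indicator {x..x+\<eta>} v :: real)"
        proof -
          consider "v < x" | "x < v" "v < x + \<eta>" | "v > x + \<eta>" using elim by linarith
          then show ?thesis
          proof cases
            case 1
            have "\<forall>\<^sub>F n in sequentially. v < X (n + N)" by (rule order_tendstoD(1)[OF XN 1])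
            then show ?thesis by eventually_elim (use 1 in auto)
          next
            case 2
            have "v - \<eta> < x" using 2 by simp
            have "\<forall>\<^sub>F n in sequentially. X (n + N) < v" "\<forall>\<^sub>F n in sequentially. v - \<eta> < X (n + N)"
              by (rule order_tendstoD[OF XN], fact)+
            then show ?thesis by eventually_elim (use 2 in auto)
          next
            case 3
            have "x < v - \<eta>" using 3 by simp
            then have "\<forall>\<^sub>F n in sequentially. X (n + N) < v - \<eta>" by (rule order_tendstoD(2)[OF XN])
            then show ?thesis by eventually_elim (use 3 in auto)
          qed
        qed
        then have "\<forall>\<^sub>F n in sequentially. indicator {x..x+\<eta>} v * a v = indicator {X (n + N)..X (n + N) + \<eta>} v * a v"
          by eventually_elim simp
        then show ?case by (rule Lim_transform_eventually[OF tendsto_const])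
      qed
    qed measurable
    then show "(\<lambda>n. B (X n)) \<longlonglongrightarrow> B x" by (rule LIMSEQ_offset)
  qed
  have contpsi: "isCont \<psi> x" for x unfolding \<psi>_def by (intro continuous_intros contB)
  have mB[measurable]: "B \<in> borel_measurable borel"
    using contB by (intro borel_measurable_continuous_onI continuous_at_imp_continuous_on) auto
  \<comment> \<open>The strip x \<le> v \<le> x + \<eta> is cut by x in [v-\<eta>, v] for fixed v,
    where the integral of the exponential is explicit.\<close>
  have pair: "integrable (lborel \<Otimes>\<^sub>M lborel) (\<lambda>(v, x). indicator {v - \<eta>..v} x *\<^sub>R (of_real (a v) * exp (- Complex \<sigma> t * of_real x)))" for t
  proof (rule lborel_pair.Fubini_integrable)
    have eq: "(LINT x|lborel. norm (indicator {v - \<eta>..v} x *\<^sub>R (of_real (a v) * exp (- Complex \<sigma> t * of_real x)))) = ((exp (\<sigma> * \<eta>) - 1) / \<sigma>) * \<bar>a v * exp (- \<sigma> * v)\<bar>" for v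
    proof -
      have "(LINT x|lborel. indicator {v - \<eta>..v} x *\<^sub>R exp (- \<sigma> * x)) = - exp (- \<sigma> * v) / \<sigma> - (- exp (- \<sigma> * (v - \<eta>)) / \<sigma>)"
        by (rule integral_FTC_Icc) (use \<eta> \<sigma> in \<open>auto intro!: derivative_eq_intros continuous_intros simp flip: has_real_derivative_iff_has_vector_derivative\<close>)
      then have "(LINT x|lborel. indicator {v - \<eta>..v} x *\<^sub>R exp (- \<sigma> * x)) = ((exp (\<sigma> * \<eta>) - 1) / \<sigma>) * exp (- \<sigma> * v)"
      proof -
        have "exp (- \<sigma> * (v - \<eta>)) = exp (\<sigma> * \<eta>) * exp (- \<sigma> * v)" by (simp add: right_diff_distrib flip: exp_add)
        moreover assume "(LINT x|lborel. indicator {v - \<eta>..v} x *\<^sub>R exp (- \<sigma> * x)) = - exp (- \<sigma> * v) / \<sigma> - (- exp (- \<sigma> * (v - \<eta>)) / \<sigma>)"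
        ultimately show ?thesis using \<sigma> by (simp only:) (simp add: field_simps)
      qed
      note E = this
      have N: "norm (indicator {v - \<eta>..v} x *\<^sub>R (of_real (a v) * exp (- Complex \<sigma> t * of_real x))) = \<bar>a v\<bar> * (indicator {v - \<eta>..v} x *\<^sub>R exp (- \<sigma> * x))" for x
        by (simp add: norm_mult indicator_def)
      show ?thesis unfolding N integral_mult_right_zero E by (simp add: abs_mult)
    qed
    show "integrable lborel (\<lambda>v. LINT x|lborel. norm (case (v, x) of (v, x) \<Rightarrow> indicator {v - \<eta>..v} x *\<^sub>R (of_real (a v) * exp (- Complex \<sigma> t * of_real x))))"
      unfolding prod.case eq by (intro integrable_mult_right integrable_abs inta)
    show "AE v in lborel. integrable lborel (\<lambda>x. case (v, x) of (v, x) \<Rightarrow> indicator {v - \<eta>..v} x *\<^sub>R (of_real (a v) * exp (- Complex \<sigma> t * of_real x)))"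
      unfolding prod.case by (intro AE_I2 borel_integrable_compact continuous_intros) auto
    define e where "e x = exp (- Complex \<sigma> t * of_real x)" for x
    have [measurable]: "e \<in> borel_measurable borel"
      unfolding e_def by (intro borel_measurable_continuous_onI continuous_intros)
    \<comment> \<open>Joint measurability becomes visible once the condition is written in terms of
      the difference v - x.\<close>
    have "(\<lambda>p. indicator {0..\<eta>} (fst p - snd p) *\<^sub>R (of_real (a (fst p)) * e (snd p))) \<in> borel_measurable (lborel \<Otimes>\<^sub>M lborel)"
      by measurable
    also have "(\<lambda>p. indicator {0..\<eta>} (fst p - snd p) *\<^sub>R (of_real (a (fst p)) * e (snd p))) = 
        (\<lambda>(v, x). indicator {v - \<eta>..v} x *\<^sub>R (of_real (a v) * exp (- Complex \<sigma> t * of_real x)))"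
      by (auto simp: fun_eq_iff e_def indicator_def)
    finally show "(\<lambda>(v, x). indicator {v - \<eta>..v} x *\<^sub>R (of_real (a v) * exp (- Complex \<sigma> t * of_real x))) \<in> borel_measurable (lborel \<Otimes>\<^sub>M lborel)" .
  qed
  have swapped: "(case (v, x) of (v, x) \<Rightarrow> indicator {v - \<eta>..v} x *\<^sub>R (of_real (a v) * exp (- Complex \<sigma> t * of_real x)))
      = exp (- Complex \<sigma> t * of_real x) * of_real (indicator {x..x+\<eta>} v * a v)" for v x t
    by (auto simp: indicator_def)
  have inner: "(LINT v|lborel. (case (v, x) of (v, x) \<Rightarrow> indicator {v - \<eta>..v} x *\<^sub>R (of_real (a v) * exp (- Complex \<sigma> t * of_real x)))) = \<psi> x * iexp (- (t * x))" for x t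
  proof -
    have "exp (- Complex \<sigma> t * of_real x) = of_real (exp (- \<sigma> * x)) * iexp (- (t * x))"
    proof -
      have "- Complex \<sigma> t * of_real x = of_real (- \<sigma> * x) + \<i> * of_real (- (t * x))"
        by (simp add: complex_eq_iff)
      then show ?thesis by (simp only: exp_add exp_of_real)
    qed
    then show ?thesis unfolding swapped integral_mult_right_zero integral_complex_of_real \<psi>_def B_def
      by (simp only: of_real_mult mult_ac)
  qed
  have intpsi: "integrable lborel \<psi>"
  proof -
    have "integrable lborel (\<lambda>x. \<psi> x * iexp (- (0 * x)))"
      using lborel_pair.integrable_snd[OF pair[of 0]] unfolding inner[unfolded prod.case] .
    then show ?thesis by simp
  qed
  have hat: "(LINT x|lborel. \<psi> x * iexp (- (t * x))) = laplace a (Complex \<sigma> t) * ((exp (of_real \<eta> * Complex \<sigma> t) - 1) / Complex \<sigma> t)" for t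
  proof -
    let ?s = "Complex \<sigma> t"
    have s0: "?s \<noteq> 0" using \<sigma> by (auto simp: complex_eq_iff)
    have "(LINT x|lborel. \<psi> x * iexp (- (t * x))) = (LINT v|lborel. LINT x|lborel. indicator {v - \<eta>..v} x *\<^sub>R (of_real (a v) * exp (- ?s * of_real x)))"
      unfolding inner[symmetric] using lborel_pair.Fubini_integral[OF pair[of t]] by simp
    also have "\<dots> = (LINT v|lborel. of_real (a v) * exp (- ?s * of_real v) * ((exp (of_real \<eta> * ?s) - 1) / ?s))"
    proof (rule Bochner_Integration.integral_cong[OF refl])
      fix v :: real
      have "((\<lambda>x. - exp (- ?s * of_real x) / ?s) has_vector_derivative exp (- ?s * of_real x)) (at x within {v - \<eta>..v})" for x
      proof -
        have "((\<lambda>z. - exp (- ?s * z) / ?s) has_field_derivative exp (- ?s * of_real x)) (at (of_real x))"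
          using s0 by (auto intro!: derivative_eq_intros)
        then show ?thesis by (rule has_vector_derivative_real_field)
      qed
      then have "(LINT x|lborel. indicator {v - \<eta>..v} x *\<^sub>R exp (- ?s * of_real x)) = - exp (- ?s * of_real v) / ?s - (- exp (- ?s * of_real (v - \<eta>)) / ?s)"
        using \<eta> by (intro integral_FTC_Icc continuous_intros) auto
      also have "\<dots> = exp (- ?s * of_real v) * ((exp (of_real \<eta> * ?s) - 1) / ?s)"
      proof -
        have "exp (- ?s * of_real (v - \<eta>)) = exp (- ?s * of_real v) * exp (of_real \<eta> * ?s)"
          by (simp add: exp_add[symmetric] algebra_simps)
        then show ?thesis by (simp add: right_diff_distrib diff_divide_distrib)
      qed
      finally show "(LINT x|lborel. indicator {v - \<eta>..v} x *\<^sub>R (of_real (a v) * exp (- ?s * of_real x))) = of_real (a v) * exp (- ?s * of_real v) * ((exp (of_real \<eta> * ?s) - 1) / ?s)"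
        by (simp only: mult_scaleR_right[symmetric] integral_mult_right_zero mult.assoc)
    qed
    also have "\<dots> = laplace a ?s * ((exp (of_real \<eta> * ?s) - 1) / ?s)"
      unfolding laplace_def by (rule integral_mult_left_zero)
    finally show ?thesis .
  qed
  have "norm (\<psi> u) \<le> (1 / (2 * pi)) * (LINT t|lborel. norm (LINT x|lborel. \<psi> x * iexp (- (t * x))))"
  proof (rule norm_le_integral_fourier[OF intpsi contpsi bd])
    have "(\<lambda>t. LINT x|lborel. \<psi> x * iexp (- (t * x))) \<in> borel_measurable lborel"
      unfolding \<psi>_def by measurable
    moreover have "integrable lborel (\<lambda>t. norm (LINT x|lborel. \<psi> x * iexp (- (t * x))))"
      using int unfolding hat norm_mult K_def .
    ultimately show "integrable lborel (\<lambda>t. LINT x|lborel. \<psi> x * iexp (- (t * x)))"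
      by (simp add: integrable_norm_iff)
  qed
  then have "exp (- \<sigma> * u) * \<bar>B u\<bar> \<le> (1 / (2 * pi)) * (LINT t|lborel. K t)"
    unfolding hat norm_mult K_def by (simp add: \<psi>_def abs_mult norm_mult)
  then have "exp (\<sigma> * u) * (exp (- \<sigma> * u) * \<bar>B u\<bar>) \<le> exp (\<sigma> * u) * ((1 / (2 * pi)) * (LINT t|lborel. K t))"
    by (intro mult_left_mono) auto
  moreover have "exp (\<sigma> * u) * (exp (- \<sigma> * u) * \<bar>B u\<bar>) = \<bar>B u\<bar>" by (simp flip: mult.assoc exp_add)
  ultimately have "\<bar>B u\<bar> \<le> exp (\<sigma> * u) * ((1 / (2 * pi)) * (LINT t|lborel. K t))" by (simp only:)
  then show ?thesis unfolding B_def by simp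
qed

section \<open>The transform of the error term\<close>

text \<open>The two sides are logarithms of \<open>\<zeta>\<close>, so they differ by a continuous function with values
  in \<open>2 \<pi> \<i> \<int>\<close>, which is 0 at real points.\<close>

lemma log_zeta_near_1:
  assumes near: "\<And>w. norm (w - 1) < d \<Longrightarrow> norm (zeta_num w - 1) < 1"
    and d: "0 < d" "d \<le> 1/4" and s: "Re s > 1" "norm (s - 1) < d"
  shows "log_zeta s = Ln (zeta_num s) - Ln (s - 1)"
proof -
  define S where "S = {s. Re s > 1} \<inter> ball 1 d"
  define D where "D s = log_zeta s + Ln (s - 1) - Ln (zeta_num s)" for s
  have S: "Re w > 1" "norm (w - 1) < d" "zeta_num w \<notin> \<real>\<^sub>\<le>\<^sub>0" "zeta_num w \<noteq> 0" "w - 1 \<notin> \<real>\<^sub>\<le>\<^sub>0" "w \<noteq> 1" if "w \<in> S" for w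
  proof -
    show w: "Re w > 1" "norm (w - 1) < d" using that by (auto simp: S_def dist_norm norm_minus_commute)
    have "\<bar>Re (zeta_num w - 1)\<bar> < 1" using near[OF w(2)] abs_Re_le_cmod[of "zeta_num w - 1"] by linarith
    then have "Re (zeta_num w) > 0" by simp
    then show "zeta_num w \<notin> \<real>\<^sub>\<le>\<^sub>0" "zeta_num w \<noteq> 0" by (auto simp: complex_nonpos_Reals_iff)
    show "w - 1 \<notin> \<real>\<^sub>\<le>\<^sub>0" "w \<noteq> 1" using w by (auto simp: complex_nonpos_Reals_iff)
  qed
  have "convex S" unfolding S_def by (intro convex_Int convex_halfspace_Re_gt convex_ball)
  then have con: "connected S" by (rule convex_connected)
  have "continuous_on S log_zeta" by (rule continuous_on_subset[OF continuous_on_log_zeta]) (auto simp: S_def)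
  moreover have "continuous_on S zeta_num"
    by (rule holomorphic_on_imp_continuous_on[OF holomorphic_on_subset[OF holomorphic_zeta_num]]) (auto simp: S_def)
  ultimately have cont: "continuous_on S D"
    unfolding D_def using S by (intro continuous_intros) auto
  have expD: "exp (D w) = 1" if "w \<in> S" for w
    using S[OF that] by (simp add: D_def exp_add exp_diff exp_log_zeta)
  have "D constant_on S"
  proof (rule continuous_discrete_range_constant[OF con cont])
    fix x assume x: "x \<in> S"
    show "\<exists>e>0. \<forall>y. y \<in> S \<and> D y \<noteq> D x \<longrightarrow> e \<le> norm (D y - D x)"
    proof (intro exI[of _ "2 * pi"] conjI allI impI)
      fix y assume y: "y \<in> S \<and> D y \<noteq> D x"
      then have "exp (D y - D x) = 1" using expD x by (simp add: exp_diff)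
      then obtain n :: int where n: "Re (D y - D x) = 0" "Im (D y - D x) = of_int (2 * n) * pi"
        by (auto simp: exp_eq_1)
      with y have "n \<noteq> 0" by (auto simp: complex_eq_iff)
      then have "1 \<le> \<bar>n\<bar>" by simp
      then have "(1::real) \<le> \<bar>of_int n\<bar>" by (simp flip: of_int_abs)
      then have "2 * pi \<le> \<bar>of_int (2 * n) * pi\<bar>" by (simp add: abs_mult)
      also have "\<dots> \<le> norm (D y - D x)" using abs_Im_le_cmod[of "D y - D x"] n by simp
      finally show "2 * pi \<le> norm (D y - D x)" .
    qed simp
  qed
  then obtain k where k: "\<And>w. w \<in> S \<Longrightarrow> D w = k" by (auto simp: constant_on_def)
  define x where "x = 1 + d / 2"
  have x: "x > 1" "complex_of_real x \<in> S" using d by (auto simp: x_def S_def dist_norm)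
  have zn: "zeta_num (of_real x) = exp (log_zeta (of_real x)) * of_real (x - 1)"
    using exp_log_zeta[of "of_real x"] x by simp
  have lr: "log_zeta (of_real x) \<in> \<real>"
  proof -
    have "log_zeta_term p (of_real x) \<in> \<real>" for p
    proof (cases "prime p")
      case True
      have p: "real p > 1" using True prime_gt_1_nat by auto
      have 1: "of_nat p powr (- complex_of_real x) = of_real (real p powr (-x))"
        using powr_of_real[of "real p" "-x"] p by simp
      have "real p powr (-x) < real p powr 0" using p x by (intro powr_less_mono) auto
      then have "1 - real p powr (-x) > 0" using p by simp
      then have "Ln (of_real (1 - real p powr (-x))) = of_real (ln (1 - real p powr (-x)))" by (rule Ln_of_real)
      then show ?thesis using True by (simp add: log_zeta_term_def 1)
    qed (auto simp: log_zeta_term_def)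
    moreover have "(\<lambda>p. log_zeta_term p (of_real x)) sums log_zeta (of_real x)"
      unfolding log_zeta_def using x by (intro summable_sums summable_log_zeta_term) auto
    ultimately have "(\<lambda>N. \<Sum>p<N. log_zeta_term p (of_real x)) \<longlonglongrightarrow> log_zeta (of_real x)" "\<And>N. (\<Sum>p<N. log_zeta_term p (of_real x)) \<in> \<real>"
      by (auto simp: sums_def)
    then show ?thesis by (intro Lim_in_closed_set[OF closed_complex_Reals]) auto
  qed
  then obtain l where l: "log_zeta (of_real x) = of_real l" by (auto elim: Reals_cases)
  have "D (of_real x) = 0"
  proof -
    have 1: "zeta_num (of_real x) = of_real (exp l * (x - 1))" unfolding zn l by (simp add: exp_of_real)
    have "exp l * (x - 1) > 0" "x - 1 > 0" using x by auto
    note L = this[THEN Ln_of_real]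
    have "D (of_real x) = of_real l + Ln (of_real (x - 1)) - Ln (of_real (exp l * (x - 1)))"
      unfolding D_def 1 l by simp
    also have "\<dots> = of_real (l + ln (x - 1) - ln (exp l * (x - 1)))"
      unfolding L by (simp only: of_real_add of_real_diff)
    also have "ln (exp l * (x - 1)) = l + ln (x - 1)" using x by (subst ln_mult_pos) auto
    finally show ?thesis by simp
  qed
  then have "k = 0" using k[OF x(2)] by simp
  moreover have "s \<in> S" using s by (auto simp: S_def dist_norm norm_minus_commute)
  ultimately show ?thesis using k[of s] by (simp add: D_def algebra_simps)
qed

lemma zeta_num_near_1:
  obtains d where "0 < d" "d \<le> 1/8" "\<And>s. norm (s - 1) < d \<Longrightarrow> norm (zeta_num s - 1) < 1/2"
proof -
  have "isCont zeta_num 1"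
    using holomorphic_on_imp_continuous_on[OF holomorphic_zeta_num] open_halfspace_Re_gt[of "3/4"]
    by (intro continuous_on_interior[of "{s. Re s > 3/4}"]) (auto simp: interior_open)
  then obtain d where d: "d > 0" "\<And>s. norm (s - 1) < d \<Longrightarrow> norm (zeta_num s - 1) < 1/2"
    unfolding continuous_at_eps_delta by (metis dist_norm zeta_num_1 half_gt_zero_iff zero_less_one)
  show ?thesis by (rule that[of "min d (1/8)"]) (use d in auto)
qed

text \<open>This is the Laplace transform of \<open>omega_error\<close> (see
  \<open>laplace_omega_error\<close>). In the subtracted term the Gamma(r) from the transform of
  exp(v) v^(r-1) has cancelled the 1/Gamma(r) of the leading coefficient.\<close>

definition error_transform :: "real \<Rightarrow> complex \<Rightarrow> complex" where
  "error_transform r s = omega_dseries r s / s - of_real (g_one r) * exp (- of_real r * Ln (s - 1))"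

text \<open>Near 1 the function is (s-1)^(-r) (Q(s) - Q(1)) with Q holomorphic around 1 and Q(1) =
  g(1,r), hence O(|s-1|^(1-r)). Cauchy's estimate on a disc whose radius is half the distance to 1
  turns this into |s-1|^(-2-r) for the third derivative.\<close>

lemma error_transform_near:
  assumes R: "R > 0"
  shows "\<exists>d>0. \<exists>C>0. \<forall>r s. 0 \<le> r \<longrightarrow> r \<le> R \<longrightarrow> Re s > 1 \<longrightarrow> norm (s - 1) < d \<longrightarrow>
    norm ((deriv ^^ 3) (error_transform r) s) \<le> C * norm (s - 1) powr (- 2 - r)"
proof -
  obtain d where d: "0 < d" "d \<le> 1/8" "\<And>s. norm (s - 1) < d \<Longrightarrow> norm (zeta_num s - 1) < 1/2"
    using zeta_num_near_1 by blast
  obtain CG where CG: "CG > 0" "\<And>r s. 0 \<le> r \<Longrightarrow> r \<le> R \<Longrightarrow> Re s \<ge> 3/4 \<Longrightarrow> norm (conv_prod r s) \<le> CG"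
    using norm_conv_prod_le[OF R] by meson
  define Q where "Q r s = exp (of_real r * Ln (zeta_num s)) * conv_prod r s / s" for r s
  define C1 where "C1 = (3/2) powr R * CG * 2"
  have C1: "C1 > 0" using CG by (simp add: C1_def)
  have bl: "Re s > 7/8" "norm s \<ge> 1/2" "zeta_num s \<notin> \<real>\<^sub>\<le>\<^sub>0" "zeta_num s \<noteq> 0" "norm (zeta_num s) \<le> 3/2" if "norm (s - 1) < d" for s
  proof -
    have "\<bar>Re (s - 1)\<bar> < 1/8" using that d abs_Re_le_cmod[of "s - 1"] by linarith
    then have "- Re (s - 1) < 1/8" using abs_ge_minus_self[of "Re (s - 1)"] by linarith
    then show 1: "Re s > 7/8" by simp
    then show "norm s \<ge> 1/2" using complex_Re_le_cmod[of s] by linarith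
    have "\<bar>Re (zeta_num s - 1)\<bar> < 1/2" using d(3)[OF that] abs_Re_le_cmod[of "zeta_num s - 1"] by linarith
    then have "- Re (zeta_num s - 1) < 1/2" using abs_ge_minus_self[of "Re (zeta_num s - 1)"] by linarith
    then have "Re (zeta_num s) > 0" by simp
    then show "zeta_num s \<notin> \<real>\<^sub>\<le>\<^sub>0" "zeta_num s \<noteq> 0" by (auto simp: complex_nonpos_Reals_iff)
    show "norm (zeta_num s) \<le> 3/2" using d(3)[OF that] norm_triangle_ineq2[of "zeta_num s" 1] by simp
  qed
  have nz: "zeta_num w \<notin> \<real>\<^sub>\<le>\<^sub>0" "w \<noteq> 0" "Re w > 3/4" if "w \<in> ball 1 d" for w
  proof -
    have "norm (w - 1) < d" using that by (simp add: dist_norm norm_minus_commute)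
    note bl[OF this]
    then show "zeta_num w \<notin> \<real>\<^sub>\<le>\<^sub>0" "w \<noteq> 0" "Re w > 3/4" by auto
  qed
  have holQ: "Q r holomorphic_on ball 1 d" if "0 \<le> r" for r
    unfolding Q_def
  proof (intro holomorphic_intros)
    show "zeta_num holomorphic_on ball 1 d"
      by (rule holomorphic_on_subset[OF holomorphic_zeta_num]) (use nz in blast)
    show "conv_prod r holomorphic_on ball 1 d"
      by (rule holomorphic_on_subset[OF holomorphic_conv_prod[OF that]]) (use nz in blast)
  qed (use nz in blast)+
  have Q_le: "norm (Q r s) \<le> C1" if "0 \<le> r" "r \<le> R" "norm (s - 1) < d" for r s
  proof -
    have "norm (Q r s) = norm (zeta_num s) powr r * norm (conv_prod r s) * (1 / norm s)"
      using bl[OF that(3)] by (simp only: Q_def norm_mult norm_divide norm_exp_Ln) (simp add: powr_def)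
    also have "\<dots> \<le> (3/2) powr R * CG * 2"
    proof (intro mult_mono)
      have "norm (zeta_num s) powr r \<le> (3/2) powr r" using bl[OF that(3)] that by (intro powr_mono2) auto
      also have "\<dots> \<le> (3/2) powr R" using that by (intro powr_mono) auto
      finally show "norm (zeta_num s) powr r \<le> (3/2) powr R" .
      show "norm (conv_prod r s) \<le> CG" using bl[OF that(3)] that by (intro CG) auto
      show "1 / norm s \<le> 2" using bl(2)[OF that(3)] frac_le[of 1 1 "1/2" "norm s"] by simp
    qed (use CG in auto)
    finally show ?thesis by (simp add: C1_def)
  qed
  \<comment> \<open>Cauchy's bound for Q' at points of \<open>ball 1 (d / 2)\<close>: discs of
    radius d/4 about them stay in \<open>ball 1 d\<close>, where |Q| \<le> C1.\<close>
  define C2 where "C2 = C1 / (d / 4)"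
  have Q1: "Q r 1 = of_real (g_one r)" if "0 \<le> r" for r
    using that by (simp add: Q_def conv_prod_1)
  have Qlip: "norm (Q r s - of_real (g_one r)) \<le> C2 * norm (s - 1)" if r: "0 \<le> r" "r \<le> R" and s: "norm (s - 1) < d / 2" for r s
  proof -
    have "norm (Q r s - Q r 1) \<le> C2 * norm (s - 1)"
    proof (rule field_differentiable_bound[where S = "ball 1 (d/2)" and f' = "deriv (Q r)"])
      fix w :: complex assume w: "w \<in> ball 1 (d / 2)"
      then have "(Q r has_field_derivative deriv (Q r) w) (at w)"
        using d by (intro holomorphic_derivI[OF holQ[OF r(1)]]) auto
      then show "(Q r has_field_derivative deriv (Q r) w) (at w within ball 1 (d/2))"
        by (rule has_field_derivative_at_within)
      have sub: "cball w (d/4) \<subseteq> ball 1 d"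
      proof
        fix z assume "z \<in> cball w (d/4)"
        then show "z \<in> ball 1 d" using w d dist_triangle[of 1 z w] by simp
      qed
      have "norm ((deriv ^^ 1) (Q r) w) \<le> fact 1 * C1 / (d / 4) ^ 1"
      proof (rule Cauchy_inequality)
        show "Q r holomorphic_on ball w (d/4)" using sub ball_subset_cball by (intro holomorphic_on_subset[OF holQ[OF r(1)]]) blast
        show "continuous_on (cball w (d/4)) (Q r)"
          by (intro holomorphic_on_imp_continuous_on holomorphic_on_subset[OF holQ[OF r(1)] sub])
        fix z assume "norm (w - z) = d / 4"
        then have "z \<in> cball w (d/4)" by (simp add: dist_norm)
        then have "z \<in> ball 1 d" using sub by blast
        then show "norm (Q r z) \<le> C1" using r by (intro Q_le) (auto simp: dist_norm norm_minus_commute)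
      qed (use d in auto)
      then show "norm (deriv (Q r) w) \<le> C2" by (simp add: C2_def)
    qed (use s d in \<open>auto simp: dist_norm norm_minus_commute\<close>)
    then show ?thesis using Q1[OF r(1)] by simp
  qed
  define C3 where "C3 = 2 powr R * (C2 * 2)"
  have C2: "C2 > 0" using C1 d by (simp add: C2_def)
  have "norm ((deriv ^^ 3) (error_transform r) s0) \<le> 48 * C3 * norm (s0 - 1) powr (- 2 - r)"
    if r: "0 \<le> r" "r \<le> R" and s0: "Re s0 > 1" "norm (s0 - 1) < d / 4" for r s0
  proof -
    define b where "b = norm (s0 - 1)"
    have b: "b > 0" "b < d / 4" using s0 by (auto simp: b_def)
    define f where "f s = exp (- of_real r * Ln (s - 1)) * (Q r s - of_real (g_one r))" for s
    have disc: "norm (s - 1) \<ge> b / 2" "norm (s - 1) < d / 2" "norm (s - 1) \<le> 2 * b" "s - 1 \<notin> \<real>\<^sub>\<le>\<^sub>0" "s \<noteq> 1" if "s \<in> cball s0 (b / 2)" for s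
    proof -
      have "norm (s - s0) \<le> b / 2" using that by (simp add: dist_norm norm_minus_commute)
      then show 1: "norm (s - 1) \<ge> b / 2" "norm (s - 1) < d / 2" "norm (s - 1) \<le> 2 * b"
        using norm_triangle_ineq[of "s - s0" "s0 - 1"] norm_triangle_ineq2[of "s0 - 1" "s0 - s"] b
        by (auto simp: b_def norm_minus_commute)
      show "s \<noteq> 1" using 1 b by auto
      \<comment> \<open>As Re s0 > 1, the point of the cut that is nearest to s0 is 1, at distance
        b, so a disc of radius b/2 misses the cut.\<close>
      show "s - 1 \<notin> \<real>\<^sub>\<le>\<^sub>0"
      proof
        assume "s - 1 \<in> \<real>\<^sub>\<le>\<^sub>0"
        then have im: "Im s = 0" "Re s \<le> 1" by (auto simp: complex_nonpos_Reals_iff)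
        have "norm (s0 - 1) \<le> norm (s0 - s)"
          unfolding cmod_def using im s0 by (intro real_sqrt_le_mono add_mono) (auto intro!: power_mono)
        then have "b \<le> norm (s0 - s)" by (simp add: b_def)
        moreover have "norm (s0 - s) \<le> b / 2" using \<open>norm (s - s0) \<le> b / 2\<close> by (metis norm_minus_commute)
        ultimately show False using b by linarith
      qed
    qed
    have sub: "cball s0 (b / 2) \<subseteq> ball 1 d"
      using disc(2) d by (force simp: dist_norm norm_minus_commute)
    have holf: "f holomorphic_on cball s0 (b / 2)"
      unfolding f_def using disc by (intro holomorphic_intros holomorphic_on_subset[OF holQ[OF r(1)] sub]) auto
    have ev: "\<forall>\<^sub>F s in nhds s0. error_transform r s = f s"
    proof (rule eventually_mono[OF eventually_nhds_in_open[of "{s. Re s > 1} \<inter> ball s0 (b/2)"]])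
      fix s assume "s \<in> {s. Re s > 1} \<inter> ball s0 (b/2)"
      then have s: "Re s > 1" "s \<in> cball s0 (b/2)" by auto
      have n: "norm (s - 1) < d" using disc(2)[OF s(2)] d by simp
      have "log_zeta s = Ln (zeta_num s) - Ln (s - 1)"
        by (rule log_zeta_near_1[of d]) (use d(1,2) d(3) n s in \<open>force\<close>)+
      then have "exp (of_real r * log_zeta s) = exp (- of_real r * Ln (s - 1)) * exp (of_real r * Ln (zeta_num s))"
        by (simp only:) (simp add: right_diff_distrib flip: exp_add)
      then show "error_transform r s = f s"
        unfolding error_transform_def f_def Q_def omega_dseries_eq[OF s(1) r(1)] by (simp add: algebra_simps)
    qed (use s0 b in \<open>auto simp: open_halfspace_Re_gt\<close>)
    have "norm ((deriv ^^ 3) f s0) \<le> fact 3 * (C3 * b powr (1 - r)) / (b / 2) ^ 3"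
    proof (rule Cauchy_inequality)
      show "f holomorphic_on ball s0 (b/2)" by (rule holomorphic_on_subset[OF holf]) auto
      show "continuous_on (cball s0 (b/2)) f" by (rule holomorphic_on_imp_continuous_on[OF holf])
      fix s assume "norm (s0 - s) = b / 2"
      then have s: "s \<in> cball s0 (b/2)" by (simp add: dist_norm)
      note ds = disc[OF s]
      have "norm (exp (- of_real r * Ln (s - 1))) = norm (s - 1) powr (- r)"
        using norm_exp_Ln[of "s - 1" "-r"] ds by simp
      also have "\<dots> \<le> (b / 2) powr (- r)" using ds b r by (intro powr_mono2') auto
      also have "\<dots> = 2 powr r * b powr (-r)" using b by (simp add: powr_divide powr_minus field_simps)
      also have "\<dots> \<le> 2 powr R * b powr (-r)" using r by (intro mult_right_mono powr_mono) auto
      finally have e: "norm (exp (- of_real r * Ln (s - 1))) \<le> 2 powr R * b powr (-r)" .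
      have "norm (Q r s - of_real (g_one r)) \<le> C2 * norm (s - 1)" using ds r by (intro Qlip) auto
      also have "\<dots> \<le> C2 * (2 * b)" using ds C2 by (intro mult_left_mono) auto
      finally have "norm (f s) \<le> (2 powr R * b powr (-r)) * (C2 * (2 * b))"
        unfolding f_def norm_mult using e by (intro mult_mono) auto
      also have "\<dots> = C3 * (b powr (-r) * b powr 1)" using b by (simp add: C3_def mult_ac)
      also have "b powr (-r) * b powr 1 = b powr (1 - r)" by (subst powr_add[symmetric]) (simp add: add.commute)
      finally show "norm (f s) \<le> C3 * b powr (1 - r)" .
    qed (use b in auto)
    \<comment> \<open>48 = 3! * 2^3, from the radius b/2.\<close>
    also have "\<dots> = 48 * C3 * (b powr (1 - r) / b powr 3)"
      using b by (simp add: powr_numeral power_divide fact_numeral)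
    also have "b powr (1 - r) / b powr 3 = b powr (- 2 - r)"
      using b by (subst powr_diff[symmetric]) simp
    finally show "norm ((deriv ^^ 3) (error_transform r) s0) \<le> 48 * C3 * norm (s0 - 1) powr (- 2 - r)"
      using higher_deriv_cong_ev[OF ev refl, of 3] by (simp add: b_def)
  qed
  moreover have "d / 4 > 0" "48 * C3 > 0" using d C2 by (auto simp: C3_def)
  ultimately show ?thesis by blast
qed

section \<open>Upper and lower bounds for zeta away from the pole\<close>

definition zeta_fn :: "complex \<Rightarrow> complex" where "zeta_fn s = zeta_num s / (s - 1)"

lemma zeta_fn_eq: "Re s > 1 \<Longrightarrow> zeta_fn s = exp (log_zeta s)"
  by (simp add: zeta_fn_def exp_log_zeta)

lemma holomorphic_zeta_fn: "zeta_fn holomorphic_on ({s. Re s > 3/4} - {1})"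
  unfolding zeta_fn_def by (intro holomorphic_intros holomorphic_on_subset[OF holomorphic_zeta_num]) auto

lemma open_zeta_fn_domain: "open ({s. Re s > 3/4} - {1})"
  by (intro open_Diff open_halfspace_Re_gt) simp

text \<open>The bound holds on a whole disc of fixed radius around s0 and is expressed through Im s0
  alone, so that Cauchy's estimate can be applied to it. Division by s - 1 is harmless because |s-1|
  \<ge> d/2 there.\<close>

lemma norm_zeta_fn_le:
  assumes a: "0 < a" "a \<le> 1/8" and d: "0 < d" "d \<le> 1/4"
  shows "\<exists>C>0. \<forall>s0 s. 1 \<le> Re s0 \<longrightarrow> Re s0 \<le> 2 \<longrightarrow> \<bar>Im s0\<bar> \<ge> d \<longrightarrow> norm (s - s0) \<le> min a (d/2) \<longrightarrow>
     norm (zeta_fn s) \<le> C * (\<bar>Im s0\<bar> + 2) powr (2 * a)"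
proof -
  obtain C where C: "C > 0" "\<And>s. Re s \<ge> 1 - a \<Longrightarrow> norm (zeta_num s - 1) \<le> C * norm (s - 1) * norm s powr (2 * a)"
    using norm_zeta_num_minus_1_le[of a] a by auto
  show ?thesis
  proof (intro exI[of _ "2 / d + C * 2"] conjI allI impI)
    fix s0 s assume s0: "1 \<le> Re s0" "Re s0 \<le> 2" "\<bar>Im s0\<bar> \<ge> d" and s: "norm (s - s0) \<le> min a (d/2)"
    let ?\<tau> = "\<bar>Im s0\<bar> + 2"
    have re: "\<bar>Re s - Re s0\<bar> \<le> a" "\<bar>Im s - Im s0\<bar> \<le> d / 2"
      using s abs_Re_le_cmod[of "s - s0"] abs_Im_le_cmod[of "s - s0"] by auto
    have im: "\<bar>Im s\<bar> \<ge> d / 2" "\<bar>Im s\<bar> \<le> ?\<tau> - 2 + d / 2" using re s0 by linarith+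
    have n1: "norm (s - 1) \<ge> d / 2" using abs_Im_le_cmod[of "s - 1"] im by simp
    then have nz: "norm (s - 1) > 0" using d by linarith
    have "norm s \<le> \<bar>Re s\<bar> + \<bar>Im s\<bar>" by (rule cmod_le)
    also have "\<dots> \<le> 2 * ?\<tau>"
    proof -
      have "\<bar>Re s\<bar> \<le> 3" using re s0 a by linarith
      define I where "I = \<bar>Im s0\<bar>"
      have "I \<ge> 0" by (simp add: I_def)
      then have "3 + (I + 2 - 2 + d / 2) \<le> 2 * (I + 2)" using d by simp
      with add_mono[OF \<open>\<bar>Re s\<bar> \<le> 3\<close> im(2)] show ?thesis
        unfolding I_def by (rule order_trans)
    qed
    finally have ns: "norm s \<le> 2 * ?\<tau>" .
    have "norm (zeta_num s) \<le> 1 + norm (zeta_num s - 1)" using norm_triangle_ineq[of 1 "zeta_num s - 1"] by simp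
    also have "\<dots> \<le> 1 + C * norm (s - 1) * norm s powr (2 * a)" using C(2)[of s] re s0 by simp
    finally have "norm (zeta_fn s) \<le> (1 + C * norm (s - 1) * norm s powr (2 * a)) / norm (s - 1)"
      using nz by (simp add: zeta_fn_def norm_divide divide_right_mono)
    also have "\<dots> = 1 / norm (s - 1) + C * norm s powr (2 * a)" using nz by (simp add: field_simps)
    also have "\<dots> \<le> 2 / d * ?\<tau> powr (2 * a) + C * (2 * ?\<tau> powr (2 * a))"
    proof (intro add_mono mult_left_mono)
      have "1 / norm (s - 1) \<le> 2 / d * 1" using n1 nz d by (simp add: field_simps)
      also have "\<dots> \<le> 2 / d * ?\<tau> powr (2 * a)" using a d by (intro mult_left_mono ge_one_powr_ge_zero) auto
      finally show "1 / norm (s - 1) \<le> 2 / d * ?\<tau> powr (2 * a)" .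
      have "norm s powr (2 * a) \<le> (2 * ?\<tau>) powr (2 * a)" using ns a by (intro powr_mono2) auto
      also have "\<dots> = 2 powr (2 * a) * ?\<tau> powr (2 * a)" by (rule powr_mult)
      also have "\<dots> \<le> 2 powr 1 * ?\<tau> powr (2 * a)" using a by (intro mult_right_mono powr_mono) auto
      finally show "norm s powr (2 * a) \<le> 2 * ?\<tau> powr (2 * a)" by simp
    qed (use C in auto)
    finally show "norm (zeta_fn s) \<le> (2 / d + C * 2) * ?\<tau> powr (2 * a)" by (simp add: algebra_simps)
  qed (use C d in \<open>auto intro!: add_pos_pos\<close>)
qed

lemma zeta_fn_region:
  assumes "1 \<le> Re s0" "\<bar>Im s0\<bar> \<ge> d" "norm (s - s0) \<le> min a (d/2)" "0 < a" "a \<le> 1/8" "d > 0"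
  shows "s \<in> {s. Re s > 3/4} - {1}"
proof -
  have "\<bar>Re s - Re s0\<bar> \<le> a" "\<bar>Im s - Im s0\<bar> \<le> d / 2"
    using assms(3) abs_Re_le_cmod[of "s - s0"] abs_Im_le_cmod[of "s - s0"] by auto
  then have "Re s > 3/4" "Im s \<noteq> 0" using assms by auto
  then show ?thesis by auto
qed

lemma norm_deriv_zeta_fn_le:
  assumes a: "0 < a" "a \<le> 1/8" and d: "0 < d" "d \<le> 1/4"
  shows "\<exists>C>0. \<forall>s0 s. 1 \<le> Re s0 \<longrightarrow> Re s0 \<le> 2 \<longrightarrow> \<bar>Im s0\<bar> \<ge> d \<longrightarrow> norm (s - s0) \<le> min a (d/2) / 2 \<longrightarrow>
     norm (deriv zeta_fn s) \<le> C * (\<bar>Im s0\<bar> + 2) powr (2 * a)"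
proof -
  obtain C where C: "C > 0" "\<And>s0 s. 1 \<le> Re s0 \<Longrightarrow> Re s0 \<le> 2 \<Longrightarrow> \<bar>Im s0\<bar> \<ge> d \<Longrightarrow> norm (s - s0) \<le> min a (d/2) \<Longrightarrow>
     norm (zeta_fn s) \<le> C * (\<bar>Im s0\<bar> + 2) powr (2 * a)"
    using norm_zeta_fn_le[OF a d] by meson
  define q where "q = min a (d/2) / 2"
  have q: "q > 0" using a d by (simp add: q_def)
  show ?thesis
  proof (intro exI[of _ "C / q"] conjI allI impI)
    fix s0 s assume s0: "1 \<le> Re s0" "Re s0 \<le> 2" "\<bar>Im s0\<bar> \<ge> d" and s: "norm (s - s0) \<le> min a (d/2) / 2"
    have *: "norm (z - s0) \<le> min a (d/2)" if "z \<in> cball s q" for z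
      using that norm_triangle_ineq[of "z - s" "s - s0"] s by (simp add: dist_norm norm_minus_commute q_def)
    have hol: "zeta_fn holomorphic_on cball s q"
      by (rule holomorphic_on_subset[OF holomorphic_zeta_fn]) (use zeta_fn_region[OF s0(1,3) * a d(1)] in blast)
    have "norm ((deriv ^^ 1) zeta_fn s) \<le> fact 1 * (C * (\<bar>Im s0\<bar> + 2) powr (2 * a)) / q ^ 1"
    proof (rule Cauchy_inequality)
      show "zeta_fn holomorphic_on ball s q" by (rule holomorphic_on_subset[OF hol]) auto
      show "continuous_on (cball s q) zeta_fn" by (rule holomorphic_on_imp_continuous_on[OF hol])
      fix z assume "norm (s - z) = q"
      then have "z \<in> cball s q" by (simp add: dist_norm)
      then show "norm (zeta_fn z) \<le> C * (\<bar>Im s0\<bar> + 2) powr (2 * a)" using s0 * by (intro C(2)) auto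
    qed (use q in auto)
    then show "norm (deriv zeta_fn s) \<le> C / q * (\<bar>Im s0\<bar> + 2) powr (2 * a)" by simp
  qed (use C q in auto)
qed

lemma norm_zeta_fn_real_le: "\<exists>C>0. \<forall>\<sigma>. 1 < \<sigma> \<longrightarrow> \<sigma> \<le> 2 \<longrightarrow> norm (zeta_fn (of_real \<sigma>)) \<le> C / (\<sigma> - 1)"
proof -
  obtain C where C: "C > 0" "\<And>s. Re s \<ge> 1 - 1/8 \<Longrightarrow> norm (zeta_num s - 1) \<le> C * norm (s - 1) * norm s powr (2 * (1/8))"
    using norm_zeta_num_minus_1_le[of "1/8"] by auto
  show ?thesis
  proof (intro exI[of _ "1 + C * 2"] conjI allI impI)
    fix \<sigma> :: real assume \<sigma>: "1 < \<sigma>" "\<sigma> \<le> 2"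
    have n: "norm (complex_of_real \<sigma> - 1) = \<sigma> - 1" using \<sigma> norm_of_real[of "\<sigma> - 1", where 'a = complex] by simp
    have "norm (zeta_num (of_real \<sigma>)) \<le> 1 + norm (zeta_num (of_real \<sigma>) - 1)"
      using norm_triangle_ineq[of 1 "zeta_num (of_real \<sigma>) - 1"] by simp
    also have "\<dots> \<le> 1 + C * norm (complex_of_real \<sigma> - 1) * norm (complex_of_real \<sigma>) powr (2 * (1/8))"
      using C(2)[of "of_real \<sigma>"] \<sigma> by simp
    also have "\<dots> = 1 + C * ((\<sigma> - 1) * \<sigma> powr (1/4))" using \<sigma> unfolding n by simp
    also have "(\<sigma> - 1) * \<sigma> powr (1/4) \<le> 1 * 2 powr 1"
    proof (intro mult_mono)
      have "\<sigma> powr (1/4) \<le> \<sigma> powr 1" using \<sigma> by (intro powr_mono) auto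
      also have "\<dots> \<le> 2 powr 1" using \<sigma> by simp
      finally show "\<sigma> powr (1/4) \<le> 2 powr 1" .
    qed (use \<sigma> in auto)
    then have "1 + C * ((\<sigma> - 1) * \<sigma> powr (1/4)) \<le> 1 + C * 2" using C by simp
    finally show "norm (zeta_fn (of_real \<sigma>)) \<le> (1 + C * 2) / (\<sigma> - 1)"
      unfolding zeta_fn_def norm_divide n using \<sigma> by (intro divide_right_mono) auto
  qed (use C in auto)
qed

text \<open>De la Vallee Poussin's argument: the inequality \<open>3 + 4 cos \<theta> + cos 2\<theta> \<ge> 0\<close> bounds \<open>\<zeta>\<close> from
  below to the right of \<open>1 + \<kappa> \<tau>\<^sup>-\<^sup>1\<^sup>0\<^sup>a\<close>, and the bound for \<open>\<zeta>'\<close> carries this over to the line \<open>Re s = 1\<close>.\<close>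

lemma norm_zeta_fn_ge:
  assumes a: "0 < a" "a \<le> 1/8" and d: "0 < d" "d \<le> 1/4"
  shows "\<exists>c>0. \<forall>\<sigma> t. 1 < \<sigma> \<longrightarrow> \<sigma> \<le> 2 \<longrightarrow> \<bar>t\<bar> \<ge> d \<longrightarrow> norm (zeta_fn (Complex \<sigma> t)) \<ge> c * (\<bar>t\<bar> + 2) powr (- 8 * a)"
proof -
  obtain C1 where C1: "C1 > 0" "\<And>s0 s. 1 \<le> Re s0 \<Longrightarrow> Re s0 \<le> 2 \<Longrightarrow> \<bar>Im s0\<bar> \<ge> d \<Longrightarrow> norm (s - s0) \<le> min a (d/2) \<Longrightarrow>
     norm (zeta_fn s) \<le> C1 * (\<bar>Im s0\<bar> + 2) powr (2 * a)"
    using norm_zeta_fn_le[OF a d] by meson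
  obtain C2 where C2: "C2 > 0" "\<And>s0 s. 1 \<le> Re s0 \<Longrightarrow> Re s0 \<le> 2 \<Longrightarrow> \<bar>Im s0\<bar> \<ge> d \<Longrightarrow> norm (s - s0) \<le> min a (d/2) / 2 \<Longrightarrow>
     norm (deriv zeta_fn s) \<le> C2 * (\<bar>Im s0\<bar> + 2) powr (2 * a)"
    using norm_deriv_zeta_fn_le[OF a d] by meson
  obtain C3 where C3: "C3 > 0" "\<And>\<sigma>. 1 < \<sigma> \<Longrightarrow> \<sigma> \<le> 2 \<Longrightarrow> norm (zeta_fn (of_real \<sigma>)) \<le> C3 / (\<sigma> - 1)"
    using norm_zeta_fn_real_le by meson
  define K where "K = C3 ^ 3 * (C1 * 2)"
  have K: "K > 0" using C1 C3 by (simp add: K_def)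
  \<comment> \<open>At distance \<kappa> \<tau>^(-10a) from the line, with \<tau> = |t| + 2, the
    3-4-1 inequality gives |zeta|^4 \<ge> (\<kappa>^3/K) \<tau>^(-32a). The root must be at least
    twice C2 \<kappa> \<tau>^(-8a), the largest change of zeta over that distance; this amounts to
    16 C2^4 K \<kappa> \<le> 1.\<close>
  define \<kappa> where "\<kappa> = min 1 (1 / (16 * C2 ^ 4 * K))"
  have \<kappa>: "0 < \<kappa>" "\<kappa> \<le> 1" "\<kappa> \<le> 1 / (16 * C2 ^ 4 * K)" using K C2 by (auto simp: \<kappa>_def)
  have lower: "(\<sigma> - 1) ^ 3 \<le> K * (\<bar>t\<bar> + 2) powr (2 * a) * norm (zeta_fn (Complex \<sigma> t)) ^ 4" if \<sigma>: "1 < \<sigma>" "\<sigma> \<le> 2" and t: "\<bar>t\<bar> \<ge> d" for \<sigma> t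
  proof -
    have "1 \<le> norm (zeta_fn (of_real \<sigma>)) ^ 3 * norm (zeta_fn (Complex \<sigma> t)) ^ 4 * norm (zeta_fn (Complex \<sigma> (2 * t)))"
      using zeta_341[OF \<sigma>(1), of t] \<sigma> by (simp add: zeta_fn_eq del: norm_exp_eq_Re)
    also have "\<dots> \<le> (C3 / (\<sigma> - 1)) ^ 3 * norm (zeta_fn (Complex \<sigma> t)) ^ 4 * (C1 * 2 * (\<bar>t\<bar> + 2) powr (2 * a))"
    proof (intro mult_mono power_mono order_refl)
      show "norm (zeta_fn (of_real \<sigma>)) \<le> C3 / (\<sigma> - 1)" by (rule C3(2)[OF \<sigma>])
      have "norm (zeta_fn (Complex \<sigma> (2 * t))) \<le> C1 * (\<bar>Im (Complex \<sigma> (2 * t))\<bar> + 2) powr (2 * a)"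
        by (rule C1(2)) (use \<sigma> t a d in auto)
      also have "\<dots> \<le> C1 * ((2 * (\<bar>t\<bar> + 2)) powr (2 * a))"
        using a C1 by (intro mult_left_mono powr_mono2) (auto simp: abs_mult)
      also have "(2 * (\<bar>t\<bar> + 2)) powr (2 * a) = 2 powr (2 * a) * (\<bar>t\<bar> + 2) powr (2 * a)" by (rule powr_mult)
      also have "C1 * (2 powr (2 * a) * (\<bar>t\<bar> + 2) powr (2 * a)) \<le> C1 * (2 powr 1 * (\<bar>t\<bar> + 2) powr (2 * a))"
        using a C1 by (intro mult_left_mono mult_right_mono powr_mono) auto
      finally show "norm (zeta_fn (Complex \<sigma> (2 * t))) \<le> C1 * 2 * (\<bar>t\<bar> + 2) powr (2 * a)" by simp
    qed (use C3 \<sigma> in auto)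
    also have "\<dots> = K * (\<bar>t\<bar> + 2) powr (2 * a) * norm (zeta_fn (Complex \<sigma> t)) ^ 4 / (\<sigma> - 1) ^ 3"
      by (simp add: K_def power_divide)
    finally show ?thesis using \<sigma> by (simp add: field_simps)
  qed
  have big: "norm (zeta_fn (Complex \<sigma> t)) \<ge> 2 * C2 * \<kappa> * (\<bar>t\<bar> + 2) powr (- 8 * a)"
    if \<sigma>: "1 < \<sigma>" "\<sigma> \<le> 2" and t: "\<bar>t\<bar> \<ge> d" and far: "\<sigma> - 1 \<ge> \<kappa> * (\<bar>t\<bar> + 2) powr (- 10 * a)" for \<sigma> t
  proof -
    let ?\<tau> = "\<bar>t\<bar> + 2"
    have "(2 * C2 * \<kappa> * ?\<tau> powr (- 8 * a)) ^ 4 = 16 * C2 ^ 4 * \<kappa> * \<kappa> ^ 3 * ?\<tau> powr (- 32 * a)"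
      by (simp add: power_mult_distrib power4_eq_xxxx power3_eq_cube flip: powr_add)
    also have "\<dots> \<le> (1 / K) * \<kappa> ^ 3 * ?\<tau> powr (- 32 * a)"
      using \<kappa> K C2 by (intro mult_right_mono) (auto simp: field_simps)
    finally have L: "(2 * C2 * \<kappa> * ?\<tau> powr (- 8 * a)) ^ 4 \<le> (1 / K) * \<kappa> ^ 3 * ?\<tau> powr (- 32 * a)" .
    have "\<kappa> ^ 3 * ?\<tau> powr (- 30 * a) \<le> (\<sigma> - 1) ^ 3"
    proof -
      have "(?\<tau> powr (- 10 * a)) ^ 3 = ?\<tau> powr (- 30 * a)" by (simp add: power3_eq_cube flip: powr_add)
      then show ?thesis using power_mono[OF far, of 3] \<kappa> by (simp only: power_mult_distrib) simp
    qed
    then have "\<kappa> ^ 3 * ?\<tau> powr (- 30 * a) \<le> K * ?\<tau> powr (2 * a) * norm (zeta_fn (Complex \<sigma> t)) ^ 4"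
      using lower[OF \<sigma> t] by linarith
    then have "(1 / K) * ?\<tau> powr (- 2 * a) * (\<kappa> ^ 3 * ?\<tau> powr (- 30 * a)) \<le> (1 / K) * ?\<tau> powr (- 2 * a) * (K * ?\<tau> powr (2 * a) * norm (zeta_fn (Complex \<sigma> t)) ^ 4)"
      using K by (intro mult_left_mono) auto
    moreover have "?\<tau> powr (- 2 * a) * ?\<tau> powr (- 30 * a) = ?\<tau> powr (- 32 * a)" by (simp flip: powr_add)
    moreover have "?\<tau> powr (- 2 * a) * ?\<tau> powr (2 * a) = 1" by (simp flip: powr_add)
    ultimately have "(1 / K) * \<kappa> ^ 3 * ?\<tau> powr (- 32 * a) \<le> norm (zeta_fn (Complex \<sigma> t)) ^ 4"
      using K by (simp add: mult_ac)
    with L have "(2 * C2 * \<kappa> * ?\<tau> powr (- 8 * a)) ^ 4 \<le> norm (zeta_fn (Complex \<sigma> t)) ^ 4" by linarith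
    then have "(2 * C2 * \<kappa> * ?\<tau> powr (- 8 * a)) ^ Suc 3 \<le> norm (zeta_fn (Complex \<sigma> t)) ^ Suc 3"
      by (simp only: numeral_eq_Suc pred_numeral_simps BitM.simps arith_special)
    then show ?thesis by (rule power_le_imp_le_base) simp
  qed
  show ?thesis
  proof (intro exI[of _ "C2 * \<kappa>"] conjI allI impI)
    fix \<sigma> t :: real assume \<sigma>: "1 < \<sigma>" "\<sigma> \<le> 2" and t: "\<bar>t\<bar> \<ge> d"
    let ?\<tau> = "\<bar>t\<bar> + 2"
    define h where "h = \<kappa> * ?\<tau> powr (- 10 * a)"
    have "?\<tau> powr (- 10 * a) \<le> ?\<tau> powr 0" using a by (intro powr_mono) auto
    moreover have "?\<tau> \<noteq> 0" using abs_ge_zero[of t] by linarith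
    then have "?\<tau> powr 0 = 1" by (simp add: powr_def)
    ultimately have "h \<le> 1 * 1" unfolding h_def using \<kappa> by (intro mult_mono) auto
    then have h: "0 < h" "h \<le> 1" using \<kappa> by (auto simp: h_def)
    show "norm (zeta_fn (Complex \<sigma> t)) \<ge> C2 * \<kappa> * ?\<tau> powr (- 8 * a)"
    \<comment> \<open>To the right of 1 + h the inequality applies directly. To the left, moving
      horizontally from 1 + h changes zeta by at most half of its lower bound there.\<close>
    proof (cases "\<sigma> - 1 \<ge> h")
      case True
      have "C2 * \<kappa> * ?\<tau> powr (- 8 * a) \<le> 2 * C2 * \<kappa> * ?\<tau> powr (- 8 * a)"
        using C2 \<kappa> by (intro mult_right_mono) auto
      then show ?thesis using big[OF \<sigma> t] True by (simp add: h_def)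
    next
      case False
      have b: "norm (zeta_fn (Complex (1 + h) t)) \<ge> 2 * C2 * \<kappa> * ?\<tau> powr (- 8 * a)"
        using h t by (intro big) (auto simp: h_def)
      have seg: "\<exists>x. w = Complex x t \<and> 1 < x \<and> x \<le> 2" if w: "w \<in> closed_segment (Complex \<sigma> t) (Complex (1 + h) t)" for w
      proof -
        obtain u where u: "0 \<le> u" "u \<le> 1" "w = (1 - u) *\<^sub>R Complex \<sigma> t + u *\<^sub>R Complex (1 + h) t"
          using w by (auto simp: in_segment)
        have "1 < (1 - u) * \<sigma> + u * (1 + h)"
        proof -
          have "(1 - u) * 1 + u * 1 < (1 - u) * \<sigma> + u * (1 + h)"
          proof (cases "u = 0")
            case False
            then show ?thesis using u \<sigma> h
              by (intro add_le_less_mono[OF mult_left_mono mult_strict_left_mono]) auto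
          qed (use \<sigma> in auto)
          then show ?thesis by simp
        qed
        moreover have "(1 - u) * \<sigma> + u * (1 + h) \<le> (1 - u) * 2 + u * 2"
          using u \<sigma> h by (intro add_mono mult_left_mono) auto
        ultimately show ?thesis using u by (intro exI[of _ "(1 - u) * \<sigma> + u * (1 + h)"]) (auto simp: complex_eq_iff algebra_simps)
      qed
      have "norm (zeta_fn (Complex \<sigma> t) - zeta_fn (Complex (1 + h) t)) \<le> (C2 * ?\<tau> powr (2 * a)) * norm (Complex \<sigma> t - Complex (1 + h) t)"
      proof (rule field_differentiable_bound[where S = "closed_segment (Complex \<sigma> t) (Complex (1 + h) t)" and f' = "deriv zeta_fn"])
        fix w assume "w \<in> closed_segment (Complex \<sigma> t) (Complex (1 + h) t)"
        then obtain x where x: "w = Complex x t" "1 < x" "x \<le> 2" using seg by blast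
        have "w \<in> {s. Re s > 3/4} - {1}" using x by (auto simp: complex_eq_iff)
        then have "(zeta_fn has_field_derivative deriv zeta_fn w) (at w)"
          by (intro holomorphic_derivI[OF holomorphic_zeta_fn open_zeta_fn_domain])
        then show "(zeta_fn has_field_derivative deriv zeta_fn w) (at w within closed_segment (Complex \<sigma> t) (Complex (1 + h) t))"
          by (rule has_field_derivative_at_within)
        show "norm (deriv zeta_fn w) \<le> C2 * ?\<tau> powr (2 * a)"
          using C2(2)[of w w] x t a d by simp
      qed auto
      also have "norm (Complex \<sigma> t - Complex (1 + h) t) = \<bar>\<sigma> - 1 - h\<bar>"
      proof -
        have "Complex \<sigma> t - Complex (1 + h) t = of_real (\<sigma> - 1 - h)" by (simp add: complex_eq_iff)
        then show ?thesis by (simp only: norm_of_real)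
      qed
      also have "C2 * ?\<tau> powr (2 * a) * \<bar>\<sigma> - 1 - h\<bar> \<le> C2 * ?\<tau> powr (2 * a) * h"
        using C2 False \<sigma> by (intro mult_left_mono) auto
      also have "\<dots> = C2 * \<kappa> * (?\<tau> powr (2 * a) * ?\<tau> powr (- 10 * a))" by (simp add: h_def)
      also have "?\<tau> powr (2 * a) * ?\<tau> powr (- 10 * a) = ?\<tau> powr (- 8 * a)" by (simp flip: powr_add)
      finally have "norm (zeta_fn (Complex \<sigma> t) - zeta_fn (Complex (1 + h) t)) \<le> C2 * \<kappa> * ?\<tau> powr (- 8 * a)" .
      then show ?thesis
        using b norm_triangle_ineq2[of "zeta_fn (Complex (1 + h) t)" "zeta_fn (Complex \<sigma> t)"] by (simp add: norm_minus_commute)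
    qed
  qed (use C2 \<kappa> in auto)
qed

section \<open>The third derivative of the transform away from the pole\<close>

lemma norm_exp_of_real_mult: "norm (exp (of_real r * z :: complex)) = norm (exp z) powr r"
  by (simp add: powr_def)

text \<open>On a disc of radius \<rho> about \<tau>^(-10a) around s0 the value of zeta stays within
  half of |zeta(s0)|, because zeta' = O(\<tau>^(2a)) and |zeta(s0)| is at least a constant times
  \<tau>^(-8a). So zeta^r continues to that disc and Cauchy's estimate applies. Analyticity is
  recorded because derivatives of a difference are split later.\<close>

lemma dirichlet_part_far:
  assumes R: "R > 0" and d: "0 < d" "d \<le> 1/4"
  shows "\<exists>C>0. \<forall>r s0. 0 \<le> r \<longrightarrow> r \<le> R \<longrightarrow> 1 < Re s0 \<longrightarrow> Re s0 \<le> 2 \<longrightarrow> \<bar>Im s0\<bar> \<ge> d \<longrightarrow>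
    (\<lambda>s. omega_dseries r s / s) analytic_on {s0} \<and>
    norm ((deriv ^^ 3) (\<lambda>s. omega_dseries r s / s) s0) \<le> C * (\<bar>Im s0\<bar> + 2) powr (-(1/2))"
proof -
  \<comment> \<open>Chosen so that 2aR + 30a = 1/2: the power zeta^r may lose \<tau>^(2aR), the cube
    of the radius loses \<tau>^(30a), and the factor 1/s supplies \<tau>^(-1).\<close>
  define a where "a = 1 / (4 * R + 60)"
  have a: "0 < a" "a \<le> 1/8" using R by (auto simp: a_def field_simps)
  have "a * (4 * R + 60) = 1" using R by (simp add: a_def)
  then have aR: "2 * a * R + 30 * a = 1/2" by (simp add: algebra_simps)
  obtain C1 where C1: "C1 > 0" "\<And>s0 s. 1 \<le> Re s0 \<Longrightarrow> Re s0 \<le> 2 \<Longrightarrow> \<bar>Im s0\<bar> \<ge> d \<Longrightarrow> norm (s - s0) \<le> min a (d/2) \<Longrightarrow>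
     norm (zeta_fn s) \<le> C1 * (\<bar>Im s0\<bar> + 2) powr (2 * a)"
    using norm_zeta_fn_le[OF a d] by meson
  obtain C2 where C2: "C2 > 0" "\<And>s0 s. 1 \<le> Re s0 \<Longrightarrow> Re s0 \<le> 2 \<Longrightarrow> \<bar>Im s0\<bar> \<ge> d \<Longrightarrow> norm (s - s0) \<le> min a (d/2) / 2 \<Longrightarrow>
     norm (deriv zeta_fn s) \<le> C2 * (\<bar>Im s0\<bar> + 2) powr (2 * a)"
    using norm_deriv_zeta_fn_le[OF a d] by meson
  obtain c where c: "c > 0" "\<And>\<sigma> t. 1 < \<sigma> \<Longrightarrow> \<sigma> \<le> 2 \<Longrightarrow> \<bar>t\<bar> \<ge> d \<Longrightarrow> norm (zeta_fn (Complex \<sigma> t)) \<ge> c * (\<bar>t\<bar> + 2) powr (- 8 * a)"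
    using norm_zeta_fn_ge[OF a d] by meson
  obtain CG where CG: "CG > 0" "\<And>r s. 0 \<le> r \<Longrightarrow> r \<le> R \<Longrightarrow> Re s \<ge> 3/4 \<Longrightarrow> norm (conv_prod r s) \<le> CG"
    using norm_conv_prod_le[OF R] by meson
  define q where "q = min a (d/2) / 2"
  have q: "q > 0" "q \<le> 1/16" using a d by (auto simp: q_def)
  \<comment> \<open>The bound q keeps the disc where zeta' is controlled; c / (2 C2) limits the
    change of zeta to half of the lower bound for |zeta(s0)|.\<close>
  define \<kappa> where "\<kappa> = min q (c / (2 * C2))"
  have \<kappa>: "\<kappa> > 0" "\<kappa> \<le> q" "C2 * \<kappa> \<le> c / 2"
  proof -
    show "\<kappa> > 0" "\<kappa> \<le> q" using q c C2 by (auto simp: \<kappa>_def)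
    have "C2 * \<kappa> \<le> C2 * (c / (2 * C2))" using C2 by (intro mult_left_mono) (auto simp: \<kappa>_def)
    then show "C2 * \<kappa> \<le> c / 2" using C2 by simp
  qed
  define M where "M = max 1 C1"
  have M: "M \<ge> 1" "C1 \<le> M" by (auto simp: M_def)
  define B where "B = M powr R * (3/2) powr R * CG * 4"
  have B: "B > 0" using M CG by (simp add: B_def)
  have main: "(\<lambda>s. omega_dseries r s / s) analytic_on {s0} \<and>
      norm ((deriv ^^ 3) (\<lambda>s. omega_dseries r s / s) s0) \<le> (6 * B / \<kappa> ^ 3) * (\<bar>Im s0\<bar> + 2) powr (-(1/2))"
    if r: "0 \<le> r" "r \<le> R" and s0: "1 < Re s0" "Re s0 \<le> 2" "\<bar>Im s0\<bar> \<ge> d" for r s0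
  proof -
    define \<tau> where "\<tau> = \<bar>Im s0\<bar> + 2"
    have \<tau>: "\<tau> \<ge> 2" by (simp add: \<tau>_def)
    define \<rho> where "\<rho> = \<kappa> * \<tau> powr (- 10 * a)"
    have "\<tau> powr (- 10 * a) \<le> \<tau> powr 0" using a \<tau> by (intro powr_mono) auto
    then have "\<rho> \<le> \<kappa> * 1" unfolding \<rho>_def using \<kappa> \<tau> by (intro mult_left_mono) auto
    then have "\<rho> \<le> q" using \<kappa> by linarith
    moreover have "\<rho> > 0" using \<kappa> \<tau> by (auto simp: \<rho>_def)
    ultimately have \<rho>: "\<rho> > 0" "\<rho> \<le> q" by auto
    have z0: "norm (zeta_fn s0) \<ge> c * \<tau> powr (- 8 * a)"
      using c(2)[OF s0] by (simp add: \<tau>_def)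
    have "c * \<tau> powr (- 8 * a) > 0" using c \<tau> by simp
    with z0 have z0': "zeta_fn s0 \<noteq> 0" "norm (zeta_fn s0) > 0" by auto
    have near: "norm (s - s0) \<le> min a (d/2) / 2" "norm (s - s0) \<le> min a (d/2)" "s \<in> {s. Re s > 3/4} - {1}" if "s \<in> cball s0 \<rho>" for s
    proof -
      show 1: "norm (s - s0) \<le> min a (d/2) / 2" using that \<rho> by (simp add: dist_norm norm_minus_commute q_def)
      moreover have "min a (d/2) = 2 * q" by (simp add: q_def)
      ultimately show 2: "norm (s - s0) \<le> min a (d/2)" using q by linarith
      show "s \<in> {s. Re s > 3/4} - {1}" by (rule zeta_fn_region[OF _ s0(3) 2 a d(1)]) (use s0 in simp)
    qed
    have ratio: "norm (zeta_fn s / zeta_fn s0 - 1) \<le> 1/2" if s: "s \<in> cball s0 \<rho>" for s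
    proof -
      have "norm (zeta_fn s - zeta_fn s0) \<le> (C2 * \<tau> powr (2 * a)) * norm (s - s0)"
      proof (rule field_differentiable_bound[where S = "cball s0 \<rho>" and f' = "deriv zeta_fn"])
        fix w assume w: "w \<in> cball s0 \<rho>"
        have "(zeta_fn has_field_derivative deriv zeta_fn w) (at w)"
          using near(3)[OF w] by (intro holomorphic_derivI[OF holomorphic_zeta_fn open_zeta_fn_domain])
        then show "(zeta_fn has_field_derivative deriv zeta_fn w) (at w within cball s0 \<rho>)"
          by (rule has_field_derivative_at_within)
        show "norm (deriv zeta_fn w) \<le> C2 * \<tau> powr (2 * a)"
          unfolding \<tau>_def using near(1)[OF w] s0 by (intro C2(2)) auto
      qed (use s \<rho> in auto)
      also have "\<dots> \<le> (C2 * \<tau> powr (2 * a)) * \<rho>"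
        using s C2 by (intro mult_left_mono) (auto simp: dist_norm norm_minus_commute)
      also have "\<dots> = C2 * \<kappa> * (\<tau> powr (2 * a) * \<tau> powr (- 10 * a))" by (simp add: \<rho>_def)
      also have "\<tau> powr (2 * a) * \<tau> powr (- 10 * a) = \<tau> powr (- 8 * a)" by (simp flip: powr_add)
      also have "C2 * \<kappa> * \<tau> powr (- 8 * a) \<le> c / 2 * \<tau> powr (- 8 * a)" using \<kappa> by (intro mult_right_mono) auto
      also have "\<dots> \<le> norm (zeta_fn s0) / 2" using z0 by simp
      finally have "norm (zeta_fn s - zeta_fn s0) \<le> norm (zeta_fn s0) / 2" .
      moreover have "zeta_fn s / zeta_fn s0 - 1 = (zeta_fn s - zeta_fn s0) / zeta_fn s0" using z0' by (simp add: field_simps)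
      ultimately show ?thesis using z0' by (simp add: norm_divide field_simps)
    qed
    have rat: "zeta_fn s / zeta_fn s0 \<notin> \<real>\<^sub>\<le>\<^sub>0" "zeta_fn s / zeta_fn s0 \<noteq> 0" "norm (zeta_fn s / zeta_fn s0) \<le> 3/2" if s: "s \<in> cball s0 \<rho>" for s
    proof -
      have "- Re (zeta_fn s / zeta_fn s0 - 1) \<le> 1/2"
        using ratio[OF s] abs_Re_le_cmod[of "zeta_fn s / zeta_fn s0 - 1"] abs_ge_minus_self[of "Re (zeta_fn s / zeta_fn s0 - 1)"] by linarith
      then have "Re (zeta_fn s / zeta_fn s0) > 0" by simp
      then show "zeta_fn s / zeta_fn s0 \<notin> \<real>\<^sub>\<le>\<^sub>0" "zeta_fn s / zeta_fn s0 \<noteq> 0" by (auto simp: complex_nonpos_Reals_iff)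
      show "norm (zeta_fn s / zeta_fn s0) \<le> 3/2" using ratio[OF s] norm_triangle_ineq2[of "zeta_fn s / zeta_fn s0" 1] by simp
    qed
    \<comment> \<open>The branch is frozen at s0 and continued by the principal logarithm of a ratio
      within 1/2 of 1. This is holomorphic on the whole disc, also on its part to the left of Re s =
      1.\<close>
    define f where "f s = exp (of_real r * log_zeta s0) * exp (of_real r * Ln (zeta_fn s / zeta_fn s0)) * conv_prod r s / s" for s
    have holf: "f holomorphic_on cball s0 \<rho>"
      unfolding f_def
    proof (intro holomorphic_intros)
      show "zeta_fn holomorphic_on cball s0 \<rho>" by (rule holomorphic_on_subset[OF holomorphic_zeta_fn]) (use near(3) in blast)
      show "conv_prod r holomorphic_on cball s0 \<rho>" by (rule holomorphic_on_subset[OF holomorphic_conv_prod[OF r(1)]]) (use near(3) in blast)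
      show "s \<noteq> 0" if "s \<in> cball s0 \<rho>" for s using near(3)[OF that] by auto
      show "zeta_fn s / zeta_fn s0 \<notin> \<real>\<^sub>\<le>\<^sub>0" if "s \<in> cball s0 \<rho>" for s by (rule rat(1)[OF that])
    qed (use z0' in auto)
    have fle: "norm (f s) \<le> B * \<tau> powr (2 * a * R - 1)" if s: "s \<in> cball s0 \<rho>" for s
    proof -
      have "norm (exp (of_real r * log_zeta s0)) = norm (zeta_fn s0) powr r"
        using s0 by (simp add: zeta_fn_eq norm_exp_of_real_mult del: norm_exp_eq_Re)
      also have "\<dots> \<le> (M * \<tau> powr (2 * a)) powr r"
      proof (rule powr_mono2)
        have "norm (zeta_fn s0) \<le> C1 * (\<bar>Im s0\<bar> + 2) powr (2 * a)" by (rule C1(2)) (use s0 a d in auto)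
        also have "\<dots> \<le> M * \<tau> powr (2 * a)" unfolding \<tau>_def using M by (intro mult_right_mono) auto
        finally show "norm (zeta_fn s0) \<le> M * \<tau> powr (2 * a)" .
      qed (use r in auto)
      also have "\<dots> \<le> (M * \<tau> powr (2 * a)) powr R"
      proof (rule powr_mono)
        have "\<tau> powr (2 * a) \<ge> 1" using \<tau> a by (intro ge_one_powr_ge_zero) auto
        then have "1 * 1 \<le> M * \<tau> powr (2 * a)" using M by (intro mult_mono) auto
        then show "1 \<le> M * \<tau> powr (2 * a)" by simp
      qed (use r in auto)
      also have "\<dots> = M powr R * \<tau> powr (2 * a * R)" by (simp add: powr_mult powr_powr)
      finally have e1: "norm (exp (of_real r * log_zeta s0)) \<le> M powr R * \<tau> powr (2 * a * R)" .
      have "norm (exp (of_real r * Ln (zeta_fn s / zeta_fn s0))) = norm (zeta_fn s / zeta_fn s0) powr r"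
        using rat[OF s] by (rule_tac norm_exp_Ln)
      also have "\<dots> \<le> (3/2) powr r" using rat[OF s] r by (intro powr_mono2) auto
      also have "\<dots> \<le> (3/2) powr R" using r by (intro powr_mono) auto
      finally have e2: "norm (exp (of_real r * Ln (zeta_fn s / zeta_fn s0))) \<le> (3/2) powr R" .
      have e3: "norm (conv_prod r s) \<le> CG" using near(3)[OF s] r by (intro CG) auto
      have e4: "1 / norm s \<le> 4 * \<tau> powr (-1)"
      proof -
        have "norm (s - s0) \<le> 1/16" using s \<rho> q by (simp add: dist_norm norm_minus_commute)
        then have "\<bar>Im s0\<bar> \<le> \<bar>Im s\<bar> + 1/16" using abs_Im_le_cmod[of "s - s0"] by simp
        then have "\<bar>Im s0\<bar> \<le> norm s + 1/16" using abs_Im_le_cmod[of s] by linarith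
        moreover have "norm s > 3/4" using near(3)[OF s] complex_Re_le_cmod[of s] by auto
        ultimately have "\<tau> \<le> 4 * norm s" unfolding \<tau>_def by linarith
        then have "1 / norm s \<le> 1 / (\<tau> / 4)" using \<tau> by (intro frac_le) auto
        then show ?thesis using \<tau> by (simp add: powr_minus_divide)
      qed
      have "norm (f s) = norm (exp (of_real r * log_zeta s0)) * norm (exp (of_real r * Ln (zeta_fn s / zeta_fn s0))) * norm (conv_prod r s) * (1 / norm s)"
        by (simp add: f_def norm_mult norm_divide del: norm_exp_eq_Re)
      also have "\<dots> \<le> (M powr R * \<tau> powr (2 * a * R)) * (3/2) powr R * CG * (4 * \<tau> powr (-1))"
        using M CG by (intro mult_mono e1 e2 e3 e4 mult_nonneg_nonneg) auto
      also have "\<dots> = B * (\<tau> powr (2 * a * R) * \<tau> powr (-1))" by (simp add: B_def)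
      also have "\<tau> powr (2 * a * R) * \<tau> powr (-1) = \<tau> powr (2 * a * R - 1)" by (subst powr_add[symmetric]) simp
      finally show ?thesis .
    qed
    \<comment> \<open>By continuity of \<open>log_zeta\<close> its increment D has |Im D| < 1 < pi
      close to s0, so the principal logarithm of the ratio is D itself.\<close>
    have ev: "\<forall>\<^sub>F s in nhds s0. f s = omega_dseries r s / s"
    proof -
      have "isCont log_zeta s0"
        using continuous_on_log_zeta s0 open_halfspace_Re_gt[of 1]
        by (intro continuous_on_interior[of "{s. Re s > 1}"]) (auto simp: interior_open)
      then obtain e where e: "e > 0" "\<And>s. norm (s - s0) < e \<Longrightarrow> norm (log_zeta s - log_zeta s0) < 1"
        unfolding continuous_at_eps_delta by (metis dist_norm zero_less_one)
      show ?thesis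
      proof (rule eventually_mono[OF eventually_nhds_in_open[of "{s. Re s > 1} \<inter> ball s0 e"]])
        fix s assume "s \<in> {s. Re s > 1} \<inter> ball s0 e"
        then have s: "Re s > 1" "norm (s - s0) < e" by (auto simp: dist_norm norm_minus_commute)
        define D where "D = log_zeta s - log_zeta s0"
        have "zeta_fn s / zeta_fn s0 = exp D" using s s0 by (simp add: zeta_fn_eq D_def exp_diff)
        moreover have "\<bar>Im D\<bar> < 1" using e(2)[OF s(2)] abs_Im_le_cmod[of D] by (simp add: D_def)
        then have "Ln (exp D) = D" using pi_gt3 by (intro Ln_exp) linarith+
        ultimately have "exp (of_real r * log_zeta s0) * exp (of_real r * Ln (zeta_fn s / zeta_fn s0)) = exp (of_real r * log_zeta s)"
          by (simp add: D_def flip: exp_add distrib_left)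
        then show "f s = omega_dseries r s / s"
          unfolding f_def omega_dseries_eq[OF s(1) r(1)] by simp
      qed (use s0 e in \<open>auto simp: open_halfspace_Re_gt\<close>)
    qed
    have "norm ((deriv ^^ 3) f s0) \<le> fact 3 * (B * \<tau> powr (2 * a * R - 1)) / \<rho> ^ 3"
    proof (rule Cauchy_inequality)
      show "f holomorphic_on ball s0 \<rho>" by (rule holomorphic_on_subset[OF holf]) auto
      show "continuous_on (cball s0 \<rho>) f" by (rule holomorphic_on_imp_continuous_on[OF holf])
      show "norm (f s) \<le> B * \<tau> powr (2 * a * R - 1)" if "norm (s0 - s) = \<rho>" for s
        using that by (intro fle) (simp add: dist_norm)
    qed (use \<rho> in auto)
    also have "\<dots> = (6 * B / \<kappa> ^ 3) * (\<tau> powr (2 * a * R - 1) / (\<tau> powr (- 10 * a)) ^ 3)"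
      by (simp add: \<rho>_def power_mult_distrib fact_numeral)
    also have "(\<tau> powr (- 10 * a)) ^ 3 = \<tau> powr (- 30 * a)"
      by (simp add: power3_eq_cube flip: powr_add)
    also have "\<tau> powr (2 * a * R - 1) / \<tau> powr (- 30 * a) = \<tau> powr (-(1/2))"
    proof -
      have "2 * a * R - 1 - (- 30 * a) = -(1/2)" using aR by linarith
      then show ?thesis by (simp only: powr_diff[symmetric])
    qed
    finally have "norm ((deriv ^^ 3) f s0) \<le> (6 * B / \<kappa> ^ 3) * \<tau> powr (-(1/2))" .
    moreover have "(deriv ^^ 3) f s0 = (deriv ^^ 3) (\<lambda>s. omega_dseries r s / s) s0"
      by (rule higher_deriv_cong_ev[OF ev refl])
    moreover have "f analytic_on {s0}"
      unfolding analytic_on_def using holomorphic_on_subset[OF holf ball_subset_cball] \<rho> by auto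
    then have "(\<lambda>s. omega_dseries r s / s) analytic_on {s0}"
      using analytic_at_cong[OF ev refl] by simp
    ultimately show ?thesis by (simp add: \<tau>_def)
  qed
  moreover have "6 * B / \<kappa> ^ 3 > 0" using B \<kappa> by simp
  ultimately show ?thesis by blast
qed

text \<open>The disc of radius |Im s0|/2 stays away from the cut and the power is bounded on it, so
  Cauchy's estimate yields |Im s0|^(-3). This is weakened to the exponent -1/2 to match the
  Dirichlet series.\<close>

lemma pole_part_far:
  assumes R: "R > 0" and d: "0 < d" "d \<le> 1/4"
  shows "\<exists>C>0. \<forall>r s0. 0 \<le> r \<longrightarrow> r \<le> R \<longrightarrow> 1 < Re s0 \<longrightarrow> \<bar>Im s0\<bar> \<ge> d \<longrightarrow>
    (\<lambda>s. of_real (g_one r) * exp (- of_real r * Ln (s - 1))) analytic_on {s0} \<and>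
    norm ((deriv ^^ 3) (\<lambda>s. of_real (g_one r) * exp (- of_real r * Ln (s - 1))) s0) \<le> C * (\<bar>Im s0\<bar> + 2) powr (-(1/2))"
proof -
  obtain CG where CG: "CG > 0" "\<And>r s. 0 \<le> r \<Longrightarrow> r \<le> R \<Longrightarrow> Re s \<ge> 3/4 \<Longrightarrow> norm (conv_prod r s) \<le> CG"
    using norm_conv_prod_le[OF R] by meson
  define B where "B = CG * (d / 2) powr (- R)"
  \<comment> \<open>The constant with \<mu> (|t|+2) \<le> |t| for all |t| \<ge> d.\<close>
  define \<mu> where "\<mu> = d / (d + 2)"
  have \<mu>: "\<mu> > 0" using d by (simp add: \<mu>_def)
  have B: "B > 0" using CG d by (simp add: B_def)
  have "(\<lambda>s. of_real (g_one r) * exp (- of_real r * Ln (s - 1))) analytic_on {s0} \<and>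
    norm ((deriv ^^ 3) (\<lambda>s. of_real (g_one r) * exp (- of_real r * Ln (s - 1))) s0) \<le> (48 * B / \<mu> ^ 3) * (\<bar>Im s0\<bar> + 2) powr (-(1/2))"
    if r: "0 \<le> r" "r \<le> R" and s0: "1 < Re s0" "\<bar>Im s0\<bar> \<ge> d" for r s0
  proof -
    define b where "b = \<bar>Im s0\<bar> / 2"
    have b: "b \<ge> d / 2" "b > 0" using s0 d by (auto simp: b_def)
    define g where "g s = of_real (g_one r) * exp (- of_real r * Ln (s - 1))" for s
    have disc: "s - 1 \<notin> \<real>\<^sub>\<le>\<^sub>0" "s \<noteq> 1" "norm (s - 1) \<ge> b" if "s \<in> cball s0 b" for s
    proof -
      have "\<bar>Im s - Im s0\<bar> \<le> b" using that abs_Im_le_cmod[of "s - s0"] by (simp add: dist_norm norm_minus_commute)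
      then have im: "\<bar>Im s\<bar> \<ge> b" unfolding b_def by linarith
      then show "s - 1 \<notin> \<real>\<^sub>\<le>\<^sub>0" "s \<noteq> 1" using b by (auto simp: complex_nonpos_Reals_iff)
      show "norm (s - 1) \<ge> b" using im abs_Im_le_cmod[of "s - 1"] by simp
    qed
    have holg: "g holomorphic_on cball s0 b"
      unfolding g_def using disc by (intro holomorphic_intros) auto
    have gone: "\<bar>g_one r\<bar> \<le> CG" using CG(2)[OF r, of 1] conv_prod_1[OF r(1)] by simp
    have "norm ((deriv ^^ 3) g s0) \<le> fact 3 * B / b ^ 3"
    proof (rule Cauchy_inequality)
      show "g holomorphic_on ball s0 b" by (rule holomorphic_on_subset[OF holg]) auto
      show "continuous_on (cball s0 b) g" by (rule holomorphic_on_imp_continuous_on[OF holg])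
      fix s assume "norm (s0 - s) = b"
      then have s: "s \<in> cball s0 b" by (simp add: dist_norm)
      have "norm (exp (- of_real r * Ln (s - 1))) = norm (s - 1) powr (- r)"
        using norm_exp_Ln[of "s - 1" "-r"] disc[OF s] by simp
      also have "\<dots> \<le> (d / 2) powr (- r)" using disc[OF s] b d r by (intro powr_mono2') auto
      also have "\<dots> \<le> (d / 2) powr (- R)" using d r by (intro powr_mono') auto
      finally show "norm (g s) \<le> B" unfolding g_def norm_mult B_def using gone CG by (intro mult_mono) auto
    qed (use b in auto)
    also have "\<dots> = 48 * B * (1 / \<bar>Im s0\<bar> ^ 3)" by (simp add: b_def power_divide fact_numeral)
    also have "1 / \<bar>Im s0\<bar> ^ 3 \<le> (1 / \<mu> ^ 3) * (\<bar>Im s0\<bar> + 2) powr (-(1/2))"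
    proof -
      have "\<mu> * (\<bar>Im s0\<bar> + 2) \<le> \<bar>Im s0\<bar>" using s0 d by (simp add: \<mu>_def field_simps)
      then have "(\<mu> * (\<bar>Im s0\<bar> + 2)) ^ 3 \<le> \<bar>Im s0\<bar> ^ 3" using \<mu> by (intro power_mono) auto
      then have "1 / \<bar>Im s0\<bar> ^ 3 \<le> 1 / (\<mu> * (\<bar>Im s0\<bar> + 2)) ^ 3" using \<mu> by (intro frac_le) auto
      also have "\<dots> = (1 / \<mu> ^ 3) * (\<bar>Im s0\<bar> + 2) powr (-3)"
        by (simp add: power_mult_distrib powr_minus_divide powr_numeral)
      also have "\<dots> \<le> (1 / \<mu> ^ 3) * (\<bar>Im s0\<bar> + 2) powr (-(1/2))"
        using \<mu> by (intro mult_left_mono powr_mono) auto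
      finally show ?thesis .
    qed
    then have "48 * B * (1 / \<bar>Im s0\<bar> ^ 3) \<le> 48 * B * ((1 / \<mu> ^ 3) * (\<bar>Im s0\<bar> + 2) powr (-(1/2)))"
      using B by (intro mult_left_mono) auto
    finally have "norm ((deriv ^^ 3) g s0) \<le> (48 * B / \<mu> ^ 3) * (\<bar>Im s0\<bar> + 2) powr (-(1/2))" by simp
    moreover have "g analytic_on {s0}"
      unfolding analytic_on_def using holomorphic_on_subset[OF holg ball_subset_cball] b by auto
    ultimately show ?thesis by (simp add: g_def[abs_def])
  qed
  moreover have "48 * B / \<mu> ^ 3 > 0" using B \<mu> by simp
  ultimately show ?thesis by blast
qed

lemma error_transform_far:
  assumes R: "R > 0" and d: "0 < d" "d \<le> 1/4"
  shows "\<exists>C>0. \<forall>r s0. 0 \<le> r \<longrightarrow> r \<le> R \<longrightarrow> 1 < Re s0 \<longrightarrow> Re s0 \<le> 2 \<longrightarrow> \<bar>Im s0\<bar> \<ge> d \<longrightarrow>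
    norm ((deriv ^^ 3) (error_transform r) s0) \<le> C * (\<bar>Im s0\<bar> + 2) powr (-(1/2))"
proof -
  obtain C1 where C1: "C1 > 0" "\<And>r s0. 0 \<le> r \<Longrightarrow> r \<le> R \<Longrightarrow> 1 < Re s0 \<Longrightarrow> Re s0 \<le> 2 \<Longrightarrow> \<bar>Im s0\<bar> \<ge> d \<Longrightarrow>
    (\<lambda>s. omega_dseries r s / s) analytic_on {s0} \<and>
    norm ((deriv ^^ 3) (\<lambda>s. omega_dseries r s / s) s0) \<le> C1 * (\<bar>Im s0\<bar> + 2) powr (-(1/2))"
    using dirichlet_part_far[OF R d] by meson
  obtain C2 where C2: "C2 > 0" "\<And>r s0. 0 \<le> r \<Longrightarrow> r \<le> R \<Longrightarrow> 1 < Re s0 \<Longrightarrow> \<bar>Im s0\<bar> \<ge> d \<Longrightarrow>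
    (\<lambda>s. of_real (g_one r) * exp (- of_real r * Ln (s - 1))) analytic_on {s0} \<and>
    norm ((deriv ^^ 3) (\<lambda>s. of_real (g_one r) * exp (- of_real r * Ln (s - 1))) s0) \<le> C2 * (\<bar>Im s0\<bar> + 2) powr (-(1/2))"
    using pole_part_far[OF R d] by meson
  have "norm ((deriv ^^ 3) (error_transform r) s0) \<le> (C1 + C2) * (\<bar>Im s0\<bar> + 2) powr (-(1/2))"
    if "0 \<le> r" "r \<le> R" "1 < Re s0" "Re s0 \<le> 2" "\<bar>Im s0\<bar> \<ge> d" for r s0
  proof -
    note 1 = C1(2)[OF that] and 2 = C2(2)[OF that(1-3,5)]
    have "(deriv ^^ 3) (error_transform r) s0 = (deriv ^^ 3) (\<lambda>s. omega_dseries r s / s) s0 - (deriv ^^ 3) (\<lambda>s. of_real (g_one r) * exp (- of_real r * Ln (s - 1))) s0"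
      unfolding error_transform_def[abs_def] using 1 2 by (intro higher_deriv_diff_at) auto
    also have "norm \<dots> \<le> C1 * (\<bar>Im s0\<bar> + 2) powr (-(1/2)) + C2 * (\<bar>Im s0\<bar> + 2) powr (-(1/2))"
      using 1 2 by (intro order_trans[OF norm_triangle_ineq4] add_mono) auto
    finally show ?thesis by (simp add: algebra_simps)
  qed
  moreover have "C1 + C2 > 0" using C1 C2 by simp
  ultimately show ?thesis by blast
qed

section \<open>Asymptotics of the full sum\<close>

definition omega_sum :: "real \<Rightarrow> real \<Rightarrow> real" where
  "omega_sum r x = (\<Sum>n\<in>{n. 1 \<le> n \<and> real n \<le> x}. r ^ omega n)"

lemma finite_nat_le [simp, intro]: "finite {n::nat. 1 \<le> n \<and> real n \<le> x}"
  by (rule finite_subset[of _ "{..nat \<lfloor>x\<rfloor>}"]) (auto simp: le_nat_floor)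

lemma omega_sum_nonneg: "0 \<le> r \<Longrightarrow> 0 \<le> omega_sum r x"
  unfolding omega_sum_def by (intro sum_nonneg) auto

lemma omega_sum_mono:
  assumes "0 \<le> r" "x \<le> y"
  shows "omega_sum r x \<le> omega_sum r y"
  unfolding omega_sum_def using assms by (intro sum_mono2[OF finite_nat_le]) auto

lemma omega_sum_lt_1: "x < 1 \<Longrightarrow> omega_sum r x = 0"
  unfolding omega_sum_def by (intro sum.neutral) auto

text \<open>As a function of v the sum consists of steps of height r^omega(n) at v = ln n, and such
  a step has transform n^(-s)/s times its height. Summation and integration commute by absolute
  convergence of the Dirichlet series; for fixed v only finitely many steps are present.\<close>

lemma omega_sum_transform:
  assumes r: "0 \<le> r" and s: "Re s > 1"
  shows "integrable lborel (\<lambda>v. of_real (omega_sum r (exp v)) * exp (- s * of_real v))"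
    "(LINT v|lborel. of_real (omega_sum r (exp v)) * exp (- s * of_real v)) = omega_dseries r s / s"
proof -
  define f where "f n v = complex_of_real (r ^ omega (Suc n)) * (indicator {ln (real (Suc n))..} v *\<^sub>R exp (- s * of_real v))" for n v
  have s0: "s \<noteq> 0" using s by auto
  have nn: "has_bochner_integral lborel (\<lambda>v. indicator {b..} v * exp (- Re s * v)) (exp (- Re s * b) / Re s)" for b
  proof (rule has_bochner_integral_nn_integral)
    have "(\<integral>\<^sup>+v. ennreal (exp (- Re s * v)) * indicator {b..} v \<partial>lborel) = ennreal (0 - (- exp (- Re s * b) / Re s))"
    proof (rule nn_integral_FTC_atLeast)
      show "((\<lambda>v. - exp (- Re s * v) / Re s) \<longlongrightarrow> 0) at_top" using s by real_asymp
    qed (use s in \<open>auto intro!: derivative_eq_intros\<close>)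
    then show "(\<integral>\<^sup>+v. ennreal (indicator {b..} v * exp (- Re s * v)) \<partial>lborel) = ennreal (exp (- Re s * b) / Re s)"
      by (simp add: ennreal_mult'' ennreal_indicator mult.commute)
  qed (use s in auto)
  have intf: "integrable lborel (\<lambda>v. indicator {b..} v *\<^sub>R exp (- s * of_real v))" for b
  proof (rule Bochner_Integration.integrable_bound)
    show "integrable lborel (\<lambda>v. indicator {b..} v * exp (- Re s * v))" using nn by (auto simp: has_bochner_integral_iff)
    have [measurable]: "(\<lambda>v::real. exp (- s * of_real v)) \<in> borel_measurable borel"
      by (intro borel_measurable_continuous_onI continuous_intros)
    show "(\<lambda>v. indicator {b..} v *\<^sub>R exp (- s * of_real v)) \<in> borel_measurable lborel" by measurable
  qed (auto simp: indicator_def)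
  have int: "(LINT v|lborel. indicator {b..} v *\<^sub>R exp (- s * of_real v)) = exp (- s * of_real b) / s" for b
  proof -
    have "(\<lambda>k. LINT v|lborel. indicator {b..b + real k} v *\<^sub>R exp (- s * of_real v)) \<longlonglongrightarrow> (LINT v|lborel. indicator {b..} v *\<^sub>R exp (- s * of_real v))"
    proof (rule integral_dominated_convergence[where w = "\<lambda>v. indicator {b..} v * exp (- Re s * v)"])
      show "integrable lborel (\<lambda>v. indicator {b..} v * exp (- Re s * v))" using nn by (auto simp: has_bochner_integral_iff)
      have [measurable]: "(\<lambda>v::real. exp (- s * of_real v)) \<in> borel_measurable borel"
        by (intro borel_measurable_continuous_onI continuous_intros)
      show "(\<lambda>v. indicator {b..} v *\<^sub>R exp (- s * of_real v)) \<in> borel_measurable lborel"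
        "(\<lambda>v. indicator {b..b + real k} v *\<^sub>R exp (- s * of_real v)) \<in> borel_measurable lborel" for k by measurable
      show "AE v in lborel. (\<lambda>k. indicator {b..b + real k} v *\<^sub>R exp (- s * of_real v)) \<longlonglongrightarrow> indicator {b..} v *\<^sub>R exp (- s * of_real v)"
      proof (rule AE_I2)
        fix v :: real
        obtain K :: nat where K: "v - b < real K" using reals_Archimedean2 by blast
        have "\<forall>\<^sub>F k in sequentially. indicator {b..} v *\<^sub>R exp (- s * of_real v) = indicator {b..b + real k} v *\<^sub>R exp (- s * of_real v)"
          by (rule eventually_sequentiallyI[of K]) (use K in \<open>auto simp: indicator_def\<close>)
        then show "(\<lambda>k. indicator {b..b + real k} v *\<^sub>R exp (- s * of_real v)) \<longlonglongrightarrow> indicator {b..} v *\<^sub>R exp (- s * of_real v)"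
          by (rule Lim_transform_eventually[OF tendsto_const])
      qed
    qed (auto simp: indicator_def)
    moreover have "(LINT v|lborel. indicator {b..b + real k} v *\<^sub>R exp (- s * of_real v)) = - exp (- s * of_real (b + real k)) / s - (- exp (- s * of_real b) / s)" for k
    proof (rule integral_FTC_Icc)
      fix x
      have "((\<lambda>z. - exp (- s * z) / s) has_field_derivative exp (- s * of_real x)) (at (of_real x))"
        using s0 by (auto intro!: derivative_eq_intros)
      then show "((\<lambda>x. - exp (- s * of_real x) / s) has_vector_derivative exp (- s * of_real x)) (at x within {b..b + real k})"
        by (rule has_vector_derivative_real_field)
    qed (auto intro!: continuous_intros)
    moreover have "(\<lambda>k. - exp (- s * of_real (b + real k)) / s - (- exp (- s * of_real b) / s)) \<longlonglongrightarrow> - 0 / s - (- exp (- s * of_real b) / s)"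
    proof (intro tendsto_intros s0)
      have "(\<lambda>k. exp (- Re s * (b + real k))) \<longlonglongrightarrow> 0" using s by real_asymp
      moreover have "norm (exp (- s * of_real x)) = exp (- Re s * x)" for x by simp
      ultimately have "(\<lambda>k. norm (exp (- s * of_real (b + real k)))) \<longlonglongrightarrow> 0" by (simp only:)
      then show "(\<lambda>k. exp (- s * of_real (b + real k))) \<longlonglongrightarrow> 0" by (rule tendsto_norm_zero_cancel)
    qed
    ultimately show ?thesis using LIMSEQ_unique by simp
  qed
  have e: "exp (- s * of_real (ln (real (Suc n)))) = of_nat (Suc n) powr (-s)" for n
    using Ln_of_real[of "real (Suc n)"] by (simp add: powr_def del: of_nat_Suc)
  have fint: "integrable lborel (f n)" for n
    unfolding f_def by (intro integrable_mult_right intf)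
  have flint: "(LINT v|lborel. f n v) = omega_dterm r s (Suc n) / s" for n
    unfolding f_def integral_mult_right_zero int e omega_dterm_def by simp
  have fnorm: "(LINT v|lborel. norm (f n v)) = norm (omega_dterm r s (Suc n)) / Re s" for n
  proof -
    have "norm (f n v) = r ^ omega (Suc n) * (indicator {ln (real (Suc n))..} v * exp (- Re s * v))" for v
      using r by (simp add: f_def norm_mult norm_power)
    then have "(LINT v|lborel. norm (f n v)) = r ^ omega (Suc n) * (exp (- Re s * ln (real (Suc n))) / Re s)"
      using nn[of "ln (real (Suc n))"] by (simp add: has_bochner_integral_iff)
    also have "exp (- Re s * ln (real (Suc n))) = real (Suc n) powr (- Re s)" by (simp add: powr_def)
    finally show ?thesis using r by (simp add: norm_omega_dterm del: of_nat_Suc)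
  qed
  have fz: "f n v = 0" if "n \<notin> {n. real (Suc n) \<le> exp v}" for n v
  proof -
    have "exp v < real (Suc n)" using that by simp
    then have "v < ln (real (Suc n))" by (metis exp_gt_zero ln_exp ln_less_cancel_iff of_nat_0_less_iff zero_less_Suc)
    then show ?thesis by (simp add: f_def)
  qed
  have ffin: "finite {n. real (Suc n) \<le> exp v}" for v
    by (rule finite_subset[of _ "{..nat \<lfloor>exp v\<rfloor>}"]) (auto simp: le_nat_floor)
  have fsum: "(\<Sum>n. f n v) = of_real (omega_sum r (exp v)) * exp (- s * of_real v)" for v
  proof -
    have "(\<Sum>n. f n v) = (\<Sum>n | real (Suc n) \<le> exp v. f n v)"
      by (rule suminf_finite[OF ffin]) (use fz in auto)
    also have "\<dots> = (\<Sum>n | real (Suc n) \<le> exp v. of_real (r ^ omega (Suc n)) * exp (- s * of_real v))"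
    proof (rule sum.cong[OF refl])
      fix n assume "n \<in> {n. real (Suc n) \<le> exp v}"
      then have "ln (real (Suc n)) \<le> v" by (metis exp_ln mem_Collect_eq of_nat_0_less_iff zero_less_Suc exp_le_cancel_iff)
      then show "f n v = of_real (r ^ omega (Suc n)) * exp (- s * of_real v)" by (simp add: f_def)
    qed
    also have "\<dots> = (\<Sum>n\<in>Suc ` {n. real (Suc n) \<le> exp v}. of_real (r ^ omega n) * exp (- s * of_real v))"
      by (subst sum.reindex) auto
    also have "Suc ` {n. real (Suc n) \<le> exp v} = {n. 1 \<le> n \<and> real n \<le> exp v}"
      by (auto simp: image_iff Suc_le_eq gr0_conv_Suc)
    finally show ?thesis by (simp add: omega_sum_def sum_distrib_right)
  qed
  have S: "summable (\<lambda>n. LINT v|lborel. norm (f n v))"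
    unfolding fnorm using summable_Suc_iff[of "\<lambda>n. norm (omega_dterm r s n)"] omega_dterm_summable_norm[OF s r]
    by (intro summable_divide) simp
  have AE: "AE v in lborel. summable (\<lambda>n. norm (f n v))"
    by (rule AE_I2, rule summable_finite[OF ffin]) (use fz in auto)
  show "integrable lborel (\<lambda>v. of_real (omega_sum r (exp v)) * exp (- s * of_real v))"
    using integrable_suminf[OF fint AE S] by (simp only: fsum)
  show "(LINT v|lborel. of_real (omega_sum r (exp v)) * exp (- s * of_real v)) = omega_dseries r s / s"
    using integral_suminf[OF fint AE S] unfolding fsum flint omega_dseries_def
    using summable_Suc_iff[of "\<lambda>n. norm (omega_dterm r s n)"] omega_dterm_summable_norm[OF s r]
    by (simp add: suminf_divide summable_norm_cancel)
qed

section \<open>Laplace transforms of the main term and of the error\<close>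

definition gamma_main :: "real \<Rightarrow> real \<Rightarrow> real" where
  "gamma_main r v = (if v > 0 then exp v * v powr (r - 1) else 0)"

lemma gamma_main_integral:
  assumes r: "r > 0" and \<sigma>: "\<sigma> > 1"
  shows "has_bochner_integral lborel (\<lambda>v. gamma_main r v * exp (- \<sigma> * v)) (Gamma r * (\<sigma> - 1) powr (- r))"
proof -
  have "has_bochner_integral lborel (\<lambda>t. indicator {0..} t * t powr (r - 1) / exp t) (Gamma r)"
    by (rule has_bochner_integral_nn_integral) (use r Gamma_conv_nn_integral_real[OF r] in \<open>auto simp: indicator_def intro: less_imp_le\<close>)
  moreover have "\<sigma> - 1 \<noteq> 0" using \<sigma> by simp
  ultimately have "has_bochner_integral lborel (\<lambda>v. indicator {0..} (0 + (\<sigma> - 1) * v) * (0 + (\<sigma> - 1) * v) powr (r - 1) / exp (0 + (\<sigma> - 1) * v)) (Gamma r /\<^sub>R \<bar>\<sigma> - 1\<bar>)"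
    by (subst (asm) lborel_has_bochner_integral_real_affine_iff[where c = "\<sigma> - 1" and t = 0])
  then have "has_bochner_integral lborel (\<lambda>v. indicator {0..} ((\<sigma> - 1) * v) * ((\<sigma> - 1) * v) powr (r - 1) / exp ((\<sigma> - 1) * v)) (Gamma r / (\<sigma> - 1))"
    using \<sigma> by (simp add: divide_inverse mult.commute)
  then have "has_bochner_integral lborel (\<lambda>v. (\<sigma> - 1) powr (1 - r) * (indicator {0..} ((\<sigma> - 1) * v) * ((\<sigma> - 1) * v) powr (r - 1) / exp ((\<sigma> - 1) * v))) ((\<sigma> - 1) powr (1 - r) * (Gamma r / (\<sigma> - 1)))"
    by (rule has_bochner_integral_mult_right)
  also have "(\<lambda>v. (\<sigma> - 1) powr (1 - r) * (indicator {0..} ((\<sigma> - 1) * v) * ((\<sigma> - 1) * v) powr (r - 1) / exp ((\<sigma> - 1) * v))) = (\<lambda>v. gamma_main r v * exp (- \<sigma> * v))"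
  proof
    fix v
    show "(\<sigma> - 1) powr (1 - r) * (indicator {0..} ((\<sigma> - 1) * v) * ((\<sigma> - 1) * v) powr (r - 1) / exp ((\<sigma> - 1) * v)) = gamma_main r v * exp (- \<sigma> * v)"
    proof (cases "v > 0")
      case True
      have "(\<sigma> - 1) powr (1 - r) * ((\<sigma> - 1) * v) powr (r - 1) = ((\<sigma> - 1) powr (1 - r) * (\<sigma> - 1) powr (r - 1)) * v powr (r - 1)"
        by (simp add: powr_mult)
      also have "(\<sigma> - 1) powr (1 - r) * (\<sigma> - 1) powr (r - 1) = 1" using \<sigma> by (simp flip: powr_add)
      finally have 1: "(\<sigma> - 1) powr (1 - r) * ((\<sigma> - 1) * v) powr (r - 1) = v powr (r - 1)" by simp
      have 2: "exp v * exp (- \<sigma> * v) = 1 / exp ((\<sigma> - 1) * v)" by (simp add: algebra_simps exp_diff exp_minus divide_inverse)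
      have "gamma_main r v * exp (- \<sigma> * v) = v powr (r - 1) * (exp v * exp (- \<sigma> * v))" using True by (simp add: gamma_main_def)
      also have "\<dots> = (\<sigma> - 1) powr (1 - r) * ((\<sigma> - 1) * v) powr (r - 1) / exp ((\<sigma> - 1) * v)" unfolding 1 2 by simp
      finally show ?thesis using True \<sigma> by simp
    qed (use \<sigma> in \<open>auto simp: gamma_main_def indicator_def zero_le_mult_iff\<close>)
  qed
  also have "(\<sigma> - 1) powr (1 - r) * (Gamma r / (\<sigma> - 1)) = Gamma r * (\<sigma> - 1) powr (- r)"
  proof -
    have "(\<sigma> - 1) powr (1 - r) / (\<sigma> - 1) powr 1 = (\<sigma> - 1) powr (- r)" by (subst powr_diff[symmetric]) simp
    then have "(\<sigma> - 1) powr (1 - r) / (\<sigma> - 1) = (\<sigma> - 1) powr (- r)" using \<sigma> by simp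
    moreover have "(\<sigma> - 1) powr (1 - r) * (Gamma r / (\<sigma> - 1)) = Gamma r * ((\<sigma> - 1) powr (1 - r) / (\<sigma> - 1))" by simp
    ultimately show ?thesis by (simp only:)
  qed
  finally show ?thesis .
qed

lemma exp_growth_gamma_main: "r > 0 \<Longrightarrow> exp_growth (gamma_main r)"
  unfolding exp_growth_def
proof (intro conjI allI impI)
  show "gamma_main r \<in> borel_measurable borel" unfolding gamma_main_def by measurable
qed (use gamma_main_integral in \<open>auto simp: gamma_main_def has_bochner_integral_iff\<close>)

text \<open>On the real segment (1,3) this is Euler's integral for Gamma after scaling; the identity
  theorem carries it to the half-plane.\<close>

lemma laplace_gamma_main:
  assumes r: "r > 0" and s: "Re s > 1"
  shows "laplace (gamma_main r) s = of_real (Gamma r) * exp (- of_real r * Ln (s - 1))"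
proof -
  let ?S = "{s. Re s > 1}"
  let ?D = "\<lambda>s. laplace (gamma_main r) s - of_real (Gamma r) * exp (- of_real r * Ln (s - 1))"
  have "?D s = 0"
  proof (rule analytic_continuation[where f = ?D and w = s and S = ?S and U = "of_real ` {1<..<3}" and \<xi> = 2])
    show "?D holomorphic_on ?S"
      by (intro holomorphic_intros holomorphic_laplace exp_growth_gamma_main r) (auto simp: complex_nonpos_Reals_iff)
    show "open ?S" by (rule open_halfspace_Re_gt)
    show "connected ?S" by (intro convex_connected convex_halfspace_Re_gt)
    show "(2::complex) islimpt (of_real ` {1<..<3})"
    proof (rule islimpt_sequential[THEN iffD2], intro exI[of _ "\<lambda>n. of_real (2 + 1 / real (n + 2))"] conjI allI)
      show "complex_of_real (2 + 1 / real (n + 2)) \<in> of_real ` {1<..<3} - {2}" for n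
      proof -
        have "2 + 1 / real (n + 2) \<in> {1<..<3}" "2 + 1 / real (n + 2) \<noteq> 2" by (auto simp: field_simps)
        moreover have "complex_of_real (2 + 1 / real (n + 2)) = 2 \<longleftrightarrow> 2 + 1 / real (n + 2) = 2"
          using of_real_eq_iff[of "2 + 1 / real (n + 2)" 2, where 'a = complex] by simp
        ultimately show ?thesis by blast
      qed
      have "(\<lambda>n. 2 + 1 / real (n + 2)) \<longlonglongrightarrow> 2" by real_asymp
      from tendsto_of_real[OF this, where 'a = complex]
      show "(\<lambda>n. complex_of_real (2 + 1 / real (n + 2))) \<longlonglongrightarrow> 2" by simp
    qed
    fix z :: complex assume "z \<in> of_real ` {1<..<3}"
    then obtain \<sigma> where z: "z = of_real \<sigma>" "\<sigma> > 1" by auto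
    have "laplace (gamma_main r) z = (LINT v|lborel. complex_of_real (gamma_main r v * exp (- \<sigma> * v)))"
      unfolding laplace_def z by (intro Bochner_Integration.integral_cong) (auto simp flip: exp_of_real)
    also have "\<dots> = of_real (Gamma r * (\<sigma> - 1) powr (- r))"
      unfolding integral_complex_of_real using gamma_main_integral[OF r z(2)] by (simp add: has_bochner_integral_iff)
    also have "\<dots> = of_real (Gamma r) * exp (- of_real r * Ln (z - 1))"
      using z Ln_of_real[of "\<sigma> - 1"] by (simp add: powr_def exp_of_real[symmetric] del: exp_of_real)
    finally show "?D z = 0" by simp
  qed (use s in auto)
  then show ?thesis by simp
qed

text \<open>\<open>rGamma\<close> is the entire function 1/Gamma; its zero at 0 makes the
  coefficient O(r).\<close>

definition lead_coeff_omega :: "real \<Rightarrow> real" where "lead_coeff_omega r = g_one r * rGamma r"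

definition omega_error :: "real \<Rightarrow> real \<Rightarrow> real" where
  "omega_error r v = omega_sum r (exp v) * indicator {0..} v - lead_coeff_omega r * gamma_main r v"

lemma omega_sum_indicator: "omega_sum r (exp v) * indicator {0..} v = omega_sum r (exp v)"
  by (cases "v < 0") (auto simp: omega_sum_lt_1)

lemma exp_growth_omega_sum:
  assumes r: "r \<ge> 0"
  shows "exp_growth (\<lambda>v. omega_sum r (exp v))"
  unfolding exp_growth_def
proof (intro conjI allI impI)
  show "(\<lambda>v. omega_sum r (exp v)) \<in> borel_measurable borel"
    by (intro borel_measurable_mono monoI omega_sum_mono r) simp
  show "omega_sum r (exp v) = 0" if "v < 0" for v using that by (intro omega_sum_lt_1) simp
  fix \<sigma> :: real assume "\<sigma> > 1"
  then have "integrable lborel (\<lambda>v. norm (of_real (omega_sum r (exp v)) * exp (- of_real \<sigma> * complex_of_real v)))"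
    by (intro integrable_norm omega_sum_transform r) auto
  then show "integrable lborel (\<lambda>v. omega_sum r (exp v) * exp (- \<sigma> * v))"
    by (simp add: norm_mult omega_sum_nonneg r)
qed

lemma exp_growth_omega_error:
  assumes r: "r > 0"
  shows "exp_growth (omega_error r)"
proof -
  note 1 = exp_growthD[OF exp_growth_omega_sum[OF less_imp_le[OF r]]] and 2 = exp_growthD[OF exp_growth_gamma_main[OF r]]
  show ?thesis
    unfolding exp_growth_def omega_error_def omega_sum_indicator
    using 1 2 by (auto simp: left_diff_distrib mult.assoc)
qed

lemma laplace_omega_error:
  assumes r: "r > 0" and s: "Re s > 1"
  shows "laplace (omega_error r) s = error_transform r s"
proof -
  note 2 = integrable_laplace[OF exp_growth_gamma_main[OF r] s]
  have "laplace (omega_error r) s = (LINT v|lborel. of_real (omega_sum r (exp v)) * exp (- s * of_real v) - of_real (lead_coeff_omega r) * (of_real (gamma_main r v) * exp (- s * of_real v)))"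
    unfolding laplace_def omega_error_def omega_sum_indicator
    by (simp only: of_real_diff of_real_mult left_diff_distrib mult.assoc)
  also have "\<dots> = omega_dseries r s / s - of_real (lead_coeff_omega r) * laplace (gamma_main r) s"
    using omega_sum_transform[OF less_imp_le[OF r] s] 2
    by (subst Bochner_Integration.integral_diff) (auto simp: laplace_def)
  also have "\<dots> = error_transform r s"
  proof -
    have "rGamma r * Gamma r = 1" using Gamma_real_pos[OF r] by (simp add: rGamma_inverse_Gamma)
    then have "complex_of_real (rGamma r) * of_real (Gamma r) = 1" by (simp flip: of_real_mult)
    then show ?thesis
      unfolding laplace_gamma_main[OF r s] error_transform_def lead_coeff_omega_def by (simp add: mult.assoc)
  qed
  finally show ?thesis .
qed

section \<open>Short averages of the error\<close>

lemma cauchy_kernel_integral: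
  assumes b: "b > 0"
  shows "has_bochner_integral lborel (\<lambda>t::real. 1 / (b\<^sup>2 + t\<^sup>2)) (pi / b)"
proof -
  have pos: "b\<^sup>2 + t\<^sup>2 > 0" for t using b by (simp add: add_pos_nonneg)
  have "(\<integral>\<^sup>+t. ennreal (1 / (b\<^sup>2 + t\<^sup>2)) * indicator {0..} t \<partial>lborel) = ennreal (pi / 2 / b - arctan (0 / b) / b)"
  proof (rule nn_integral_FTC_atLeast[where F = "\<lambda>t. arctan (t / b) / b"])
    fix t :: real
    have "((\<lambda>t. arctan (t / b) / b) has_real_derivative (1 / b * inverse (1 + (t / b)\<^sup>2)) / b) (at t)"
      using b by (auto intro!: derivative_eq_intros)
    moreover have "(1 / b * inverse (1 + (t / b)\<^sup>2)) / b = 1 / (b\<^sup>2 + t\<^sup>2)"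
    proof -
      have "1 + (t / b)\<^sup>2 = (b\<^sup>2 + t\<^sup>2) / b\<^sup>2" using b by (simp add: field_simps)
      then show ?thesis using b by (simp add: power2_eq_square)
    qed
    ultimately show "((\<lambda>t. arctan (t / b) / b) has_real_derivative 1 / (b\<^sup>2 + t\<^sup>2)) (at t)" by simp
    show "0 \<le> 1 / (b\<^sup>2 + t\<^sup>2)" using pos[of t] by simp
    have "filterlim (\<lambda>t. t / b) at_top at_top" using b by real_asymp
    then have "((\<lambda>t. arctan (t / b)) \<longlongrightarrow> pi / 2) at_top" by (rule filterlim_compose[OF tendsto_arctan_at_top])
    then show "((\<lambda>t. arctan (t / b) / b) \<longlongrightarrow> pi / 2 / b) at_top" by (intro tendsto_intros) (use b in auto)
  qed measurable
  moreover have "ennreal (indicator {0..} t *\<^sub>R (1 / (b\<^sup>2 + t\<^sup>2))) = ennreal (1 / (b\<^sup>2 + t\<^sup>2)) * indicator {0..} t" for t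
    by (simp add: indicator_def)
  ultimately have "(\<integral>\<^sup>+t. ennreal (indicator {0..} t *\<^sub>R (1 / (b\<^sup>2 + t\<^sup>2))) \<partial>lborel) = ennreal (pi / 2 / b)"
    by (simp only:) simp
  moreover have "0 \<le> indicator {0..} t *\<^sub>R (1 / (b\<^sup>2 + t\<^sup>2))" for t :: real
    using pos[of t] by (simp add: indicator_def)
  ultimately have "has_bochner_integral lborel (\<lambda>t::real. indicator {0..} t *\<^sub>R (1 / (b\<^sup>2 + t\<^sup>2))) (pi / 2 / b)"
    using b by (intro has_bochner_integral_nn_integral) auto
  then have "has_bochner_integral lborel (\<lambda>t::real. 1 / (b\<^sup>2 + t\<^sup>2)) (2 *\<^sub>R (pi / 2 / b))"
    by (rule has_bochner_integral_even_function) simp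
  then show ?thesis by simp
qed

lemma tail_kernel_integrable: "integrable lborel (\<lambda>t::real. (\<bar>t\<bar> + 2) powr (-(3/2)))"
proof -
  have "(\<integral>\<^sup>+t. ennreal ((\<bar>t\<bar> + 2) powr (-(3/2))) * indicator {0..} t \<partial>lborel) = ennreal (0 - (- 2 * (0 + 2) powr (-(1/2))))"
  proof (rule nn_integral_FTC_atLeast[where F = "\<lambda>t. - 2 * (t + 2) powr (-(1/2))"])
    fix t :: real assume t: "0 \<le> t"
    have "((\<lambda>t. - 2 * (t + 2) powr (-(1/2))) has_real_derivative (t + 2) powr (-(3/2))) (at t)"
      using t by (auto intro!: derivative_eq_intros)
    then show "((\<lambda>t. - 2 * (t + 2) powr (-(1/2))) has_real_derivative (\<bar>t\<bar> + 2) powr (-(3/2))) (at t)" using t by simp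
  next
    show "((\<lambda>t::real. - 2 * (t + 2) powr (-(1/2))) \<longlongrightarrow> 0) at_top" by real_asymp
  qed auto
  moreover have "ennreal (indicator {0..} t *\<^sub>R ((\<bar>t\<bar> + 2) powr (-(3/2)))) = ennreal ((\<bar>t\<bar> + 2) powr (-(3/2))) * indicator {0..} t" for t :: real
    by (simp add: indicator_def)
  ultimately have "(\<integral>\<^sup>+t. ennreal (indicator {0..} t *\<^sub>R ((\<bar>t\<bar> + 2) powr (-(3/2)))) \<partial>lborel) = ennreal (2 * 2 powr (-(1/2)))"
    by (simp only:) simp
  then have "has_bochner_integral lborel (\<lambda>t::real. indicator {0..} t *\<^sub>R ((\<bar>t\<bar> + 2) powr (-(3/2)))) (2 * 2 powr (-(1/2)))"
    by (intro has_bochner_integral_nn_integral) auto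
  then have "has_bochner_integral lborel (\<lambda>t::real. (\<bar>t\<bar> + 2) powr (-(3/2))) (2 *\<^sub>R (2 * 2 powr (-(1/2))))"
    by (rule has_bochner_integral_even_function) simp
  then show ?thesis by (simp add: has_bochner_integral_iff)
qed

lemma norm_laplace_cube:
  assumes r: "r > 0" and s: "Re s > 1"
  shows "exp_growth (\<lambda>v. v ^ 3 * omega_error r v)"
    "norm (laplace (\<lambda>v. v ^ 3 * omega_error r v) s) = norm ((deriv ^^ 3) (error_transform r) s)"
proof -
  note g = exp_growth_omega_error[OF r]
  show "exp_growth (\<lambda>v. v ^ 3 * omega_error r v)"
    using exp_growth_mult[OF exp_growth_mult[OF exp_growth_mult[OF g]]] by (simp add: power3_eq_cube mult.assoc)
  have ev: "\<forall>\<^sub>F z in nhds s. laplace (omega_error r) z = error_transform r z"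
    using eventually_nhds_in_open[OF open_halfspace_Re_gt[of 1], of s] s
    by (auto elim!: eventually_mono intro!: laplace_omega_error r)
  have "(deriv ^^ 3) (error_transform r) s = (deriv ^^ 3) (laplace (omega_error r)) s"
    by (rule higher_deriv_cong_ev[OF ev refl, symmetric])
  also have "\<dots> = laplace (\<lambda>v. (- v) ^ 3 * omega_error r v) s" by (rule higher_deriv_laplace[OF g s])
  also have "\<dots> = - laplace (\<lambda>v. v ^ 3 * omega_error r v) s"
    unfolding laplace_def by (simp flip: Bochner_Integration.integral_minus)
  finally show "norm (laplace (\<lambda>v. v ^ 3 * omega_error r v) s) = norm ((deriv ^^ 3) (error_transform r) s)" by simp
qed

text \<open>Inversion runs along Re s = 1 + \<eta> with \<eta> = 1/u. For small |t| the third
  derivative is at most a constant times u^r/(\<eta>^2+t^2) and the window factor is O(\<eta>); the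
  integral of 1/(\<eta>^2+t^2) is pi/\<eta>, so u^r results. For large |t| the exponents 1/2 of the
  transform and 1 of the window add to 3/2 and leave a constant. The window position w is
  independent of u, because windows on both sides of u are used.\<close>

lemma window_average_error:
  assumes R: "R > 0"
  shows "\<exists>u0\<ge>2. \<exists>C>0. \<forall>r u w. 0 < r \<longrightarrow> r \<le> R \<longrightarrow> u \<ge> u0 \<longrightarrow>
    \<bar>LINT v|lborel. indicator {w..w + 1/u} v * (v ^ 3 * omega_error r v)\<bar> \<le> C * exp ((1 + 1/u) * w) * (u powr r + 1)"
proof -
  obtain dn Cn where n: "dn > 0" "Cn > 0" "\<And>r s. 0 \<le> r \<Longrightarrow> r \<le> R \<Longrightarrow> Re s > 1 \<Longrightarrow> norm (s - 1) < dn \<Longrightarrow>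
    norm ((deriv ^^ 3) (error_transform r) s) \<le> Cn * norm (s - 1) powr (- 2 - r)"
    using error_transform_near[OF R] by meson
  define d where "d = min (dn / 2) (1/4)"
  have d: "0 < d" "d \<le> 1/4" "d \<le> dn / 2" using n by (auto simp: d_def)
  obtain Cf where f: "Cf > 0" "\<And>r s0. 0 \<le> r \<Longrightarrow> r \<le> R \<Longrightarrow> 1 < Re s0 \<Longrightarrow> Re s0 \<le> 2 \<Longrightarrow> \<bar>Im s0\<bar> \<ge> d \<Longrightarrow>
    norm ((deriv ^^ 3) (error_transform r) s0) \<le> Cf * (\<bar>Im s0\<bar> + 2) powr (-(1/2))"
    using error_transform_far[OF R d(1,2)] by meson
  \<comment> \<open>For u \<ge> u0 one has \<eta> < dn/2, so |t| < d \<le> dn/2 places the point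
    within dn of 1.\<close>
  define u0 where "u0 = max 2 (2 / dn + 1)"
  define J where "J = (LINT t|lborel. (\<bar>t\<bar> + 2) powr (-(3/2)) :: real)"
  \<comment> \<open>On the near part \<eta> |s| \<le> 3, so |exp(\<eta> s) - 1| \<le> \<eta> |s| exp
    3. On the far part it is at most exp 2 + 1, and |t| + 2 \<le> 3 |s|.\<close>
  define A where "A = Cn * exp 3"
  define B where "B = Cf * ((exp 2 + 1) * 3)"
  have AB: "A > 0" "B > 0" using n f by (auto simp: A_def B_def intro!: mult_pos_pos add_pos_pos)
  have J: "J \<ge> 0" unfolding J_def by (intro Bochner_Integration.integral_nonneg) auto
  have main: "\<bar>LINT v|lborel. indicator {w..w + 1/u} v * (v ^ 3 * omega_error r v)\<bar> \<le> (A * pi + B * J + 1) * exp ((1 + 1/u) * w) * (u powr r + 1)"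
    if r: "0 < r" "r \<le> R" and u: "u \<ge> u0" for r u w
  proof -
    define \<sigma> where "\<sigma> = 1 + 1 / u"
    define \<eta> where "\<eta> = 1 / u"
    have u2: "u \<ge> 2" "u > 2 / dn" using u by (auto simp: u0_def)
    have \<eta>: "\<eta> > 0" "\<eta> \<le> 1/2" using u2 by (auto simp: \<eta>_def field_simps)
    have \<eta>d: "\<eta> < dn / 2"
    proof -
      have "2 < u * dn" using u2 n by (simp add: field_simps)
      then show ?thesis using u2 by (simp add: \<eta>_def field_simps)
    qed
    have \<sigma>: "\<sigma> = 1 + \<eta>" "\<sigma> > 1" "\<sigma> \<le> 2" using \<eta> by (auto simp: \<sigma>_def \<eta>_def)
    define a where "a = (\<lambda>v. v ^ 3 * omega_error r v)"
    have a: "exp_growth a" unfolding a_def by (rule norm_laplace_cube[OF r(1), of 2]) simp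
    have la: "norm (laplace a s) = norm ((deriv ^^ 3) (error_transform r) s)" if "Re s > 1" for s
      unfolding a_def by (rule norm_laplace_cube[OF r(1) that])
    define K where "K = (\<lambda>t. norm (laplace a (Complex \<sigma> t)) * norm ((exp (of_real \<eta> * Complex \<sigma> t) - 1) / Complex \<sigma> t))"
    define g where "g = (\<lambda>t. A * u powr (r - 1) * (1 / (\<eta>\<^sup>2 + t\<^sup>2)) + B * (\<bar>t\<bar> + 2) powr (-(3/2)))"
    have Kg: "K t \<le> g t" for t
    proof (cases "\<bar>t\<bar> < d")
      case True
      let ?s = "Complex \<sigma> t"
      have s1: "?s - 1 = Complex \<eta> t" using \<sigma> by (simp add: complex_eq_iff)
      have "norm (?s - 1) \<le> \<bar>\<eta>\<bar> + \<bar>t\<bar>" unfolding s1 using cmod_le[of "Complex \<eta> t"] by simp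
      also have "\<dots> < dn" using True d \<eta> \<eta>d by linarith
      finally have sn: "norm (?s - 1) < dn" .
      have sq: "norm (?s - 1) ^ 2 = \<eta>\<^sup>2 + t\<^sup>2" unfolding s1 by (simp add: cmod_power2)
      have ge: "norm (?s - 1) \<ge> \<eta>" using abs_Re_le_cmod[of "?s - 1"] \<eta> unfolding s1 by simp
      have "norm (laplace a ?s) \<le> Cn * norm (?s - 1) powr (- 2 - r)"
        using la[of ?s] n(3)[of r ?s] r \<sigma> sn by simp
      also have "norm (?s - 1) powr (- 2 - r) = norm (?s - 1) powr (-2) * norm (?s - 1) powr (-r)"
        by (simp flip: powr_add)
      also have "norm (?s - 1) powr (-2) = 1 / (\<eta>\<^sup>2 + t\<^sup>2)"
        using ge \<eta> sq by (simp add: powr_minus_divide)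
      also have "norm (?s - 1) powr (-r) \<le> \<eta> powr (-r)" using ge \<eta> r by (intro powr_mono2') auto
      also have "\<eta> powr (-r) = u powr r" using u2 by (simp add: \<eta>_def powr_divide powr_minus)
      finally have l: "norm (laplace a ?s) \<le> Cn * (1 / (\<eta>\<^sup>2 + t\<^sup>2) * u powr r)"
        using n by (simp add: mult_left_mono divide_right_mono)
      have s0: "norm ?s > 0" "norm ?s \<le> 3"
      proof -
        show "norm ?s > 0" using \<sigma> by (simp add: complex_eq_iff)
        have "norm ?s \<le> \<bar>\<sigma>\<bar> + \<bar>t\<bar>" using cmod_le[of ?s] by simp
        then show "norm ?s \<le> 3" using \<sigma> True d by linarith
      qed
      have "norm (exp (of_real \<eta> * ?s) - 1) \<le> norm (of_real \<eta> * ?s) * exp (norm (of_real \<eta> * ?s))" by (rule norm_exp_minus_1_le)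
      also have "\<dots> = \<eta> * norm ?s * exp (\<eta> * norm ?s)" using \<eta> by (simp add: norm_mult)
      also have "\<dots> \<le> \<eta> * norm ?s * exp 3"
      proof -
        have "\<eta> * norm ?s \<le> 1 * 3" using \<eta> s0 by (intro mult_mono) auto
        then show ?thesis using \<eta> s0 by (intro mult_left_mono) auto
      qed
      finally have e: "norm ((exp (of_real \<eta> * ?s) - 1) / ?s) \<le> \<eta> * exp 3"
        using s0 by (simp add: norm_divide field_simps)
      have "K t \<le> (Cn * (1 / (\<eta>\<^sup>2 + t\<^sup>2) * u powr r)) * (\<eta> * exp 3)"
        unfolding K_def using n by (intro mult_mono l e) auto
      also have "\<dots> = A * (u powr r * \<eta>) * (1 / (\<eta>\<^sup>2 + t\<^sup>2))" by (simp add: A_def)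
      also have "u powr r * \<eta> = u powr (r - 1)" using u2 by (simp add: \<eta>_def powr_diff)
      also have "A * u powr (r - 1) * (1 / (\<eta>\<^sup>2 + t\<^sup>2)) \<le> g t" unfolding g_def using AB by simp
      finally show ?thesis .
    next
      case False
      let ?s = "Complex \<sigma> t"
      have l: "norm (laplace a ?s) \<le> Cf * (\<bar>t\<bar> + 2) powr (-(1/2))"
        using la[of ?s] f(2)[of r ?s] r \<sigma> False by simp
      have n0: "\<bar>t\<bar> + 2 \<le> 3 * norm ?s" using abs_Re_le_cmod[of ?s] abs_Im_le_cmod[of ?s] \<sigma> by simp
      have "norm (exp (of_real \<eta> * ?s) - 1) \<le> exp (\<eta> * \<sigma>) + 1"
        using norm_triangle_ineq4[of "exp (of_real \<eta> * ?s)" 1] by simp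
      also have "\<eta> * \<sigma> \<le> 1 * 2" using \<eta> \<sigma> by (intro mult_mono) auto
      then have "exp (\<eta> * \<sigma>) + 1 \<le> exp 2 + 1" by simp
      finally have "norm ((exp (of_real \<eta> * ?s) - 1) / ?s) \<le> (exp 2 + 1) / norm ?s"
        by (simp add: norm_divide divide_right_mono)
      also have "\<dots> \<le> (exp 2 + 1) / ((\<bar>t\<bar> + 2) / 3)"
        using n0 by (intro divide_left_mono) (auto intro!: mult_pos_pos add_nonneg_pos)
      also have "\<dots> = (exp 2 + 1) * 3 * (\<bar>t\<bar> + 2) powr (-1)" by (simp add: powr_minus_divide)
      finally have e: "norm ((exp (of_real \<eta> * ?s) - 1) / ?s) \<le> (exp 2 + 1) * 3 * (\<bar>t\<bar> + 2) powr (-1)" .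
      have "K t \<le> (Cf * (\<bar>t\<bar> + 2) powr (-(1/2))) * ((exp 2 + 1) * 3 * (\<bar>t\<bar> + 2) powr (-1))"
        unfolding K_def using f by (intro mult_mono l e) auto
      also have "\<dots> = B * ((\<bar>t\<bar> + 2) powr (-(1/2)) * (\<bar>t\<bar> + 2) powr (-1))" by (simp add: B_def)
      also have "(\<bar>t\<bar> + 2) powr (-(1/2)) * (\<bar>t\<bar> + 2) powr (-1) = (\<bar>t\<bar> + 2) powr (-(3/2))" by (subst powr_add[symmetric]) simp
      also have "B * (\<bar>t\<bar> + 2) powr (-(3/2)) \<le> g t" unfolding g_def using AB by simp
      finally show ?thesis .
    qed
    note ck = cauchy_kernel_integral[OF \<eta>(1), unfolded has_bochner_integral_iff]
    have intg: "integrable lborel g"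
      unfolding g_def using ck tail_kernel_integrable by (intro Bochner_Integration.integrable_add integrable_mult_right) auto
    have Ig: "(LINT t|lborel. g t) = A * u powr (r - 1) * (pi / \<eta>) + B * J"
    proof -
      have "integrable lborel (\<lambda>t. A * u powr (r - 1) * (1 / (\<eta>\<^sup>2 + t\<^sup>2)))" using ck by (intro integrable_mult_right) auto
      moreover have "integrable lborel (\<lambda>t::real. B * (\<bar>t\<bar> + 2) powr (-(3/2)))" by (intro integrable_mult_right tail_kernel_integrable)
      ultimately show ?thesis
        unfolding g_def J_def by (simp only: Bochner_Integration.integral_add integral_mult_right_zero ck)
    qed
    have contK: "continuous_on UNIV K"
    proof -
      have "continuous_on UNIV (\<lambda>t. Complex \<sigma> t)"
        unfolding Complex_eq by (intro continuous_intros)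
      moreover from this have "continuous_on UNIV (\<lambda>t. laplace a (Complex \<sigma> t))"
        by (rule continuous_on_compose2[OF holomorphic_on_imp_continuous_on[OF holomorphic_laplace[OF a]]]) (use \<sigma> in auto)
      ultimately show ?thesis unfolding K_def
        using \<sigma> by (intro continuous_intros) (auto simp: complex_eq_iff)
    qed
    have intK: "integrable lborel K"
    proof (rule Bochner_Integration.integrable_bound[OF intg])
      show "K \<in> borel_measurable lborel" using contK by (simp add: borel_measurable_continuous_onI)
      have "K t \<ge> 0" for t by (simp add: K_def)
      then show "AE t in lborel. norm (K t) \<le> norm (g t)" using Kg by (auto intro!: AE_I2 order_trans[OF Kg])
    qed
    have "(LINT t|lborel. K t) \<le> (LINT t|lborel. g t)" by (rule integral_mono[OF intK intg Kg])
    also have "\<dots> = A * pi * u powr r + B * J"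
    proof -
      have "u powr (r - 1) * u = u powr r" using u2 by (simp add: powr_diff)
      then show ?thesis unfolding Ig by (simp add: \<eta>_def)
    qed
    also have "\<dots> \<le> (A * pi + B * J + 1) * (u powr r + 1)"
      using AB J by (simp add: algebra_simps add_nonneg_nonneg)
    finally have IK: "(LINT t|lborel. K t) \<le> (A * pi + B * J + 1) * (u powr r + 1)" .
    have "\<bar>LINT v|lborel. indicator {w..w + \<eta>} v * a v\<bar> \<le> exp (\<sigma> * w) / (2 * pi) * (LINT t|lborel. K t)"
      using box_average_le[OF a \<sigma>(2) \<eta>(1), of w] intK unfolding K_def by simp
    also have "\<dots> \<le> exp (\<sigma> * w) * ((A * pi + B * J + 1) * (u powr r + 1))"
    proof (rule mult_mono[OF _ IK])
      show "exp (\<sigma> * w) / (2 * pi) \<le> exp (\<sigma> * w)" using pi_gt3 by (simp add: field_simps)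
      show "0 \<le> (LINT t|lborel. K t)" by (intro Bochner_Integration.integral_nonneg) (simp add: K_def)
    qed auto
    finally show ?thesis by (simp add: a_def \<sigma>_def \<eta>_def mult_ac)
  qed
  have "A * pi + B * J + 1 > 0" using AB J by (intro add_nonneg_pos add_nonneg_nonneg) auto
  moreover have "u0 \<ge> 2" by (simp add: u0_def)
  ultimately show ?thesis using main by blast
qed

text \<open>By 1/Gamma(r) = r/Gamma(r+1) with 1/Gamma bounded on [0, R+1]. The linear factor r is
  kept because it later cancels a 1/r from the integral in m_r.\<close>

lemma lead_coeff_omega_le:
  assumes R: "R > 0"
  shows "\<exists>C>0. \<forall>r. 0 < r \<longrightarrow> r \<le> R \<longrightarrow> \<bar>lead_coeff_omega r\<bar> \<le> C * r"
proof -
  obtain CG where CG: "CG > 0" "\<And>r s. 0 \<le> r \<Longrightarrow> r \<le> R \<Longrightarrow> Re s \<ge> 3/4 \<Longrightarrow> norm (conv_prod r s) \<le> CG"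
    using norm_conv_prod_le[OF R] by meson
  have "compact ((rGamma :: real \<Rightarrow> real) ` {0..R + 1})"
    by (intro compact_continuous_image continuous_on_rGamma) simp
  from compact_imp_bounded[OF this] obtain B where "\<forall>y\<in>rGamma ` {0..R + 1}. norm (y::real) \<le> B"
    unfolding bounded_iff by blast
  then have B: "\<bar>rGamma x\<bar> \<le> B" if "x \<in> {0..R + 1}" for x using that by auto
  have "\<bar>lead_coeff_omega r\<bar> \<le> (CG * (\<bar>B\<bar> + 1)) * r" if r: "0 < r" "r \<le> R" for r
  proof -
    have 1: "\<bar>g_one r\<bar> \<le> CG" using CG(2)[of r 1] conv_prod_1[of r] r by simp
    have "\<bar>rGamma r\<bar> = r * \<bar>rGamma (r + 1)\<bar>" using rGamma_plus1[of r] r by (simp add: abs_mult flip: rGamma_plus1[of r])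
    also have "\<dots> \<le> r * (\<bar>B\<bar> + 1)" using B[of "r + 1"] r by (intro mult_left_mono) auto
    finally have 2: "\<bar>rGamma r\<bar> \<le> r * (\<bar>B\<bar> + 1)" .
    have "\<bar>lead_coeff_omega r\<bar> \<le> CG * (r * (\<bar>B\<bar> + 1))"
      unfolding lead_coeff_omega_def abs_mult using 1 2 CG by (intro mult_mono) auto
    then show ?thesis by (simp add: mult_ac)
  qed
  moreover have "CG * (\<bar>B\<bar> + 1) > 0" using CG by (intro mult_pos_pos) auto
  ultimately show ?thesis by blast
qed

section \<open>From averages to pointwise asymptotics\<close>

lemma window_integral_bounds:
  fixes f :: "real \<Rightarrow> real"
  assumes f[measurable]: "f \<in> borel_measurable borel" and h: "h > 0"
    and bd: "\<And>v. w \<le> v \<Longrightarrow> v \<le> w + h \<Longrightarrow> m \<le> f v \<and> f v \<le> M"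
  shows "integrable lborel (\<lambda>v. indicator {w..w + h} v * f v)"
    "h * m \<le> (LINT v|lborel. indicator {w..w + h} v * f v)" "(LINT v|lborel. indicator {w..w + h} v * f v) \<le> h * M"
proof -
  have c: "integrable lborel (\<lambda>v::real. indicator {w..w + h} v * c)" "(LINT v|lborel. indicator {w..w + h} v * c) = h * c" for c :: real
    using h by (auto intro!: integrable_mult_left integrable_real_indicator)
  show i: "integrable lborel (\<lambda>v. indicator {w..w + h} v * f v)"
  proof (rule Bochner_Integration.integrable_bound[OF c(1)[of "\<bar>m\<bar> + \<bar>M\<bar>"]])
    show "AE v in lborel. norm (indicator {w..w + h} v * f v) \<le> norm (indicator {w..w + h} v * (\<bar>m\<bar> + \<bar>M\<bar>))"
    proof (rule AE_I2)
      fix v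
      show "norm (indicator {w..w + h} v * f v) \<le> norm (indicator {w..w + h} v * (\<bar>m\<bar> + \<bar>M\<bar>))"
        using bd[of v] by (cases "v \<in> {w..w + h}") auto
    qed
  qed measurable
  have "(LINT v|lborel. indicator {w..w + h} v * m) \<le> (LINT v|lborel. indicator {w..w + h} v * f v)"
    by (rule integral_mono[OF c(1) i]) (use bd in \<open>auto simp: indicator_def\<close>)
  then show "h * m \<le> (LINT v|lborel. indicator {w..w + h} v * f v)" by (simp only: c)
  have "(LINT v|lborel. indicator {w..w + h} v * f v) \<le> (LINT v|lborel. indicator {w..w + h} v * M)"
    by (rule integral_mono[OF i c(1)]) (use bd in \<open>auto simp: indicator_def\<close>)
  then show "(LINT v|lborel. indicator {w..w + h} v * f v) \<le> h * M" by (simp only: c)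
qed

lemma exp_powr_lipschitz:
  fixes u v p P :: real
  assumes u: "u \<ge> 2" and v: "\<bar>v - u\<bar> \<le> 1 / u" and p: "0 \<le> p" "p \<le> P"
  shows "\<bar>exp v * v powr p - exp u * u powr p\<bar> \<le> (exp 1 * (1 + P) * 2 powr P) * exp u * u powr p / u"
proof -
  have iu: "1 / u \<le> 1/2" using u by (simp add: field_simps)
  let ?K = "(exp 1 * (1 + P) * 2 powr P) * exp u * u powr p"
  have "norm (exp v * v powr p - exp u * u powr p) \<le> ?K * norm (v - u)"
  proof (rule field_differentiable_bound[where S = "{u - 1/2..u + 1/2}" and f' = "\<lambda>x. exp x * x powr p + exp x * (p * x powr (p - 1))"])
    fix x assume "x \<in> {u - 1/2..u + 1/2}"
    then have x: "x \<ge> 1" "x \<le> u + 1" "x \<le> 2 * u" using u by auto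
    show "((\<lambda>x. exp x * x powr p) has_field_derivative exp x * x powr p + exp x * (p * x powr (p - 1))) (at x within {u - 1/2..u + 1/2})"
      using x by (auto intro!: derivative_eq_intros)
    have "norm (exp x * x powr p + exp x * (p * x powr (p - 1))) = exp x * (x powr p + p * x powr (p - 1))"
      using p x by (simp add: distrib_left)
    also have "\<dots> \<le> exp (u + 1) * (x powr p + P * x powr p)"
      using p x by (intro mult_mono add_mono powr_mono) auto
    also have "x powr p + P * x powr p = (1 + P) * x powr p" by (simp add: algebra_simps)
    also have "exp (u + 1) * ((1 + P) * x powr p) \<le> exp (u + 1) * ((1 + P) * (2 powr P * u powr p))"
    proof (intro mult_left_mono)
      have "x powr p \<le> (2 * u) powr p" using x p by (intro powr_mono2) auto
      also have "\<dots> = 2 powr p * u powr p" by (rule powr_mult)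
      also have "\<dots> \<le> 2 powr P * u powr p" using p by (intro mult_right_mono powr_mono) auto
      finally show "x powr p \<le> 2 powr P * u powr p" .
    qed (use p in auto)
    also have "\<dots> = ?K" by (simp add: exp_add)
    finally show "norm (exp x * x powr p + exp x * (p * x powr (p - 1))) \<le> ?K" .
  qed (use v iu in auto)
  also have "\<dots> \<le> ?K * (1 / u)" using v p by (intro mult_left_mono) auto
  finally show ?thesis by simp
qed

text \<open>Applied only where ln x stays bounded, so the power of x is immaterial.\<close>

lemma omega_sum_crude:
  assumes R: "R > 0"
  shows "\<exists>C>0. \<forall>r x. 0 \<le> r \<longrightarrow> r \<le> R \<longrightarrow> x \<ge> 1 \<longrightarrow> omega_sum r x \<le> C * x\<^sup>2"
proof -
  obtain C where C: "C > 0" "\<And>r n. 0 \<le> r \<Longrightarrow> r \<le> R \<Longrightarrow> n > 0 \<Longrightarrow> r ^ omega n \<le> C * real n powr 1"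
    using power_omega_le[OF R, of 1] by (meson zero_less_one)
  have "omega_sum r x \<le> C * x\<^sup>2" if r: "0 \<le> r" "r \<le> R" and x: "x \<ge> 1" for r x
  proof -
    have "omega_sum r x \<le> (\<Sum>n\<in>{n::nat. 1 \<le> n \<and> real n \<le> x}. C * x)"
      unfolding omega_sum_def
    proof (intro sum_mono)
      fix n :: nat assume n: "n \<in> {n. 1 \<le> n \<and> real n \<le> x}"
      have "r ^ omega n \<le> C * real n" using C(2)[of r n] r n by simp
      also have "\<dots> \<le> C * x" using n C by (intro mult_left_mono) auto
      finally show "r ^ omega n \<le> C * x" .
    qed
    also have "\<dots> = real (card {n::nat. 1 \<le> n \<and> real n \<le> x}) * (C * x)" by simp
    also have "\<dots> \<le> x * (C * x)"
    proof (intro mult_right_mono)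
      have "card {n::nat. 1 \<le> n \<and> real n \<le> x} \<le> card {1..nat \<lfloor>x\<rfloor>}" by (intro card_mono) (auto simp: le_nat_floor)
      also have "\<dots> = nat \<lfloor>x\<rfloor>" by simp
      finally show "real (card {n::nat. 1 \<le> n \<and> real n \<le> x}) \<le> x" using x by linarith
    qed (use C x in auto)
    finally show ?thesis by (simp add: power2_eq_square mult_ac)
  qed
  with C show ?thesis by blast
qed

text \<open>Since v^3 \<open>omega_sum r (exp v)\<close> increases with v, its value at u lies
  between its averages over [u-\<eta>, u] and [u, u+\<eta>]. On these windows the main term exp(v)
  v^(r+2) changes only by a relative O(1/u). Dividing the bound for the averages by \<eta> u^3 = u^2
  gives the remainder.\<close>

theorem omega_sum_exp_asymptotic:
  assumes R: "R > 0"
  shows "\<exists>u0\<ge>2. \<exists>C>0. \<forall>r u. 0 < r \<longrightarrow> r \<le> R \<longrightarrow> u \<ge> u0 \<longrightarrow>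
    \<bar>omega_sum r (exp u) - lead_coeff_omega r * exp u * u powr (r - 1)\<bar> \<le> C * exp u * (u powr (r - 2) + u powr (-2))"
proof -
  obtain u0 C where C: "u0 \<ge> 2" "C > 0" "\<And>r u w. 0 < r \<Longrightarrow> r \<le> R \<Longrightarrow> u \<ge> u0 \<Longrightarrow>
    \<bar>LINT v|lborel. indicator {w..w + 1/u} v * (v ^ 3 * omega_error r v)\<bar> \<le> C * exp ((1 + 1/u) * w) * (u powr r + 1)"
    using window_average_error[OF R] by meson
  obtain CL where CL: "CL > 0" "\<And>r. 0 < r \<Longrightarrow> r \<le> R \<Longrightarrow> \<bar>lead_coeff_omega r\<bar> \<le> CL * r"
    using lead_coeff_omega_le[OF R] by meson
  define KL where "KL = exp 1 * (1 + (R + 2)) * 2 powr (R + 2)"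
  have KL: "KL > 0" using R by (simp add: KL_def)
  define D where "D = C * exp 1 + CL * R * KL"
  have "\<bar>omega_sum r (exp u) - lead_coeff_omega r * exp u * u powr (r - 1)\<bar> \<le> D * exp u * (u powr (r - 2) + u powr (-2))"
    if r: "0 < r" "r \<le> R" and u: "u \<ge> u0" for r u
  proof -
    have u2: "u \<ge> 2" using u C by linarith
    define \<eta> where "\<eta> = 1 / u"
    have \<eta>: "\<eta> > 0" "\<eta> \<le> 1/2" "\<eta> * u = 1" using u2 by (auto simp: \<eta>_def field_simps)
    define c where "c = lead_coeff_omega r"
    have cle: "\<bar>c\<bar> \<le> CL * R"
      using CL(2)[OF r] CL(1) r mult_left_mono[of r R CL] unfolding c_def by linarith
    define S where "S v = v ^ 3 * omega_sum r (exp v)" for v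
    define m where "m v = v ^ 3 * gamma_main r v" for v
    define L where "L = KL * exp u * u powr (r + 2) / u"
    have L: "L \<ge> 0" using KL u2 by (simp add: L_def)
    have mS[measurable]: "S \<in> borel_measurable borel"
      unfolding S_def using exp_growthD(1)[OF exp_growth_omega_sum[OF less_imp_le[OF r(1)]]] by measurable
    have [measurable]: "m \<in> borel_measurable borel"
      unfolding m_def gamma_main_def by measurable
    have m: "m v = exp v * v powr (r + 2)" if "v > 0" for v
    proof -
      have "v ^ 3 * v powr (r - 1) = v powr 3 * v powr (r - 1)" using that by simp
      also have "\<dots> = v powr (r + 2)" by (subst powr_add[symmetric]) (simp add: add.commute)
      finally show ?thesis using that by (simp add: m_def gamma_main_def)
    qed
    have mL: "\<bar>m v - m u\<bar> \<le> L" if "\<bar>v - u\<bar> \<le> \<eta>" for v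
    proof -
      have "v > 0" using that \<eta> u2 by linarith
      then show ?thesis
        using exp_powr_lipschitz[OF u2, of v "r + 2" "R + 2"] that r u2 unfolding L_def KL_def by (simp add: m \<eta>_def)
    qed
    have Smono: "S v \<le> S v'" if "0 \<le> v" "v \<le> v'" for v v'
      unfolding S_def using that r by (intro mult_mono power_mono omega_sum_mono omega_sum_nonneg) auto
    have key: "\<bar>(LINT v|lborel. indicator {w..w + \<eta>} v * S v) - c * (\<eta> * m u)\<bar> \<le> C * (exp 1 * exp u) * (u powr r + 1) + \<bar>c\<bar> * (\<eta> * L)"
      \<comment> \<open>The two windows that touch u from the right and from the left.\<close>
      if w: "w = u \<or> w = u - \<eta>" for w
    proof -
      have wpos: "0 \<le> w" "w \<le> u" using w u2 \<eta> by auto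
      have im: "integrable lborel (\<lambda>v. indicator {w..w + \<eta>} v * m v)"
        "\<eta> * (m u - L) \<le> (LINT v|lborel. indicator {w..w + \<eta>} v * m v)"
        "(LINT v|lborel. indicator {w..w + \<eta>} v * m v) \<le> \<eta> * (m u + L)"
      proof -
        have bd: "m u - L \<le> m v \<and> m v \<le> m u + L" if "w \<le> v" "v \<le> w + \<eta>" for v
        proof -
          have "\<bar>v - u\<bar> \<le> \<eta>" using that w \<eta> by auto
          from mL[OF this] show ?thesis by linarith
        qed
        show "integrable lborel (\<lambda>v. indicator {w..w + \<eta>} v * m v)"
          "\<eta> * (m u - L) \<le> (LINT v|lborel. indicator {w..w + \<eta>} v * m v)"
          "(LINT v|lborel. indicator {w..w + \<eta>} v * m v) \<le> \<eta> * (m u + L)"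
          by (rule window_integral_bounds[OF _ \<eta>(1) bd]; simp)+
      qed
      have iS: "integrable lborel (\<lambda>v. indicator {w..w + \<eta>} v * S v)"
        by (rule window_integral_bounds(1)[OF mS \<eta>(1), where m = "S w" and M = "S (w + \<eta>)"])
          (use \<eta> wpos Smono in auto)
      have "(LINT v|lborel. indicator {w..w + \<eta>} v * (v ^ 3 * omega_error r v)) =
          (LINT v|lborel. indicator {w..w + \<eta>} v * S v - c * (indicator {w..w + \<eta>} v * m v))"
        unfolding omega_error_def omega_sum_indicator S_def m_def c_def
        by (intro Bochner_Integration.integral_cong refl) (simp add: algebra_simps)
      also have "\<dots> = (LINT v|lborel. indicator {w..w + \<eta>} v * S v) - c * (LINT v|lborel. indicator {w..w + \<eta>} v * m v)"
        by (simp only: Bochner_Integration.integral_diff[OF iS integrable_mult_right[OF im(1)]] integral_mult_right_zero)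
      finally have eq: "(LINT v|lborel. indicator {w..w + \<eta>} v * S v) - c * (\<eta> * m u) =
          (LINT v|lborel. indicator {w..w + \<eta>} v * (v ^ 3 * omega_error r v)) + c * ((LINT v|lborel. indicator {w..w + \<eta>} v * m v) - \<eta> * m u)"
        by (simp add: algebra_simps)
      have "\<bar>(LINT v|lborel. indicator {w..w + \<eta>} v * m v) - \<eta> * m u\<bar> \<le> \<eta> * L"
        using im(2,3) by (simp add: algebra_simps abs_le_iff)
      then have 2: "\<bar>c * ((LINT v|lborel. indicator {w..w + \<eta>} v * m v) - \<eta> * m u)\<bar> \<le> \<bar>c\<bar> * (\<eta> * L)"
        unfolding abs_mult by (intro mult_left_mono) auto
      have "\<bar>LINT v|lborel. indicator {w..w + \<eta>} v * (v ^ 3 * omega_error r v)\<bar> \<le> C * exp ((1 + \<eta>) * w) * (u powr r + 1)"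
        using C(3)[OF r u, of w] by (simp add: \<eta>_def)
      also have "\<dots> \<le> C * (exp 1 * exp u) * (u powr r + 1)"
      proof (intro mult_right_mono mult_left_mono)
        have "(1 + \<eta>) * w \<le> (1 + \<eta>) * u" using wpos \<eta> by (intro mult_left_mono) auto
        also have "\<dots> = u + 1" using \<eta> by (simp add: algebra_simps)
        finally show "exp ((1 + \<eta>) * w) \<le> exp 1 * exp u" by (simp flip: exp_add)
      qed (use C in auto)
      finally show ?thesis using 2 unfolding eq by linarith
    qed
    define E where "E = C * (exp 1 * exp u) * (u powr r + 1) + \<bar>c\<bar> * (\<eta> * L)"
    have up: "\<eta> * S u \<le> (LINT v|lborel. indicator {u..u + \<eta>} v * S v)"
      by (rule window_integral_bounds(2)[where M = "S (u + \<eta>)"]) (use \<eta> u2 Smono in auto)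
    have lo: "(LINT v|lborel. indicator {u - \<eta>..u - \<eta> + \<eta>} v * S v) \<le> \<eta> * S u"
      by (rule window_integral_bounds(3)[where m = "S (u - \<eta>)"]) (use \<eta> u2 Smono in auto)
    have "\<bar>\<eta> * S u - c * (\<eta> * m u)\<bar> \<le> E"
      using key[of u] key[of "u - \<eta>"] up lo unfolding E_def by simp
    then have "u * \<bar>\<eta> * S u - c * (\<eta> * m u)\<bar> \<le> u * E" using u2 by (intro mult_left_mono) auto
    moreover have "u * \<bar>\<eta> * S u - c * (\<eta> * m u)\<bar> = \<bar>S u - c * m u\<bar>"
    proof -
      have "u * \<bar>\<eta> * S u - c * (\<eta> * m u)\<bar> = \<bar>u * (\<eta> * S u - c * (\<eta> * m u))\<bar>" using u2 by (simp add: abs_mult)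
      also have "u * (\<eta> * S u - c * (\<eta> * m u)) = (\<eta> * u) * (S u - c * m u)" by (simp add: algebra_simps)
      finally show ?thesis using \<eta> by simp
    qed
    ultimately have b1: "\<bar>S u - c * m u\<bar> \<le> u * E" by simp
    have "S u - c * m u = u ^ 3 * (omega_sum r (exp u) - c * exp u * u powr (r - 1))"
      using u2 by (simp add: S_def m_def gamma_main_def algebra_simps)
    then have "u ^ 3 * \<bar>omega_sum r (exp u) - c * exp u * u powr (r - 1)\<bar> \<le> u * E"
      using b1 u2 by (simp add: abs_mult)
    \<comment> \<open>Comparison of exponents: u (u^r + 1) = u^3 (u^(r-2) + u^(-2)), and u \<eta> L
      = L = KL exp(u) u^(r+1).\<close>
    also have "u * E = u ^ 3 * (C * exp 1 * exp u * (u powr (r - 2) + u powr (-2)) + \<bar>c\<bar> * KL * exp u * u powr (r - 2))"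
    proof -
      have p3: "u ^ 3 = u powr 3" using u2 by simp
      have u1: "u powr 1 = u" using u2 by simp
      have e1: "u ^ 3 * u powr (r - 2) = u * u powr r"
      proof -
        have "u powr 3 * u powr (r - 2) = u powr (1 + r)" by (subst powr_add[symmetric]) simp
        then show ?thesis by (simp only: p3 u1 powr_add[of u 1 r])
      qed
      have e2: "u ^ 3 * u powr (-2) = u"
      proof -
        have "u powr 3 * u powr (-2) = u powr 1" by (subst powr_add[symmetric]) simp
        then show ?thesis by (simp only: p3 u1)
      qed
      have "u * (\<eta> * L) = L" using \<eta> by (simp add: mult_ac)
      moreover have "L = KL * exp u * (u * u powr r)"
        using u2 by (simp add: L_def powr_add power2_eq_square)
      ultimately have uL: "u * (\<eta> * L) = KL * exp u * (u * u powr r)" by (simp only:)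
      have "u * E = C * (exp 1 * exp u) * (u * u powr r + u) + \<bar>c\<bar> * (u * (\<eta> * L))"
        unfolding E_def by (simp only: distrib_left mult_1_right mult_ac)
      then have "u * E = C * exp 1 * exp u * (u * u powr r + u) + \<bar>c\<bar> * KL * exp u * (u * u powr r)"
        unfolding uL by (simp only: mult.assoc)
      also have "\<dots> = C * exp 1 * exp u * (u ^ 3 * u powr (r - 2) + u ^ 3 * u powr (-2)) + \<bar>c\<bar> * KL * exp u * (u ^ 3 * u powr (r - 2))"
        unfolding e1 e2 ..
      finally show ?thesis by (simp add: algebra_simps)
    qed
    finally have "\<bar>omega_sum r (exp u) - c * exp u * u powr (r - 1)\<bar> \<le> C * exp 1 * exp u * (u powr (r - 2) + u powr (-2)) + \<bar>c\<bar> * KL * exp u * u powr (r - 2)"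
      using u2 by (subst (asm) mult_le_cancel_left_pos) auto
    also have "\<dots> \<le> C * exp 1 * exp u * (u powr (r - 2) + u powr (-2)) + CL * R * KL * exp u * (u powr (r - 2) + u powr (-2))"
      using cle KL C(2) CL(1) R by (intro add_mono mult_mono order_refl) auto
    also have "\<dots> = D * exp u * (u powr (r - 2) + u powr (-2))" by (simp add: D_def algebra_simps)
    finally show ?thesis by (simp add: c_def)
  qed
  moreover have "D > 0" unfolding D_def using C CL R KL by (intro add_pos_pos mult_pos_pos) auto
  ultimately show ?thesis using C(1) by blast
qed

text \<open>For 2 \<le> x < exp u0 both the sum and the main term are O(x), while the error term is
  at least x/u0^2; the constant D absorbs this range.\<close>

theorem omega_sum_asymptotic:
  assumes R: "R > 0"
  shows "\<exists>C>0. \<forall>r x. 0 < r \<longrightarrow> r \<le> R \<longrightarrow> x \<ge> 2 \<longrightarrow>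
    \<bar>omega_sum r x - lead_coeff_omega r * x * ln x powr (r - 1)\<bar> \<le> C * x * (ln x powr (r - 2) + ln x powr (-2))"
proof -
  obtain u0 C where C: "u0 \<ge> 2" "C > 0" "\<And>r u. 0 < r \<Longrightarrow> r \<le> R \<Longrightarrow> u \<ge> u0 \<Longrightarrow>
    \<bar>omega_sum r (exp u) - lead_coeff_omega r * exp u * u powr (r - 1)\<bar> \<le> C * exp u * (u powr (r - 2) + u powr (-2))"
    using omega_sum_exp_asymptotic[OF R] by meson
  obtain CL where CL: "CL > 0" "\<And>r. 0 < r \<Longrightarrow> r \<le> R \<Longrightarrow> \<bar>lead_coeff_omega r\<bar> \<le> CL * r"
    using lead_coeff_omega_le[OF R] by meson
  obtain B where B: "B > 0" "\<And>r x. 0 \<le> r \<Longrightarrow> r \<le> R \<Longrightarrow> x \<ge> 1 \<Longrightarrow> omega_sum r x \<le> B * x\<^sup>2"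
    using omega_sum_crude[OF R] by meson
  define D where "D = (B * exp u0 + CL * R * (u0 powr R + 4)) * u0\<^sup>2"
  have D: "D > 0" unfolding D_def using B CL R C(1) by (intro mult_pos_pos add_pos_pos add_nonneg_pos) auto
  have "\<bar>omega_sum r x - lead_coeff_omega r * x * ln x powr (r - 1)\<bar> \<le> (C + D) * x * (ln x powr (r - 2) + ln x powr (-2))"
    if r: "0 < r" "r \<le> R" and x: "x \<ge> 2" for r x
  proof (cases "ln x \<ge> u0")
    case True
    have "\<bar>omega_sum r x - lead_coeff_omega r * x * ln x powr (r - 1)\<bar> \<le> C * x * (ln x powr (r - 2) + ln x powr (-2))"
      using C(3)[OF r True] x by simp
    also have "\<dots> \<le> (C + D) * x * (ln x powr (r - 2) + ln x powr (-2))"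
      using D x by (intro mult_right_mono) auto
    finally show ?thesis .
  next
    case False
    have l2: "ln x \<ge> 1/2"
    proof -
      have "ln 2 \<le> ln x" using x by (intro ln_mono) auto
      then show ?thesis using ln2_ge_two_thirds by linarith
    qed
    have xe: "x \<le> exp u0" using False x by (metis exp_ln exp_le_cancel_iff less_imp_le not_le order_less_le_trans zero_less_numeral)
    \<comment> \<open>For ln x \<ge> 1 the exponent may be raised to R; for ln x in [1/2, 1) it may
      be lowered to -1, which gives at most 2.\<close>
    have "ln x powr (r - 1) \<le> u0 powr R + 4"
    proof (cases "ln x \<ge> 1")
      case True
      have "ln x powr (r - 1) \<le> ln x powr R" using True r by (intro powr_mono) auto
      also have "\<dots> \<le> u0 powr R" using True False r by (intro powr_mono2) auto
      finally show ?thesis by simp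
    next
      case False
      have "ln x powr (r - 1) \<le> ln x powr (- 1)" using False l2 r by (intro powr_mono') auto
      also have "\<dots> = 1 / ln x" using l2 by (simp add: powr_minus_divide)
      also have "\<dots> \<le> 1 / (1/2)" using l2 by (intro frac_le) auto
      finally show ?thesis by (simp add: add_increasing)
    qed
    then have m: "\<bar>lead_coeff_omega r * x * ln x powr (r - 1)\<bar> \<le> CL * R * x * (u0 powr R + 4)"
      unfolding abs_mult using CL(2)[OF r] CL(1) r mult_left_mono[of r R CL] x
      by (intro mult_mono order_trans[OF CL(2)[OF r]]) auto
    have "omega_sum r x \<le> B * x * x" using B(2)[of r x] r x by (simp add: power2_eq_square mult_ac)
    also have "\<dots> \<le> B * exp u0 * x" using xe B x by (intro mult_right_mono mult_left_mono) auto
    finally have s: "\<bar>omega_sum r x\<bar> \<le> B * exp u0 * x" using omega_sum_nonneg[of r x] r by simp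
    have "\<bar>omega_sum r x - lead_coeff_omega r * x * ln x powr (r - 1)\<bar> \<le> B * exp u0 * x + CL * R * x * (u0 powr R + 4)"
      using m s by linarith
    also have "\<dots> = D * x * (1 / u0\<^sup>2)" using C(1) by (simp add: D_def field_simps)
    also have "1 / u0\<^sup>2 \<le> ln x powr (-2)"
    proof -
      have "1 / u0\<^sup>2 \<le> 1 / (ln x)\<^sup>2" using False l2 by (intro frac_le power_mono) auto
      then show ?thesis using l2 by (simp add: powr_minus_divide)
    qed
    also have "D * x * ln x powr (-2) \<le> (C + D) * x * (ln x powr (r - 2) + ln x powr (-2))"
      using D C(2) x by (intro mult_mono) auto
    finally show ?thesis using D x by (simp add: mult_left_mono)
  qed
  moreover have "C + D > 0" using C D by simp
  ultimately show ?thesis by blast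
qed

section \<open>Mertens estimates\<close>

abbreviation psi :: "nat \<Rightarrow> real" where "psi N \<equiv> (\<Sum>d=1..N. mangoldt d)"

lemma ln_fact_eq_sum_mangoldt: "ln (fact N :: real) = (\<Sum>d=1..N. mangoldt d * real (N div d))"
proof -
  have "ln (fact N :: real) = (\<Sum>n=1..N. ln (real n))"
    by (induction N) (auto simp: ln_mult_pos)
  also have "\<dots> = (\<Sum>n=1..N. \<Sum>d | d dvd n. mangoldt d)"
    by (intro sum.cong refl) (subst mangoldt_sum, auto)
  also have "\<dots> = (\<Sum>n=1..N. \<Sum>d=1..N. if d dvd n then mangoldt d else 0)"
  proof (rule sum.cong[OF refl])
    fix n assume n: "n \<in> {1..N}"
    have "d \<in> {1..N}" if "d dvd n" for d
      using n that dvd_imp_le[OF that] dvd_pos_nat[OF _ that] by force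
    then have "{d. d dvd n} = {d\<in>{1..N}. d dvd n}" by blast
    then show "(\<Sum>d | d dvd n. mangoldt d :: real) = (\<Sum>d=1..N. if d dvd n then mangoldt d else 0)"
      by (simp only: sum.inter_filter finite_atLeastAtMost)
  qed
  also have "\<dots> = (\<Sum>d=1..N. \<Sum>n=1..N. if d dvd n then mangoldt d else 0)" by (rule sum.swap)
  also have "\<dots> = (\<Sum>d=1..N. mangoldt d * real (N div d))"
  proof (intro sum.cong refl)
    fix d assume d: "d \<in> {1..N}"
    have "{n\<in>{1..N}. d dvd n} = (\<lambda>k. d * k) ` {1..N div d}"
    proof (intro equalityI subsetI)
      fix n assume "n \<in> {n\<in>{1..N}. d dvd n}"
      then obtain k where k: "n = d * k" "1 \<le> n" "n \<le> N" by auto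
      then have "k \<le> N div d" using d by (simp add: less_eq_div_iff_mult_less_eq mult.commute)
      moreover have "1 \<le> k" using k by (cases k) auto
      ultimately show "n \<in> (\<lambda>k. d * k) ` {1..N div d}" using k(1) by auto
    next
      fix n assume "n \<in> (\<lambda>k. d * k) ` {1..N div d}"
      then obtain k where "n = d * k" "k \<in> {1..N div d}" by (rule imageE)
      then have k: "n = d * k" "1 \<le> k" "k \<le> N div d" by auto
      then have "d * k \<le> N" using d by (simp add: less_eq_div_iff_mult_less_eq mult.commute)
      then show "n \<in> {n\<in>{1..N}. d dvd n}" using k d by auto
    qed
    moreover have "inj_on (\<lambda>k. d * k) {1..N div d}" using d by (auto intro: inj_onI)
    ultimately have "card {n\<in>{1..N}. d dvd n} = N div d" by (simp add: card_image)
    then show "(\<Sum>n=1..N. if d dvd n then mangoldt d else 0) = mangoldt d * real (N div d)"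
      by (simp add: sum.inter_filter[symmetric])
  qed
  finally show ?thesis .
qed

text \<open>Chebyshev's argument with the central binomial coefficient: floor(2n/d) - 2 floor(n/d)
  is never negative and equals 1 for n < d \<le> 2n, while the coefficient is at most 4^n.\<close>

lemma psi_double_le: "psi (2 * n) \<le> psi n + real n * ln 4"
proof -
  have "ln (real ((2 * n) choose n)) = ln (fact (2 * n) :: real) - 2 * ln (fact n :: real)"
  proof -
    have "real ((2 * n) choose n) = fact (2 * n) / (fact n * fact n)"
      using binomial_fact[of n "2 * n", where 'a = real] by simp
    then show ?thesis by (simp add: ln_div ln_mult_pos)
  qed
  also have "\<dots> = (\<Sum>d=1..2*n. mangoldt d * real (2 * n div d)) - 2 * (\<Sum>d=1..2*n. mangoldt d * real (n div d))"
  proof -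
    have "(\<Sum>d=1..2*n. mangoldt d * real (n div d)) = (\<Sum>d=1..n. mangoldt d * real (n div d))"
      by (rule sum.mono_neutral_right) auto
    then show ?thesis by (simp add: ln_fact_eq_sum_mangoldt)
  qed
  also have "\<dots> = (\<Sum>d=1..2*n. mangoldt d * (real (2 * n div d) - 2 * real (n div d)))"
    by (simp add: sum_distrib_left sum_subtractf right_diff_distrib mult_ac)
  also have "\<dots> \<ge> (\<Sum>d=1..2*n. if d \<in> {n+1..2*n} then mangoldt d else 0)"
  proof (intro sum_mono)
    fix d assume d: "d \<in> {1..2*n}"
    have "2 * (n div d) \<le> 2 * n div d" using d by (simp add: less_eq_div_iff_mult_less_eq)
    then have 1: "real (2 * n div d) - 2 * real (n div d) \<ge> 0" by linarith
    show "(if d \<in> {n+1..2*n} then mangoldt d else 0) \<le> mangoldt d * (real (2 * n div d) - 2 * real (n div d))"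
    proof (cases "d \<in> {n+1..2*n}")
      case True
      have "2 * n div d \<ge> 1" using True by (simp add: less_eq_div_iff_mult_less_eq)
      then have "1 \<le> real (2 * n div d) - 2 * real (n div d)" using True by simp
      then have "mangoldt d * 1 \<le> mangoldt d * (real (2 * n div d) - 2 * real (n div d))"
        by (intro mult_left_mono mangoldt_nonneg)
      then show ?thesis using True by simp
    qed (use 1 mangoldt_nonneg in auto)
  qed
  also have "(\<Sum>d=1..2*n. if d \<in> {n+1..2*n} then mangoldt d else 0 :: real) = (\<Sum>d=n+1..2*n. mangoldt d)"
    by (subst sum.inter_restrict[symmetric]) (auto intro!: sum.cong)
  also have "(\<Sum>d=n+1..2*n. mangoldt d :: real) = psi (2 * n) - psi n"
  proof -
    have "{1..2*n} = {1..n} \<union> {n+1..2*n}" by auto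
    then have "psi (2 * n) = psi n + (\<Sum>d=n+1..2*n. mangoldt d)"
      by (simp only:) (rule sum.union_disjoint, auto)
    then show ?thesis by simp
  qed
  finally have 1: "psi (2 * n) - psi n \<le> ln (real ((2 * n) choose n))" by simp
  have "(2 * n) choose n \<le> 2 ^ (2 * n)" by (rule binomial_le_pow2)
  then have "real ((2 * n) choose n) \<le> real (2 ^ (2 * n))" by (simp only: of_nat_le_iff)
  also have "\<dots> = 4 ^ n" by (simp add: power_mult)
  finally have "real ((2 * n) choose n) \<le> 4 ^ n" .
  then have "ln (real ((2 * n) choose n)) \<le> ln (4 ^ n)" by (intro ln_mono) auto
  also have "\<dots> = real n * ln 4" by (simp add: ln_realpow)
  finally show ?thesis using 1 by simp
qed

lemma ln4_le_2: "ln (4::real) \<le> 2"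
proof -
  have "ln (4::real) = 2 * ln 2" using ln_realpow[of 2 2] by simp
  then show ?thesis using ln_2_less_1 by linarith
qed

text \<open>Induction by halving: 4n + 2n for psi(2n) leaves a slack of 2n below 8n, which for N =
  2n + 1 pays for the extra term, at most ln N \<le> N - 1 = 2n.\<close>

lemma psi_le: "psi N \<le> 4 * real N"
proof (induction N rule: less_induct)
  case (less N)
  show ?case
  proof (cases "N = 0")
    case False
    define n where "n = N div 2"
    have n: "n < N" using False by (simp add: n_def)
    have d: "psi (2 * n) \<le> 4 * real n + real n * 2"
      using psi_double_le[of n] less.IH[OF n] mult_left_mono[OF ln4_le_2, of "real n"] by linarith
    show ?thesis
    proof (cases "even N")
      case True
      then have "N = 2 * n" by (simp add: n_def)
      then show ?thesis using d by simp
    next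
      case False
      then have N: "N = Suc (2 * n)" by (simp add: n_def odd_two_times_div_two_succ)
      have "psi N = psi (2 * n) + mangoldt N" by (simp add: N)
      also have "mangoldt N \<le> ln (real N)" using N by (intro mangoldt_le) auto
      also have "ln (real N) \<le> real N - 1" using N by (intro ln_le_minus_one) auto
      finally show ?thesis using d N by simp
    qed
  qed simp
qed

lemma ln_fact_bounds:
  assumes "N > 0"
  shows "ln (fact N :: real) \<le> real N * ln (real N)" "ln (fact N :: real) \<ge> real N * ln (real N) - real N"
proof -
  have "(fact N :: real) \<le> real N ^ N" using fact_le_power[of N, where 'a = real] by simp
  then have "ln (fact N :: real) \<le> ln (real N ^ N)" by (intro ln_mono) auto
  then show "ln (fact N :: real) \<le> real N * ln (real N)" using assms by (simp add: ln_realpow)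
  show "ln (fact N :: real) \<ge> real N * ln (real N) - real N" using assms
  proof (induction N rule: nat_induct_non_zero)
    case (Suc n)
    have "ln (1 + 1 / real n) \<le> 1 / real n" using Suc by (intro ln_add_one_self_le_self) auto
    also have "1 + 1 / real n = (real n + 1) / real n" using Suc by (simp add: field_simps)
    finally have "real n * (ln (real n + 1) - ln (real n)) \<le> 1" using Suc by (simp add: ln_div field_simps)
    moreover have "ln (fact (Suc n) :: real) = ln (real n + 1) + ln (fact n)" using ln_mult_pos[of "real n + 1" "fact n"] by (simp add: add.commute)
    ultimately show ?case using Suc by (simp add: algebra_simps)
  qed simp
qed

text \<open>In ln N! = sum of mangoldt(d) floor(N/d), replacing the floor by N/d costs at most
  psi(N) \<le> 4N; dividing by N compares the sum with ln N.\<close>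

lemma sum_mangoldt_over_bounds:
  assumes N: "N > 0"
  shows "\<bar>(\<Sum>d=1..N. mangoldt d / real d) - ln (real N)\<bar> \<le> 4"
proof -
  let ?S = "\<Sum>d=1..N. mangoldt d / real d :: real"
  have fl: "real (N div d) \<le> real N / real d" "real N / real d \<le> real (N div d) + 1" if "d \<in> {1..N}" for d
  proof -
    have "\<lfloor>real N / real d\<rfloor> = int (N div d)" by (rule floor_divide_of_nat_eq)
    then show "real (N div d) \<le> real N / real d" "real N / real d \<le> real (N div d) + 1" by linarith+
  qed
  have "ln (fact N) \<le> (\<Sum>d=1..N. mangoldt d * (real N / real d))"
    unfolding ln_fact_eq_sum_mangoldt by (intro sum_mono mult_left_mono fl mangoldt_nonneg)
  also have "\<dots> = real N * ?S" by (simp add: sum_distrib_left mult_ac)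
  finally have "real N * ln (real N) - real N \<le> real N * ?S" using ln_fact_bounds(2)[OF N] by linarith
  then have "real N * (ln (real N) - 1) \<le> real N * ?S" by (simp add: algebra_simps)
  then have 1: "ln (real N) - 1 \<le> ?S" using N by simp
  have "real N * ?S = (\<Sum>d=1..N. mangoldt d * (real N / real d))" by (simp add: sum_distrib_left mult_ac)
  also have "\<dots> \<le> (\<Sum>d=1..N. mangoldt d * (real (N div d) + 1))"
    by (intro sum_mono mult_left_mono fl mangoldt_nonneg)
  also have "\<dots> = ln (fact N) + psi N" by (simp add: ln_fact_eq_sum_mangoldt distrib_left sum.distrib)
  also have "\<dots> \<le> real N * ln (real N) + 4 * real N" by (intro add_mono ln_fact_bounds N psi_le)
  finally have "real N * ?S \<le> real N * (ln (real N) + 4)" by (simp add: algebra_simps)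
  then have "?S \<le> ln (real N) + 4" using N by simp
  with 1 show ?thesis by linarith
qed

section \<open>From prime powers to primes\<close>

definition primes_upto :: "real \<Rightarrow> nat set" where "primes_upto x = {p. prime p \<and> real p \<le> x}"

lemma finite_primes_upto [simp, intro]: "finite (primes_upto x)"
  by (rule finite_subset[of _ "{..nat \<lfloor>x\<rfloor>}"]) (auto simp: primes_upto_def le_nat_floor)

text \<open>For one prime the powers with k \<ge> 2 contribute at most 2 ln p/p^2, and ln p \<le> 2
  sqrt p turns this into 4 p^(-3/2).\<close>

lemma sum_prime_powers_le: "\<exists>C\<ge>0. \<forall>N. (\<Sum>d | d \<in> {1..N} \<and> \<not> prime d. mangoldt d / real d) \<le> C"
proof (intro exI conjI allI)
  let ?C = "\<Sum>p. 4 * real p powr (-(3/2))"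
  have sm: "summable (\<lambda>p. 4 * real p powr (-(3/2)))" by (intro summable_mult) (simp add: summable_real_powr_iff)
  show "0 \<le> ?C" by (intro suminf_nonneg sm) auto
  fix N :: nat
  let ?D = "{d. d \<in> {1..N} \<and> \<not> prime d}"
  let ?I = "{p. prime p \<and> p \<le> N} \<times> {2..N}"
  have "(\<Sum>d\<in>?D. mangoldt d / real d :: real) = (\<Sum>d\<in>{d\<in>?D. primepow d}. mangoldt d / real d)"
    by (rule sum.mono_neutral_right) (auto simp: mangoldt_def)
  also have "\<dots> \<le> (\<Sum>d\<in>(\<lambda>(p, k). p ^ k) ` ?I. mangoldt d / real d)"
  proof (rule sum_mono2)
    show "{d\<in>?D. primepow d} \<subseteq> (\<lambda>(p, k). p ^ k) ` ?I"
    proof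
      fix d assume d: "d \<in> {d\<in>?D. primepow d}"
      then obtain p k where pk: "prime p" "k > 0" "d = p ^ k" by (auto simp: primepow_def)
      with d have "k \<noteq> 1" by auto
      with pk have "k \<ge> 2" by linarith
      have p2: "p \<ge> 2" using pk prime_ge_2_nat by auto
      \<comment> \<open>The exponent satisfies k < p^k = d \<le> N, so a finite grid of pairs (p, k)
        covers all d.\<close>
      have "k < p ^ k" using p2 by (intro power_gt_expt) auto
      moreover have "p \<le> p ^ k" using pk p2 by (intro self_le_power) auto
      ultimately show "d \<in> (\<lambda>(p, k). p ^ k) ` ?I"
        using d pk \<open>k \<ge> 2\<close> by (auto intro!: rev_image_eqI[of "(p, k)"])
    qed
  qed (auto simp: mangoldt_nonneg)
  also have "\<dots> \<le> (\<Sum>i\<in>?I. ((\<lambda>d. mangoldt d / real d) \<circ> (\<lambda>(p, k). p ^ k)) i)"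
    by (rule sum_image_le) (auto simp: mangoldt_nonneg)
  also have "\<dots> = (\<Sum>p | prime p \<and> p \<le> N. \<Sum>k=2..N. ln (real p) / real p ^ k)"
    by (subst sum.cartesian_product) (auto intro!: sum.cong simp: mangoldt_primepow')
  also have "\<dots> \<le> (\<Sum>p | prime p \<and> p \<le> N. 4 * real p powr (-(3/2)))"
  proof (rule sum_mono)
    fix p assume "p \<in> {p. prime p \<and> p \<le> N}"
    then have p: "p \<ge> 2" using prime_ge_2_nat by auto
    define q where "q = 1 / real p"
    have q: "0 < q" "q \<le> 1/2" using p by (auto simp: q_def)
    have "(\<Sum>k=2..N. q ^ k) \<le> 2 * q ^ 2"
    proof -
      have "(\<Sum>k=2..N. q ^ k) \<le> (\<Sum>k. q ^ (k + 2))"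
      proof -
        have "(\<Sum>k=2..N. q ^ k) \<le> (\<Sum>k\<in>(\<lambda>k. k + 2) ` {..<N}. q ^ k)"
        proof (rule sum_mono2)
          show "{2..N} \<subseteq> (\<lambda>k. k + 2) ` {..<N}"
          proof
            fix k assume "k \<in> {2..N}"
            then have "k = (k - 2) + 2" "k - 2 \<in> {..<N}" by auto
            then show "k \<in> (\<lambda>k. k + 2) ` {..<N}" by (rule image_eqI)
          qed
        qed (use q in auto)
        also have "\<dots> = (\<Sum>k<N. q ^ (k + 2))" by (subst sum.reindex) (auto simp: inj_on_def)
        also have "\<dots> \<le> (\<Sum>k. q ^ (k + 2))"
          using q by (intro sum_le_suminf) (auto simp: power_add intro!: summable_mult2)
        finally show ?thesis .
      qed
      also have "\<dots> = (\<Sum>k. q ^ k) * q ^ 2" using q by (subst suminf_mult2) (auto simp: power_add power2_eq_square mult_ac)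
      also have "(\<Sum>k. q ^ k) = 1 / (1 - q)" using q by (intro suminf_geometric) auto
      also have "1 / (1 - q) * q ^ 2 \<le> 2 * q ^ 2" using q by (intro mult_right_mono) (auto simp: field_simps)
      finally show ?thesis .
    qed
    moreover have "ln (real p) \<le> 2 * real p powr (1/2)"
    proof -
      have "ln (real p powr (1/2)) \<le> real p powr (1/2) - 1" using p by (intro ln_le_minus_one) auto
      then show ?thesis using p by (simp add: ln_powr)
    qed
    moreover have "(\<Sum>k=2..N. ln (real p) / real p ^ k) = ln (real p) * (\<Sum>k=2..N. q ^ k)"
      by (simp add: q_def sum_distrib_left power_divide)
    moreover have "q ^ 2 = real p powr (-2)" using p by (simp add: q_def powr_minus_divide power_divide)
    ultimately have "(\<Sum>k=2..N. ln (real p) / real p ^ k) \<le> (2 * real p powr (1/2)) * (2 * real p powr (-2))"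
      using q p by (simp only:) (intro mult_mono sum_nonneg, auto)
    also have "\<dots> = 4 * real p powr (-(3/2))" by (simp flip: powr_add)
    finally show "(\<Sum>k=2..N. ln (real p) / real p ^ k) \<le> 4 * real p powr (-(3/2))" .
  qed
  also have "\<dots> \<le> ?C" by (intro sum_le_suminf sm) auto
  finally show "(\<Sum>d | d \<in> {1..N} \<and> \<not> prime d. mangoldt d / real d) \<le> ?C" .
qed

theorem mertens_first: "\<exists>C>0. \<forall>x\<ge>1. \<bar>(\<Sum>p\<in>primes_upto x. ln (real p) / real p) - ln x\<bar> \<le> C"
proof -
  obtain C where C: "C \<ge> 0" "\<And>N. (\<Sum>d | d \<in> {1..N} \<and> \<not> prime d. mangoldt d / real d) \<le> C"
    using sum_prime_powers_le by blast
  show ?thesis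
  proof (intro exI[of _ "C + 5"] conjI allI impI)
    fix x :: real assume x: "x \<ge> 1"
    define N where "N = nat \<lfloor>x\<rfloor>"
    have N: "N > 0" "real N \<le> x" "x < real N + 1" using x by (auto simp: N_def)
    have P: "primes_upto x = {d. d \<in> {1..N} \<and> prime d}"
    proof -
      have "real p \<le> x \<longleftrightarrow> p \<le> N" for p using x by (auto simp: N_def le_nat_floor le_nat_iff le_floor_iff)
      then show ?thesis using prime_ge_1_nat by (auto simp: primes_upto_def)
    qed
    have "(\<Sum>d=1..N. mangoldt d / real d :: real) = (\<Sum>d\<in>{d. d \<in> {1..N} \<and> prime d} \<union> {d. d \<in> {1..N} \<and> \<not> prime d}. mangoldt d / real d)"
      by (rule sum.cong) auto
    also have "\<dots> = (\<Sum>d\<in>primes_upto x. mangoldt d / real d) + (\<Sum>d | d \<in> {1..N} \<and> \<not> prime d. mangoldt d / real d)"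
      unfolding P by (rule sum.union_disjoint) auto
    also have "(\<Sum>d\<in>primes_upto x. mangoldt d / real d :: real) = (\<Sum>p\<in>primes_upto x. ln (real p) / real p)"
      by (intro sum.cong) (auto simp: primes_upto_def)
    finally have eq: "(\<Sum>p\<in>primes_upto x. ln (real p) / real p) = (\<Sum>d=1..N. mangoldt d / real d) - (\<Sum>d | d \<in> {1..N} \<and> \<not> prime d. mangoldt d / real d)"
      by simp
    have "0 \<le> (\<Sum>d | d \<in> {1..N} \<and> \<not> prime d. mangoldt d / real d :: real)" by (intro sum_nonneg) (auto simp: mangoldt_nonneg)
    moreover have "\<bar>ln x - ln (real N)\<bar> \<le> 1"
    proof -
      have "ln (real N) \<le> ln x" using N by (intro ln_mono) auto
      moreover have "ln x \<le> ln (2 * real N)" using N by (intro ln_mono) auto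
      moreover have "ln (2 * real N) = ln 2 + ln (real N)" using N by (intro ln_mult_pos) auto
      ultimately show ?thesis using ln_2_less_1 by linarith
    qed
    ultimately show "\<bar>(\<Sum>p\<in>primes_upto x. ln (real p) / real p) - ln x\<bar> \<le> C + 5"
      using sum_mangoldt_over_bounds[OF N(1)] C(2)[of N] unfolding eq by linarith
  qed (use C in auto)
qed

text \<open>Each prime counted has weight at least ln(x/2) \<ge> (ln x)/2 in psi. The bound serves
  the primes with x/p < 2, for which the asymptotic formula for the inner sum is out of
  reach.\<close>

lemma card_primes_le:
  assumes x: "x \<ge> 4"
  shows "real (card {p. prime p \<and> x / 2 < real p \<and> real p \<le> x}) \<le> 8 * x / ln x"
proof -
  let ?A = "{p. prime p \<and> x / 2 < real p \<and> real p \<le> x}"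
  have fin: "finite ?A" by (rule finite_subset[OF _ finite_primes_upto[of x]]) (auto simp: primes_upto_def)
  define N where "N = nat \<lfloor>x\<rfloor>"
  have "ln x / 2 \<le> ln (x / 2)"
  proof -
    have "ln 4 \<le> ln x" using x by (intro ln_mono) auto
    moreover have "ln (4::real) = 2 * ln 2" using ln_realpow[of 2 2] by simp
    moreover have "ln (x / 2) = ln x - ln 2" using x by (simp add: ln_div)
    ultimately show ?thesis by linarith
  qed
  then have "real (card ?A) * (ln x / 2) \<le> real (card ?A) * ln (x / 2)" by (intro mult_left_mono) auto
  also have "\<dots> = (\<Sum>p\<in>?A. ln (x / 2))" by simp
  also have "\<dots> \<le> (\<Sum>p\<in>?A. mangoldt p)"
    using x by (intro sum_mono) auto
  also have "\<dots> \<le> psi N"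
    by (rule sum_mono2) (auto simp: N_def le_nat_floor mangoldt_nonneg prime_ge_1_nat)
  also have "\<dots> \<le> 4 * real N" by (rule psi_le)
  also have "real N \<le> x" using x by (simp add: N_def)
  finally have "real (card ?A) * (ln x / 2) \<le> 4 * x" by simp
  moreover have "ln x > 0" using x by simp
  ultimately show ?thesis by (simp add: field_simps)
qed

section \<open>Sums over the primes in an interval\<close>

definition primes_between :: "real \<Rightarrow> real \<Rightarrow> nat set" where
  "primes_between y w = {p. prime p \<and> y \<le> real p \<and> real p \<le> w}"

lemma finite_primes_between [simp, intro]: "finite (primes_between y w)"
  by (rule finite_subset[OF _ finite_primes_upto[of w]]) (auto simp: primes_between_def primes_upto_def)

text \<open>The interval is closed at y because \<open>omega_below\<close> counts primes strictly
  below y. A prime equal to y therefore occurs in both Mertens sums; the set Q of such primes has at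
  most one element, with weight at most 1.\<close>

lemma mertens_between:
  "\<exists>C>0. \<forall>y x. 1 \<le> y \<longrightarrow> y \<le> x \<longrightarrow> \<bar>(\<Sum>p\<in>primes_between y x. ln (real p) / real p) - (ln x - ln y)\<bar> \<le> C"
proof -
  obtain C where C: "C > 0" "\<And>x. x \<ge> 1 \<Longrightarrow> \<bar>(\<Sum>p\<in>primes_upto x. ln (real p) / real p) - ln x\<bar> \<le> C"
    using mertens_first by meson
  have "\<bar>(\<Sum>p\<in>primes_between y x. ln (real p) / real p) - (ln x - ln y)\<bar> \<le> 2 * C + 1" if yx: "1 \<le> y" "y \<le> x" for y x
  proof -
    let ?c = "\<lambda>p::nat. ln (real p) / real p"
    define Q where "Q = {p \<in> primes_upto y. real p = y}"
    have un: "primes_upto x \<union> Q = primes_between y x \<union> primes_upto y" "primes_between y x \<inter> primes_upto y = Q" "Q \<subseteq> primes_upto x"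
      using yx by (auto simp: primes_between_def primes_upto_def Q_def)
    have fQ: "finite Q" by (simp add: Q_def)
    have "sum ?c (primes_between y x) + sum ?c (primes_upto y) = sum ?c (primes_upto x) + sum ?c Q"
      using sum.union_inter[of "primes_between y x" "primes_upto y" ?c] un by (simp add: Un_absorb2)
    moreover have "0 \<le> sum ?c Q" "sum ?c Q \<le> 1"
    proof -
      have c: "0 \<le> ?c p" "?c p \<le> 1" if "p \<in> Q" for p
      proof -
        have p: "p \<ge> 1" using that prime_ge_1_nat by (auto simp: Q_def primes_upto_def)
        then show "0 \<le> ?c p" by simp
        have "ln (real p) \<le> real p - 1" using p by (intro ln_le_minus_one) auto
        then show "?c p \<le> 1" using p by (simp add: divide_le_eq)
      qed
      then show "0 \<le> sum ?c Q" by (intro sum_nonneg)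
      have "card Q \<le> 1" using fQ by (subst card_le_Suc0_iff_eq[unfolded One_nat_def[symmetric]]) (auto simp: Q_def)
      moreover have "sum ?c Q \<le> (\<Sum>p\<in>Q. 1)" by (intro sum_mono c)
      ultimately show "sum ?c Q \<le> 1" by simp
    qed
    ultimately show ?thesis using C(2)[of x] C(2)[of y] yx by linarith
  qed
  moreover have "2 * C + 1 > 0" using C by simp
  ultimately show ?thesis by blast
qed

text \<open>Abel summation against Mertens' estimate, in the variable \<open>v = ln p\<close>.\<close>

lemma abel_mertens:
  "\<exists>C>0. \<forall>y w k k'. 2 \<le> y \<longrightarrow> y \<le> w \<longrightarrow>
     (\<forall>v\<in>{ln y..ln w}. (k has_real_derivative k' v) (at v within {ln y..ln w})) \<longrightarrow> continuous_on {ln y..ln w} k' \<longrightarrow>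
     \<bar>(\<Sum>p\<in>primes_between y w. ln (real p) / real p * k (ln (real p))) - integral {ln y..ln w} k\<bar>
       \<le> C * (\<bar>k (ln w)\<bar> + integral {ln y..ln w} (\<lambda>v. \<bar>k' v\<bar>))"
proof -
  obtain C where C: "C > 0" "\<And>y x. 1 \<le> y \<Longrightarrow> y \<le> x \<Longrightarrow> \<bar>(\<Sum>p\<in>primes_between y x. ln (real p) / real p) - (ln x - ln y)\<bar> \<le> C"
    using mertens_between by meson
  have "\<bar>(\<Sum>p\<in>primes_between y w. ln (real p) / real p * k (ln (real p))) - integral {ln y..ln w} k\<bar>
       \<le> C * (\<bar>k (ln w)\<bar> + integral {ln y..ln w} (\<lambda>v. \<bar>k' v\<bar>))"
    if y: "2 \<le> y" "y \<le> w" and k: "\<forall>v\<in>{ln y..ln w}. (k has_real_derivative k' v) (at v within {ln y..ln w})"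
      and k': "continuous_on {ln y..ln w} k'" for y w k k'
  proof -
    define Y V where "Y = ln y" and "V = ln w"
    have YV: "Y \<le> V" unfolding Y_def V_def using y by (intro ln_mono) auto
    note k = k[folded Y_def V_def] and k' = k'[folded Y_def V_def]
    let ?c = "\<lambda>p::nat. ln (real p) / real p"
    let ?P = "primes_between y w"
    \<comment> \<open>The step function of Mertens: the sum of ln p/p over y \<le> p \<le> e^v,
      which differs from v - Y by at most C.\<close>
    define A where "A v = (\<Sum>p\<in>?P. if ln (real p) \<le> v then ?c p else 0)" for v
    have P: "Y \<le> ln (real p)" "ln (real p) \<le> V" "real p > 0" if "p \<in> ?P" for p
      using that y unfolding Y_def V_def primes_between_def by (auto intro!: ln_mono)
    have A: "\<bar>A v - (v - Y)\<bar> \<le> C" if v: "v \<in> {Y..V}" for v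
    proof -
      have "{p\<in>?P. ln (real p) \<le> v} = primes_between y (exp v)"
      proof -
        have "exp v \<le> exp V" using v by simp
        also have "exp V = w" using y by (simp add: V_def)
        finally have "exp v \<le> w" .
        moreover have "ln (real p) \<le> v \<longleftrightarrow> real p \<le> exp v" if "prime p" for p
        proof -
          have "real p > 0" using that prime_gt_0_nat by simp
          then show ?thesis by (metis exp_le_cancel_iff exp_ln)
        qed
        ultimately show ?thesis by (auto simp: primes_between_def)
      qed
      then have "A v = (\<Sum>p\<in>primes_between y (exp v). ?c p)"
        unfolding A_def by (subst sum.inter_filter[symmetric]) auto
      moreover have "y \<le> exp v"
      proof -
        have "y = exp Y" using y by (simp add: Y_def)
        also have "\<dots> \<le> exp v" using v by simp
        finally show ?thesis .
      qed
      ultimately show ?thesis using C(2)[of y "exp v"] y by (simp add: Y_def)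
    qed
    have k'int: "k' integrable_on {Y..V}" by (rule integrable_continuous_real[OF k'])
    have kint: "k integrable_on {Y..V}"
      by (rule integrable_continuous_real) (use k in \<open>auto intro!: DERIV_continuous_on\<close>)
    \<comment> \<open>k(V) - k(ln p) is the integral of k' over [ln p, V]; summed with the weights
      ln p/p this becomes the integral of A k'.\<close>
    have tail: "((\<lambda>v. if v \<in> {ln (real p)..V} then k' v else 0) has_integral (k V - k (ln (real p)))) {Y..V}" if p: "p \<in> ?P" for p
    proof (subst has_integral_restrict)
      show "(k' has_integral (k V - k (ln (real p)))) {ln (real p)..V}"
      proof (rule fundamental_theorem_of_calculus)
        show "ln (real p) \<le> V" using P[OF p] by simp
        fix v assume v: "v \<in> {ln (real p)..V}"
        have "(k has_real_derivative k' v) (at v within {Y..V})" using k v P[OF p] by auto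
        then have "(k has_real_derivative k' v) (at v within {ln (real p)..V})"
          by (rule DERIV_subset) (use P[OF p] in auto)
        then show "(k has_vector_derivative k' v) (at v within {ln (real p)..V})"
          by (simp add: has_real_derivative_iff_has_vector_derivative)
      qed
    qed (use P[OF p] in auto)
    have "((\<lambda>v. \<Sum>p\<in>?P. ?c p * (if v \<in> {ln (real p)..V} then k' v else 0)) has_integral (\<Sum>p\<in>?P. ?c p * (k V - k (ln (real p))))) {Y..V}"
      by (intro has_integral_sum has_integral_mult_right tail) auto
    then have Ak: "((\<lambda>v. A v * k' v) has_integral (\<Sum>p\<in>?P. ?c p * (k V - k (ln (real p))))) {Y..V}"
    proof (rule has_integral_eq[rotated])
      fix v assume "v \<in> {Y..V}"
      then show "(\<Sum>p\<in>?P. ?c p * (if v \<in> {ln (real p)..V} then k' v else 0)) = A v * k' v"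
        unfolding A_def sum_distrib_right by (intro sum.cong) auto
    qed
    have AV: "A V = (\<Sum>p\<in>?P. ?c p)" unfolding A_def using P by (intro sum.cong) auto
    \<comment> \<open>The same identity for the smooth counterpart v - Y of A; subtracting the two
      leaves (A v - (v - Y)) k'(v) under the integral.\<close>
    have parts: "((\<lambda>v. k v + (v - Y) * k' v) has_integral ((V - Y) * k V - (Y - Y) * k Y)) {Y..V}"
    proof (rule fundamental_theorem_of_calculus[OF YV])
      fix v assume "v \<in> {Y..V}"
      then have "((\<lambda>v. (v - Y) * k v) has_real_derivative k v + (v - Y) * k' v) (at v within {Y..V})"
        using k by (auto intro!: derivative_eq_intros)
      then show "((\<lambda>v. (v - Y) * k v) has_vector_derivative k v + (v - Y) * k' v) (at v within {Y..V})"
        by (simp add: has_real_derivative_iff_has_vector_derivative)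
    qed
    from has_integral_diff[OF parts integrable_integral[OF kint]]
    have Bk: "((\<lambda>v. (v - Y) * k' v) has_integral ((V - Y) * k V - integral {Y..V} k)) {Y..V}" by simp
    from has_integral_diff[OF Ak Bk]
    have D: "((\<lambda>v. (A v - (v - Y)) * k' v) has_integral ((\<Sum>p\<in>?P. ?c p * (k V - k (ln (real p)))) - ((V - Y) * k V - integral {Y..V} k))) {Y..V}"
      by (simp add: algebra_simps)
    have "\<bar>integral {Y..V} (\<lambda>v. (A v - (v - Y)) * k' v)\<bar> \<le> integral {Y..V} (\<lambda>v. C * \<bar>k' v\<bar>)"
      unfolding real_norm_def[symmetric]
    proof (rule integral_norm_bound_integral)
      show "(\<lambda>v. (A v - (v - Y)) * k' v) integrable_on {Y..V}" using D by (rule has_integral_integrable)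
      show "(\<lambda>v. C * norm (k' v)) integrable_on {Y..V}"
        by (intro integrable_continuous_real continuous_intros k')
      show "norm ((A v - (v - Y)) * k' v) \<le> C * norm (k' v)" if "v \<in> {Y..V}" for v
        unfolding norm_mult using A[OF that] by (intro mult_right_mono) auto
    qed
    then have b1: "\<bar>(\<Sum>p\<in>?P. ?c p * (k V - k (ln (real p)))) - ((V - Y) * k V - integral {Y..V} k)\<bar> \<le> C * integral {Y..V} (\<lambda>v. \<bar>k' v\<bar>)"
      unfolding integral_unique[OF D] by simp
    have "\<bar>(A V - (V - Y)) * k V\<bar> \<le> C * \<bar>k V\<bar>"
      unfolding abs_mult using A[of V] YV by (intro mult_right_mono) auto
    moreover have "(\<Sum>p\<in>?P. ?c p * k (ln (real p))) - integral {Y..V} k =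
        (A V - (V - Y)) * k V - ((\<Sum>p\<in>?P. ?c p * (k V - k (ln (real p)))) - ((V - Y) * k V - integral {Y..V} k))"
    proof -
      have "(\<Sum>p\<in>?P. ?c p * (k V - k (ln (real p)))) = (\<Sum>p\<in>?P. ?c p) * k V - (\<Sum>p\<in>?P. ?c p * k (ln (real p)))"
        by (simp only: right_diff_distrib sum_subtractf sum_distrib_right)
      then show ?thesis unfolding AV by (simp only:) (simp add: algebra_simps)
    qed
    ultimately have "\<bar>(\<Sum>p\<in>?P. ?c p * k (ln (real p))) - integral {Y..V} k\<bar> \<le> C * \<bar>k V\<bar> + C * integral {Y..V} (\<lambda>v. \<bar>k' v\<bar>)"
      using b1 by linarith
    then show ?thesis by (simp add: Y_def V_def algebra_simps)
  qed
  with C(1) show ?thesis by blast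
qed

lemma powr_between_le:
  assumes "0 < a" "a \<le> t" "t \<le> (b::real)"
  shows "t powr \<beta> \<le> a powr \<beta> + b powr \<beta>"
proof (cases "\<beta> \<ge> 0")
  case True
  then have "t powr \<beta> \<le> b powr \<beta>" using assms by (intro powr_mono2) auto
  then show ?thesis by (simp add: add_increasing)
next
  case False
  then have "t powr \<beta> \<le> a powr \<beta>" using assms by (intro powr_mono2') auto
  then show ?thesis by (simp add: add_increasing2)
qed

text \<open>Abel summation with k(v) = (X-v)^\<beta>/v. Stopping at x/2 keeps X - v \<ge> ln 2, so
  that k is smooth for every real \<beta>, and the total variation of k is O(H/Y) with a constant
  independent of \<beta>.\<close>

lemma sum_primes_powr_ln:
  "\<exists>C>0. \<forall>x y \<beta>. 2 \<le> y \<longrightarrow> y \<le> x / 2 \<longrightarrow>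
    \<bar>(\<Sum>p\<in>primes_between y (x / 2). ln (x / real p) powr \<beta> / real p) - integral {ln y..ln (x / 2)} (\<lambda>v. (ln x - v) powr \<beta> / v)\<bar>
     \<le> C * (ln 2 powr \<beta> + ln (x / y) powr \<beta>) / ln y"
proof -
  obtain C where C: "C > 0" "\<And>y w k k'. 2 \<le> y \<Longrightarrow> y \<le> w \<Longrightarrow>
     (\<forall>v\<in>{ln y..ln w}. (k has_real_derivative k' v) (at v within {ln y..ln w})) \<Longrightarrow> continuous_on {ln y..ln w} k' \<Longrightarrow>
     \<bar>(\<Sum>p\<in>primes_between y w. ln (real p) / real p * k (ln (real p))) - integral {ln y..ln w} k\<bar>
       \<le> C * (\<bar>k (ln w)\<bar> + integral {ln y..ln w} (\<lambda>v. \<bar>k' v\<bar>))"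
    using abel_mertens by meson
  have "\<bar>(\<Sum>p\<in>primes_between y (x / 2). ln (x / real p) powr \<beta> / real p) - integral {ln y..ln (x / 2)} (\<lambda>v. (ln x - v) powr \<beta> / v)\<bar>
     \<le> (3 * C) * (ln 2 powr \<beta> + ln (x / y) powr \<beta>) / ln y"
    if y: "2 \<le> y" "y \<le> x / 2" for x y \<beta>
  proof -
    define X Y V where "X = ln x" and "Y = ln y" and "V = ln (x / 2)"
    have x: "x \<ge> 4" using y by simp
    have V: "V = X - ln 2" unfolding V_def X_def using x by (simp add: ln_div)
    have YV: "Y \<le> V" unfolding Y_def V_def using y by (intro ln_mono) auto
    have Y: "Y > 0" unfolding Y_def using y by simp
    have XY: "ln (x / y) = X - Y" unfolding X_def Y_def using x y by (simp add: ln_div)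
    define H where "H = ln 2 powr \<beta> + (X - Y) powr \<beta>"
    have l2: "ln 2 > (0::real)" by simp
    have Xv: "ln 2 \<le> X - v" "X - v \<le> X - Y" "v > 0" "v \<ge> Y" if "v \<in> {Y..V}" for v
      using that V Y by auto
    have hH: "(X - v) powr \<beta> \<le> H" if "v \<in> {Y..V}" for v
      unfolding H_def by (rule powr_between_le[OF l2]) (use Xv[OF that] in auto)
    define k where "k = (\<lambda>v. (X - v) powr \<beta> / v)"
    define k' where "k' = (\<lambda>v. - \<beta> * (X - v) powr (\<beta> - 1) / v - (X - v) powr \<beta> / v\<^sup>2)"
    have dk: "\<forall>v\<in>{Y..V}. (k has_real_derivative k' v) (at v within {Y..V})"
    proof
      fix v assume v: "v \<in> {Y..V}"
      have "X - v > 0" using Xv(1)[OF v] l2 by linarith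
      then have "(k has_real_derivative (\<beta> * (X - v) powr (\<beta> - 1) * (0 - 1) * v - (X - v) powr \<beta> * 1) / (v * v)) (at v within {Y..V})"
        unfolding k_def using Xv(3)[OF v] by (auto intro!: derivative_eq_intros)
      moreover have "(\<beta> * (X - v) powr (\<beta> - 1) * (0 - 1) * v - (X - v) powr \<beta> * 1) / (v * v) = k' v"
        using Xv(3)[OF v] by (simp add: k'_def field_simps power2_eq_square)
      ultimately show "(k has_real_derivative k' v) (at v within {Y..V})" by simp
    qed
    have nz: "X - v \<noteq> 0" "v \<noteq> 0" if "v \<in> {Y..V}" for v using Xv[OF that] l2 by auto
    have ck': "continuous_on {Y..V} k'"
      unfolding k'_def using nz by (intro continuous_intros) auto
    have "(\<Sum>p\<in>primes_between y (x / 2). ln (real p) / real p * k (ln (real p))) = (\<Sum>p\<in>primes_between y (x / 2). ln (x / real p) powr \<beta> / real p)"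
    proof (rule sum.cong[OF refl])
      fix p assume p: "p \<in> primes_between y (x / 2)"
      then have "real p > 1" using y by (auto simp: primes_between_def)
      moreover from this have "ln (x / real p) = X - ln (real p)" unfolding X_def using x by (simp add: ln_div)
      ultimately show "ln (real p) / real p * k (ln (real p)) = ln (x / real p) powr \<beta> / real p"
        by (simp add: k_def)
    qed
    then have b: "\<bar>(\<Sum>p\<in>primes_between y (x / 2). ln (x / real p) powr \<beta> / real p) - integral {Y..V} k\<bar> \<le> C * (\<bar>k V\<bar> + integral {Y..V} (\<lambda>v. \<bar>k' v\<bar>))"
      using C(2)[OF y, of k k'] dk ck' unfolding Y_def V_def by simp
    have kV: "\<bar>k V\<bar> \<le> H / Y"
    proof -
      have "H \<ge> 0" by (simp add: H_def)
      then show ?thesis unfolding k_def abs_divide using hH[of V] YV Y by (intro frac_le) auto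
    qed
    \<comment> \<open>The absolute value of the derivative of the monotone function (X-v)^\<beta>
      integrates to the difference of the end values, with the sign of \<beta> but without a factor
      \<beta>.\<close>
    have sg: "((\<lambda>v. \<bar>\<beta>\<bar> * (X - v) powr (\<beta> - 1)) has_integral (- sgn \<beta> * (X - V) powr \<beta> - (- sgn \<beta> * (X - Y) powr \<beta>))) {Y..V}"
    proof (rule fundamental_theorem_of_calculus[OF YV])
      fix v assume v: "v \<in> {Y..V}"
      have pos: "X - v > 0" using Xv(1)[OF v] l2 by linarith
      have "((\<lambda>v. - sgn \<beta> * (X - v) powr \<beta>) has_real_derivative - sgn \<beta> * (\<beta> * (X - v) powr (\<beta> - 1) * (0 - 1))) (at v within {Y..V})"
        using pos by (auto intro!: derivative_eq_intros)
      moreover have "- sgn \<beta> * (\<beta> * (X - v) powr (\<beta> - 1) * (0 - 1)) = \<bar>\<beta>\<bar> * (X - v) powr (\<beta> - 1)"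
        by (simp add: abs_sgn mult_ac)
      ultimately show "((\<lambda>v. - sgn \<beta> * (X - v) powr \<beta>) has_vector_derivative \<bar>\<beta>\<bar> * (X - v) powr (\<beta> - 1)) (at v within {Y..V})"
        by (simp only: has_real_derivative_iff_has_vector_derivative)
    qed
    have iv: "((\<lambda>v. 1 / v\<^sup>2) has_integral (- 1 / V - (- 1 / Y))) {Y..V}"
    proof (rule fundamental_theorem_of_calculus[OF YV])
      fix v assume v: "v \<in> {Y..V}"
      have "((\<lambda>v. - 1 / v) has_real_derivative 1 / v\<^sup>2) (at v within {Y..V})"
        using Xv(3)[OF v] by (auto intro!: derivative_eq_intros simp: power2_eq_square)
      then show "((\<lambda>v. - 1 / v) has_vector_derivative 1 / v\<^sup>2) (at v within {Y..V})"
        by (simp add: has_real_derivative_iff_has_vector_derivative)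
    qed
    have g: "((\<lambda>v. 1 / Y * (\<bar>\<beta>\<bar> * (X - v) powr (\<beta> - 1)) + H * (1 / v\<^sup>2)) has_integral
       (1 / Y * (- sgn \<beta> * (X - V) powr \<beta> - (- sgn \<beta> * (X - Y) powr \<beta>)) + H * (- 1 / V - (- 1 / Y)))) {Y..V}"
      by (intro has_integral_add has_integral_mult_right sg iv)
    have "integral {Y..V} (\<lambda>v. \<bar>k' v\<bar>) \<le> integral {Y..V} (\<lambda>v. 1 / Y * (\<bar>\<beta>\<bar> * (X - v) powr (\<beta> - 1)) + H * (1 / v\<^sup>2))"
    proof (rule integral_le)
      show "(\<lambda>v. \<bar>k' v\<bar>) integrable_on {Y..V}" by (intro integrable_continuous_real continuous_intros ck')
      show "(\<lambda>v. 1 / Y * (\<bar>\<beta>\<bar> * (X - v) powr (\<beta> - 1)) + H * (1 / v\<^sup>2)) integrable_on {Y..V}" using g by (rule has_integral_integrable)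
      fix v assume v: "v \<in> {Y..V}"
      have "\<bar>k' v\<bar> \<le> \<bar>- \<beta> * (X - v) powr (\<beta> - 1) / v\<bar> + \<bar>(X - v) powr \<beta> / v\<^sup>2\<bar>" unfolding k'_def by (rule abs_triangle_ineq4)
      also have "\<bar>- \<beta> * (X - v) powr (\<beta> - 1) / v\<bar> \<le> 1 / Y * (\<bar>\<beta>\<bar> * (X - v) powr (\<beta> - 1))"
        using Xv[OF v] Y by (simp add: abs_mult) (intro divide_left_mono, auto)
      also have "\<bar>(X - v) powr \<beta> / v\<^sup>2\<bar> \<le> H * (1 / v\<^sup>2)"
        using hH[OF v] by (simp add: divide_right_mono)
      finally show "\<bar>k' v\<bar> \<le> 1 / Y * (\<bar>\<beta>\<bar> * (X - v) powr (\<beta> - 1)) + H * (1 / v\<^sup>2)" by simp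
    qed
    also have "\<dots> = 1 / Y * (sgn \<beta> * ((X - Y) powr \<beta> - (X - V) powr \<beta>)) + H * (1 / Y - 1 / V)"
      unfolding integral_unique[OF g] by (simp add: algebra_simps)
    also have "\<dots> \<le> 1 / Y * H + H * (1 / Y)"
    proof (intro add_mono mult_left_mono)
      have p: "(X - V) powr \<beta> \<ge> 0" "(X - Y) powr \<beta> \<ge> 0" "(X - V) powr \<beta> = ln 2 powr \<beta>" by (simp_all add: V)
      then show "sgn \<beta> * ((X - Y) powr \<beta> - (X - V) powr \<beta>) \<le> H"
        unfolding H_def by (cases "\<beta> > 0"; cases "\<beta> = 0") (auto simp: sgn_if)
      show "1 / Y - 1 / V \<le> 1 / Y" using Y YV by simp
      show "0 \<le> H" by (simp add: H_def)
    qed (use Y in auto)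
    finally have "integral {Y..V} (\<lambda>v. \<bar>k' v\<bar>) \<le> 2 * (H / Y)" by simp
    with kV have "\<bar>k V\<bar> + integral {Y..V} (\<lambda>v. \<bar>k' v\<bar>) \<le> 3 * (H / Y)" by linarith
    then have "C * (\<bar>k V\<bar> + integral {Y..V} (\<lambda>v. \<bar>k' v\<bar>)) \<le> C * (3 * (H / Y))" using C by (intro mult_left_mono) auto
    with b have "\<bar>(\<Sum>p\<in>primes_between y (x / 2). ln (x / real p) powr \<beta> / real p) - integral {Y..V} k\<bar> \<le> C * (3 * (H / Y))" by linarith
    moreover have "C * (3 * (H / Y)) = (3 * C) * H / Y" by simp
    ultimately show ?thesis unfolding XY unfolding k_def X_def Y_def V_def H_def by (simp only:)
  qed
  moreover have "3 * C > 0" using C by simp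
  ultimately show ?thesis by blast
qed

section \<open>The integral in the main term\<close>

definition m_integrand :: "real \<Rightarrow> real \<Rightarrow> real" where
  "m_integrand r u = 1 / (u powr r * (u - 1) powr (1 - r))"

lemma m_integrand_eq: "m_integrand r u = u powr (- r) * (u - 1) powr (r - 1)"
  using powr_minus_divide[of "u - 1" "1 - r"] by (simp add: m_integrand_def powr_minus_divide)

text \<open>Comparison with (u-1)^(r-1), which is integrable at 1 for every r > 0. The price is a
  factor 1/r, to be cancelled by the leading coefficient.\<close>

lemma m_integrand_near_1:
  assumes r: "r > 0" and b: "b \<ge> 1"
  shows "m_integrand r integrable_on {1..b}" "0 \<le> integral {1..b} (m_integrand r)"
    "integral {1..b} (m_integrand r) \<le> (b - 1) powr r / r"
proof -
  \<comment> \<open>The antiderivative (u-1)^r/r is continuous at 1, but in general differentiable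
    only in the interior.\<close>
  have g: "((\<lambda>u. (u - 1) powr (r - 1)) has_integral ((b - 1) powr r / r - (1 - 1) powr r / r)) {1..b}"
  proof (rule fundamental_theorem_of_calculus_interior[OF b])
    show "continuous_on {1..b} (\<lambda>u. (u - 1) powr r / r)"
      using r by (intro continuous_intros continuous_on_powr') auto
    fix u assume u: "u \<in> {1<..<b}"
    then have "((\<lambda>u. (u - 1) powr r / r) has_real_derivative (r * (u - 1) powr (r - 1) * (1 - 0)) / r) (at u)"
      by (auto intro!: derivative_eq_intros)
    then show "((\<lambda>u. (u - 1) powr r / r) has_vector_derivative (u - 1) powr (r - 1)) (at u)"
      using r by (simp add: has_real_derivative_iff_has_vector_derivative)
  qed
  have le: "0 \<le> m_integrand r u \<and> m_integrand r u \<le> (u - 1) powr (r - 1)" if "u \<in> {1..b}" for u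
  \<comment> \<open>At u = 1 both sides are 0, since \<open>0 powr a = 0\<close> and division by
    zero gives 0.\<close>
  proof (cases "u = 1")
    case False
    then have u: "u > 1" using that by auto
    have "u powr (- r) \<le> u powr 0" using u r by (intro powr_mono) auto
    then have "u powr (- r) * (u - 1) powr (r - 1) \<le> 1 * (u - 1) powr (r - 1)" using u by (intro mult_right_mono) auto
    then show ?thesis using u by (simp add: m_integrand_eq)
  qed (auto simp: m_integrand_def)
  have "m_integrand r \<in> borel_measurable borel" unfolding m_integrand_def by measurable
  then have "m_integrand r \<in> borel_measurable (lebesgue_on {1..b})"
    by (intro measurable_restrict_space1 measurable_completion) simp
  then show i: "m_integrand r integrable_on {1..b}"
    by (rule measurable_bounded_by_integrable_imp_integrable[OF _ has_integral_integrable[OF g]]) (use le in auto)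
  show "0 \<le> integral {1..b} (m_integrand r)" by (rule integral_nonneg[OF i]) (use le in auto)
  have "integral {1..b} (m_integrand r) \<le> integral {1..b} (\<lambda>u. (u - 1) powr (r - 1))"
    by (rule integral_le[OF i has_integral_integrable[OF g]]) (use le in auto)
  also have "\<dots> = (b - 1) powr r / r" using integral_unique[OF g] by simp
  finally show "integral {1..b} (m_integrand r) \<le> (b - 1) powr r / r" .
qed

text \<open>The substitution \<open>v = X / u\<close>.\<close>

lemma m_integrand_substitution:
  assumes Y: "0 < Y" "Y \<le> V" "V < X"
  shows "integral {X / V..X / Y} (m_integrand r) = X powr (1 - r) * integral {Y..V} (\<lambda>v. (X - v) powr (r - 1) / v)"
proof -
  define \<phi> where "\<phi> = (\<lambda>v. (X - v) powr (r - 1) / v)"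
  have V: "V > 0" and X: "X > 0" using Y by linarith+
  have ab: "X / V \<le> X / Y" using Y V X by (intro divide_left_mono) auto
  have one: "X / V > 1" using V Y by simp
  have "((\<lambda>u. (- X / u\<^sup>2) *\<^sub>R \<phi> (X / u)) has_integral (integral {X / (X / V)..X / (X / Y)} \<phi> - integral {X / (X / Y)..X / (X / V)} \<phi>)) {X / V..X / Y}"
  proof (rule has_integral_substitution_general[where s = "{}" and c = Y and d = V])
    show "(\<lambda>u. X / u) ` {X / V..X / Y} \<subseteq> {Y..V}"
    proof safe
      fix u assume u: "u \<in> {X / V..X / Y}"
      then have "u > 0" using one by auto
      then show "X / u \<in> {Y..V}" using u Y V by (simp add: field_simps)
    qed
    show "continuous_on {Y..V} \<phi>" unfolding \<phi>_def using Y by (intro continuous_intros) auto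
    show "continuous_on {X / V..X / Y} (\<lambda>u. X / u)" using one by (intro continuous_intros) auto
    show "((\<lambda>u. X / u) has_field_derivative - X / u\<^sup>2) (at u within {X / V..X / Y})" if "u \<in> {X / V..X / Y} - {}" for u
      using that one by (auto intro!: derivative_eq_intros simp: power2_eq_square)
  qed (use ab in auto)
  moreover have "X / (X / V) = V" "X / (X / Y) = Y" using X by simp_all
  ultimately have 1: "((\<lambda>u. (- X / u\<^sup>2) *\<^sub>R \<phi> (X / u)) has_integral (integral {V..Y} \<phi> - integral {Y..V} \<phi>)) {X / V..X / Y}" by simp
  \<comment> \<open>The substitution X/u is decreasing, so the rule returns a difference of two
    integrals; the one over the reversed interval is empty or a point, and the minus sign is undone
    by the factor applied next.\<close>
  have "integral {V..Y} \<phi> = 0" using Y(2) by (cases "V = Y") auto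
  with 1 have 2: "((\<lambda>u. (- X / u\<^sup>2) *\<^sub>R \<phi> (X / u)) has_integral (- integral {Y..V} \<phi>)) {X / V..X / Y}" by simp
  from has_integral_mult_right[OF 2, of "- (X powr (1 - r))"]
  have "((\<lambda>u. - (X powr (1 - r)) * ((- X / u\<^sup>2) *\<^sub>R \<phi> (X / u))) has_integral (X powr (1 - r) * integral {Y..V} \<phi>)) {X / V..X / Y}" by simp
  then have "(m_integrand r has_integral (X powr (1 - r) * integral {Y..V} \<phi>)) {X / V..X / Y}"
  proof (rule has_integral_eq[rotated])
    fix u assume "u \<in> {X / V..X / Y}"
    then have u: "u > 1" using one by auto
    have "X - X / u = X * ((u - 1) * (1 / u))" using u by (simp add: field_simps)
    then have "(X - X / u) powr (r - 1) = X powr (r - 1) * ((u - 1) powr (r - 1) * (1 / u) powr (r - 1))"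
      by (simp only: powr_mult)
    also have "(1 / u) powr (r - 1) = u powr (1 - r)" using u by (simp add: powr_divide powr_minus_divide[symmetric])
    finally have e: "(X - X / u) powr (r - 1) = X powr (r - 1) * ((u - 1) powr (r - 1) * u powr (1 - r))" .
    have xx: "X powr (1 - r) * X powr (r - 1) = 1" using X by (simp flip: powr_add)
    have uu: "u powr (1 - r) / u = u powr (- r)"
    proof -
      have "u powr (1 - r) / u powr 1 = u powr (- r)" by (subst powr_diff[symmetric]) simp
      then show ?thesis using u by simp
    qed
    have "- (X powr (1 - r)) * ((- X / u\<^sup>2) *\<^sub>R \<phi> (X / u)) = X powr (1 - r) * (X / u\<^sup>2) * ((X - X / u) powr (r - 1) * (u / X))"
      by (simp add: \<phi>_def)
    also have "\<dots> = (X powr (1 - r) * X powr (r - 1)) * ((u - 1) powr (r - 1) * (u powr (1 - r) / u))"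
      unfolding e using X u by (simp add: power2_eq_square)
    also have "\<dots> = m_integrand r u" unfolding xx uu m_integrand_eq by simp
    finally show "- (X powr (1 - r)) * ((- X / u\<^sup>2) *\<^sub>R \<phi> (X / u)) = m_integrand r u" .
  qed
  then show ?thesis by (simp add: integral_unique \<phi>_def)
qed

text \<open>The prime sum ends at V = ln(x/2), whereas the integral in m_r extends to u = 1, that is
  v = X. The piece over [1, X/V] makes up the difference and is bounded by
  \<open>m_integrand_near_1\<close>.\<close>

lemma m_integral_approx:
  assumes r: "r > 0" and Y: "0 < Y" "Y \<le> V" "V < X"
  shows "\<bar>X powr (r - 1) * integral {1..X / Y} (m_integrand r) - integral {Y..V} (\<lambda>v. (X - v) powr (r - 1) / v)\<bar>
    \<le> X powr (r - 1) * ((X / V - 1) powr r / r)"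
proof -
  have V: "V > 0" and X: "X > 0" using Y by linarith+
  have one: "1 \<le> X / V" using V Y by simp
  have "X / V \<le> X / Y" using Y V X by (intro divide_left_mono) auto
  then have eq: "integral {1..X / Y} (m_integrand r) = integral {1..X / V} (m_integrand r) + integral {X / V..X / Y} (m_integrand r)"
    using one Henstock_Kurzweil_Integration.integral_combine[OF one _ m_integrand_near_1(1)[OF r, of "X / Y"]] by simp
  have "X powr (r - 1) * X powr (1 - r) = 1" using X by (simp flip: powr_add)
  then have "X powr (r - 1) * integral {1..X / Y} (m_integrand r) - integral {Y..V} (\<lambda>v. (X - v) powr (r - 1) / v)
      = X powr (r - 1) * integral {1..X / V} (m_integrand r)"
    unfolding eq m_integrand_substitution[OF Y] distrib_left mult.assoc[symmetric] by simp
  then show ?thesis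
    using m_integrand_near_1[OF r one] by (simp add: mult_left_mono abs_mult del: times_divide_eq_right)
qed

text \<open>Keeping the factor |\<beta>+1| on the left avoids the logarithm at \<beta> = -1. For
  \<beta> = r - 2 it is |1-r|, exactly the factor that the Buchstab identity places before the sum
  over primes.\<close>

lemma powr_integral_over_le:
  fixes X Y V \<beta> :: real
  assumes Y: "0 < Y" "Y \<le> V" "V < X"
  shows "\<bar>\<beta> + 1\<bar> * integral {Y..V} (\<lambda>v. (X - v) powr \<beta> / v) \<le> ((X - V) powr (\<beta> + 1) + (X - Y) powr (\<beta> + 1)) / Y"
proof -
  have sg: "((\<lambda>v. \<bar>\<beta> + 1\<bar> * (X - v) powr \<beta>) has_integral (- sgn (\<beta> + 1) * (X - V) powr (\<beta> + 1) - (- sgn (\<beta> + 1) * (X - Y) powr (\<beta> + 1)))) {Y..V}"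
  proof (rule fundamental_theorem_of_calculus[OF Y(2)])
    fix v assume v: "v \<in> {Y..V}"
    have pos: "X - v > 0" using v Y by auto
    have "((\<lambda>v. - sgn (\<beta> + 1) * (X - v) powr (\<beta> + 1)) has_real_derivative - sgn (\<beta> + 1) * ((\<beta> + 1) * (X - v) powr (\<beta> + 1 - 1) * (0 - 1))) (at v within {Y..V})"
      using pos by (auto intro!: derivative_eq_intros)
    moreover have "- sgn (\<beta> + 1) * ((\<beta> + 1) * (X - v) powr (\<beta> + 1 - 1) * (0 - 1)) = \<bar>\<beta> + 1\<bar> * (X - v) powr \<beta>"
      by (simp add: abs_sgn mult_ac)
    ultimately show "((\<lambda>v. - sgn (\<beta> + 1) * (X - v) powr (\<beta> + 1)) has_vector_derivative \<bar>\<beta> + 1\<bar> * (X - v) powr \<beta>) (at v within {Y..V})"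
      by (simp only: has_real_derivative_iff_has_vector_derivative)
  qed
  have "\<bar>\<beta> + 1\<bar> * integral {Y..V} (\<lambda>v. (X - v) powr \<beta> / v) = integral {Y..V} (\<lambda>v. \<bar>\<beta> + 1\<bar> * ((X - v) powr \<beta> / v))"
    by (simp only: integral_mult_right)
  also have "\<dots> \<le> integral {Y..V} (\<lambda>v. 1 / Y * (\<bar>\<beta> + 1\<bar> * (X - v) powr \<beta>))"
  proof (rule integral_le)
    show "(\<lambda>v. \<bar>\<beta> + 1\<bar> * ((X - v) powr \<beta> / v)) integrable_on {Y..V}"
      using Y by (intro integrable_continuous_real continuous_intros) auto
    show "(\<lambda>v. 1 / Y * (\<bar>\<beta> + 1\<bar> * (X - v) powr \<beta>)) integrable_on {Y..V}"
      using Y by (intro integrable_continuous_real continuous_intros) auto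
    fix v assume v: "v \<in> {Y..V}"
    have "(X - v) powr \<beta> / v \<le> (X - v) powr \<beta> / Y" using v Y by (intro divide_left_mono) auto
    then have "\<bar>\<beta> + 1\<bar> * ((X - v) powr \<beta> / v) \<le> \<bar>\<beta> + 1\<bar> * ((X - v) powr \<beta> / Y)" by (intro mult_left_mono) auto
    then show "\<bar>\<beta> + 1\<bar> * ((X - v) powr \<beta> / v) \<le> 1 / Y * (\<bar>\<beta> + 1\<bar> * (X - v) powr \<beta>)" by simp
  qed
  also have "\<dots> = 1 / Y * (sgn (\<beta> + 1) * ((X - Y) powr (\<beta> + 1) - (X - V) powr (\<beta> + 1)))"
    unfolding integral_unique[OF has_integral_mult_right[OF sg, of "1 / Y"]] by (simp add: algebra_simps)
  also have "\<dots> \<le> 1 / Y * ((X - V) powr (\<beta> + 1) + (X - Y) powr (\<beta> + 1))"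
  proof (rule mult_left_mono)
    have p: "(X - V) powr (\<beta> + 1) \<ge> 0" "(X - Y) powr (\<beta> + 1) \<ge> 0" by simp_all
    then show "sgn (\<beta> + 1) * ((X - Y) powr (\<beta> + 1) - (X - V) powr (\<beta> + 1)) \<le> (X - V) powr (\<beta> + 1) + (X - Y) powr (\<beta> + 1)"
      by (auto simp: sgn_if)
  qed (use Y in auto)
  finally show ?thesis by simp
qed

section \<open>Large prime factors\<close>

lemma omega_below_eq:
  assumes n: "n > 0"
  shows "omega_below y n = card {p \<in> prime_factors n. real p < y}"
  using n unfolding omega_below_def by (intro arg_cong[where f = card]) (auto simp: prime_factors_dvd)

lemma omega_split:
  assumes n: "n > 0" "real n \<le> x"
  shows "omega n = omega_below y n + card {p \<in> primes_between y x. p dvd n}"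
proof -
  have le: "real p \<le> x" if "p dvd n" for p using that n dvd_imp_le[OF that n(1)] by linarith
  have "prime_factors n = {p \<in> prime_factors n. real p < y} \<union> {p \<in> primes_between y x. p dvd n}"
    using n le by (auto simp: prime_factors_dvd primes_between_def)
  then have "omega n = card ({p \<in> prime_factors n. real p < y} \<union> {p \<in> primes_between y x. p dvd n})"
    unfolding omega_def by simp
  also have "\<dots> = card {p \<in> prime_factors n. real p < y} + card {p \<in> primes_between y x. p dvd n}"
    by (rule card_Un_disjoint) (auto simp: primes_between_def intro: finite_subset[OF _ finite_primes_between[of y x]])
  finally show ?thesis by (simp add: omega_below_eq n)
qed

text \<open>Two distinct primes that are at least y have a product strictly above y^2, even if the
  smaller one equals y.\<close>

lemma at_most_one_large_prime:
  assumes n: "n > 0" "real n \<le> x" and y: "0 < y" "x \<le> y\<^sup>2"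
  shows "card {p \<in> primes_between y x. p dvd n} \<le> 1"
proof -
  have aux: False if "p \<in> primes_between y x" "q \<in> primes_between y x" "p dvd n" "q dvd n" "p < q" for p q
  proof -
    have "coprime p q" using that by (intro primes_coprime) (auto simp: primes_between_def)
    then have "p * q dvd n" using that by (intro divides_mult) auto
    then have "p * q \<le> n" using n by (intro dvd_imp_le) auto
    then have "real (p * q) \<le> x" using n(2) by linarith
    moreover have "y * y < real p * real q"
      using that y by (intro mult_le_less_imp_less) (auto simp: primes_between_def)
    ultimately show False using y by (simp add: power2_eq_square)
  qed
  have "p = q" if "p \<in> {p \<in> primes_between y x. p dvd n}" "q \<in> {p \<in> primes_between y x. p dvd n}" for p q
    using aux[of p q] aux[of q p] that by (cases p q rule: linorder_cases) auto
  then show ?thesis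
    using card_le_Suc0_iff_eq[of "{p \<in> primes_between y x. p dvd n}"] by simp
qed

lemma omega_below_prime_mult:
  assumes "prime p" "y \<le> real p" "m > 0"
  shows "omega_below y (p * m) = omega_below y m"
proof -
  have "{q. prime q \<and> real q < y \<and> q dvd p * m} = {q. prime q \<and> real q < y \<and> q dvd m}"
  proof -
    have "q dvd m" if "prime q" "real q < y" "q dvd p * m" for q
    proof -
      have "\<not> q dvd p" using primes_dvd_imp_eq[OF that(1) assms(1)] that assms by auto
      then show ?thesis using that by (simp add: prime_dvd_mult_iff)
    qed
    then show ?thesis by auto
  qed
  then show ?thesis by (simp add: omega_below_def)
qed

text \<open>Because \<open>x \<le> y\<^sup>2\<close>, every \<open>n \<le> x\<close> has at most one prime factor \<open>p \<ge> y\<close>; writing \<open>n = p m\<close>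
  for these \<open>n\<close> gives an identity of Buchstab type.\<close>

lemma S_sum_decomposition:
  assumes y: "0 < y" "x \<le> y\<^sup>2"
  shows "S_sum r x y = omega_sum r x + (1 - r) * (\<Sum>p\<in>primes_between y x. S_sum r (x / real p) y)"
proof -
  let ?N = "{n::nat. 1 \<le> n \<and> real n \<le> x}" and ?P = "primes_between y x"
  \<comment> \<open>If n has k large prime factors, then r^omega = r^k r^omega_y, and for k = 0 or 1
    one has r^k = 1 - (1-r) k.\<close>
  have "r ^ omega_below y n = r ^ omega n + (1 - r) * (\<Sum>p\<in>?P. if p dvd n then r ^ omega_below y n else 0)" if n: "n \<in> ?N" for n
  proof -
    have n': "n > 0" "real n \<le> x" using n by auto
    have c: "(\<Sum>p\<in>?P. if p dvd n then r ^ omega_below y n else 0) = real (card {p \<in> ?P. p dvd n}) * r ^ omega_below y n"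
      by (subst sum.inter_filter[symmetric]) auto
    consider "card {p \<in> ?P. p dvd n} = 0" | "card {p \<in> ?P. p dvd n} = 1"
      using at_most_one_large_prime[OF n' y] by linarith
    then show ?thesis
    proof cases
      case 1
      then show ?thesis unfolding c omega_split[OF n', of y] 1 by simp
    next
      case 2
      then show ?thesis unfolding c omega_split[OF n', of y] 2 by (simp add: algebra_simps)
    qed
  qed
  then have "S_sum r x y = (\<Sum>n\<in>?N. r ^ omega n + (1 - r) * (\<Sum>p\<in>?P. if p dvd n then r ^ omega_below y n else 0))"
    unfolding S_sum_def by (intro sum.cong) auto
  also have "\<dots> = omega_sum r x + (1 - r) * (\<Sum>n\<in>?N. \<Sum>p\<in>?P. if p dvd n then r ^ omega_below y n else 0)"
    by (simp add: sum.distrib sum_distrib_left omega_sum_def)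
  also have "(\<Sum>n\<in>?N. \<Sum>p\<in>?P. if p dvd n then r ^ omega_below y n else 0) = (\<Sum>p\<in>?P. \<Sum>n\<in>?N. if p dvd n then r ^ omega_below y n else 0)"
    by (rule sum.swap)
  also have "\<dots> = (\<Sum>p\<in>?P. S_sum r (x / real p) y)"
  proof (rule sum.cong[OF refl])
    fix p assume "p \<in> ?P"
    then have p: "prime p" "y \<le> real p" "p > 0" using prime_gt_0_nat by (auto simp: primes_between_def)
    have img: "{n\<in>?N. p dvd n} = (\<lambda>m. p * m) ` {m::nat. 1 \<le> m \<and> real m \<le> x / real p}"
    proof (intro equalityI subsetI)
      fix n assume "n \<in> {n\<in>?N. p dvd n}"
      then obtain m where m: "n = p * m" "1 \<le> n" "real n \<le> x" by auto
      then have "1 \<le> m" by (cases m) auto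
      moreover have "real m \<le> x / real p" using m p by (simp add: field_simps)
      ultimately show "n \<in> (\<lambda>m. p * m) ` {m::nat. 1 \<le> m \<and> real m \<le> x / real p}" using m(1) by blast
    next
      fix n assume "n \<in> (\<lambda>m. p * m) ` {m::nat. 1 \<le> m \<and> real m \<le> x / real p}"
      then obtain m where m: "n = p * m" "1 \<le> m" "real m \<le> x / real p" by blast
      then have "real n \<le> x" using p by (simp add: field_simps)
      then show "n \<in> {n\<in>?N. p dvd n}" using m p by simp
    qed
    have "(\<Sum>n\<in>?N. if p dvd n then r ^ omega_below y n else 0) = (\<Sum>n\<in>{n\<in>?N. p dvd n}. r ^ omega_below y n)"
      by (rule sum.inter_filter[OF finite_nat_le, symmetric])
    also have "\<dots> = (\<Sum>m\<in>{m::nat. 1 \<le> m \<and> real m \<le> x / real p}. r ^ omega_below y (p * m))"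
      unfolding img using p by (subst sum.reindex) (auto simp: inj_on_def)
    also have "\<dots> = S_sum r (x / real p) y"
      unfolding S_sum_def using p by (intro sum.cong refl) (simp add: omega_below_prime_mult)
    finally show "(\<Sum>n\<in>?N. if p dvd n then r ^ omega_below y n else 0) = S_sum r (x / real p) y" .
  qed
  finally show ?thesis .
qed

text \<open>For \<open>z \<le> y\<close> the sums with \<open>\<omega>\<^sub>y\<close> and \<open>\<omega>\<close> differ at most in the term \<open>n = y = z\<close>.\<close>

lemma S_sum_small:
  assumes z: "z \<le> y" and r: "0 \<le> r"
  shows "\<bar>S_sum r z y - omega_sum r z\<bar> \<le> (if z = y then 1 + r else 0)"
proof -
  let ?N = "{n::nat. 1 \<le> n \<and> real n \<le> z}"
  have eq: "omega_below y n = omega n" if n: "n \<in> ?N" "real n < y" for n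
  proof -
    have "real p < y" if "p \<in> prime_factors n" for p
    proof -
      have "p \<le> n" using that n by (intro dvd_imp_le) (auto simp: prime_factors_dvd)
      then show ?thesis using n by linarith
    qed
    then have "{p \<in> prime_factors n. real p < y} = prime_factors n" by auto
    then show ?thesis using n by (simp add: omega_below_eq omega_def)
  qed
  have d: "S_sum r z y - omega_sum r z = (\<Sum>n\<in>?N. r ^ omega_below y n - r ^ omega n)"
    by (simp add: S_sum_def omega_sum_def sum_subtractf)
  show ?thesis
  proof (cases "\<exists>q\<in>?N. real q = y")
    case False
    then have "real n < y" if "n \<in> ?N" for n using that z by force
    then have "(\<Sum>n\<in>?N. r ^ omega_below y n - r ^ omega n) = 0" using eq by (intro sum.neutral) auto
    then show ?thesis using d r by simp
  next
    case True
    then obtain q where q: "q \<in> ?N" "real q = y" by blast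
    then have zy: "z = y" using z by auto
    have "(\<Sum>n\<in>?N. r ^ omega_below y n - r ^ omega n) = (\<Sum>n\<in>{q}. r ^ omega_below y n - r ^ omega n)"
    proof (rule sum.mono_neutral_right)
      show "\<forall>n\<in>?N - {q}. r ^ omega_below y n - r ^ omega n = 0"
      proof
        fix n assume n: "n \<in> ?N - {q}"
        then have "real n < y" using zy q by (auto simp: less_le)
        then show "r ^ omega_below y n - r ^ omega n = 0" using eq n by simp
      qed
    next
      show "finite ?N" by (rule finite_nat_le)
    qed (use q in auto)
    \<comment> \<open>If q = y is prime, then omega counts q and \<open>omega_below y\<close> does
      not, a difference of |1-r|; if q is not prime, the two counts agree.\<close>
    moreover have "\<bar>r ^ omega_below y q - r ^ omega q\<bar> \<le> 1 + r"
    proof (cases "prime q")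
      case True
      then have "{p \<in> prime_factors q. real p < y} = {}" using q by (auto simp: prime_prime_factors)
      then have "omega_below y q = 0" using q by (simp add: omega_below_eq)
      moreover have "omega q = 1" using True by (simp add: omega_def prime_prime_factors)
      ultimately show ?thesis using r by simp
    next
      case False
      have "real p < y" if "p \<in> prime_factors q" for p
      proof -
        have "p \<le> q" "p \<noteq> q" using that q False by (auto intro!: dvd_imp_le simp: prime_factors_dvd)
        then show ?thesis using q by linarith
      qed
      then have "{p \<in> prime_factors q. real p < y} = prime_factors q" by auto
      then show ?thesis using q r by (simp add: omega_below_eq omega_def)
    qed
    ultimately show ?thesis using d zy by simp
  qed
qed

text \<open>For p \<ge> y \<ge> sqrt x one has x/p \<le> y, so in the inner sums
  \<open>omega_below\<close> may be replaced by \<open>omega\<close>. Equality x/p = y forces p = y,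
  hence at most one p contributes a discrepancy, of size at most 1 + R; the prefactor 1 - r gives
  the square.\<close>

lemma S_sum_approx:
  assumes x: "x \<ge> 4" and y: "sqrt x \<le> y" "y \<le> x" and r: "0 \<le> r" "r \<le> R"
  shows "\<bar>S_sum r x y - (omega_sum r x + (1 - r) * (\<Sum>p\<in>primes_between y x. omega_sum r (x / real p)))\<bar> \<le> (1 + R)\<^sup>2"
proof -
  have y0: "0 < y" using x y(1) real_sqrt_gt_zero[of x] by linarith
  have xy2: "x \<le> y\<^sup>2" using power_mono[OF y(1), of 2] x by simp
  let ?P = "primes_between y x"
  have 1: "\<bar>S_sum r (x / real p) y - omega_sum r (x / real p)\<bar> \<le> (if real p = y then 1 + r else 0)" if p: "p \<in> ?P" for p
  proof -
    have py: "y \<le> real p" using p by (simp add: primes_between_def)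
    have "y * y \<le> y * real p" using py y0 by (intro mult_left_mono) auto
    then have "x \<le> y * real p" using xy2 by (simp add: power2_eq_square)
    then have le: "x / real p \<le> y" using py y0 by (simp add: divide_le_eq)
    have "real p = y" if "x / real p = y"
    proof -
      have "y * real p \<le> y * y" using that xy2 py y0 by (simp add: field_simps power2_eq_square)
      then show ?thesis using py y0 by simp
    qed
    then show ?thesis using S_sum_small[OF le r(1)] r by (auto split: if_splits)
  qed
  have "\<bar>(\<Sum>p\<in>?P. S_sum r (x / real p) y) - (\<Sum>p\<in>?P. omega_sum r (x / real p))\<bar> \<le> (\<Sum>p\<in>?P. if real p = y then 1 + r else 0)"
    unfolding sum_subtractf[symmetric] by (rule order_trans[OF sum_abs sum_mono[OF 1]])
  also have "\<dots> = real (card {p\<in>?P. real p = y}) * (1 + r)"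
    by (subst sum.inter_filter[symmetric]) auto
  also have "\<dots> \<le> 1 * (1 + R)"
  proof (intro mult_mono)
    have "p = q" if "p \<in> {p\<in>?P. real p = y}" "q \<in> {p\<in>?P. real p = y}" for p q using that by auto
    then show "real (card {p\<in>?P. real p = y}) \<le> 1"
      using card_le_Suc0_iff_eq[of "{p\<in>?P. real p = y}"] by simp
  qed (use r in auto)
  finally have 2: "\<bar>(\<Sum>p\<in>?P. S_sum r (x / real p) y) - (\<Sum>p\<in>?P. omega_sum r (x / real p))\<bar> \<le> 1 + R" by simp
  have "S_sum r x y - (omega_sum r x + (1 - r) * (\<Sum>p\<in>?P. omega_sum r (x / real p)))
      = (1 - r) * ((\<Sum>p\<in>?P. S_sum r (x / real p) y) - (\<Sum>p\<in>?P. omega_sum r (x / real p)))"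
    unfolding S_sum_decomposition[OF y0 xy2] by (simp add: algebra_simps)
  also have "\<bar>\<dots>\<bar> \<le> (1 + R) * (1 + R)"
    unfolding abs_mult using 2 r by (intro mult_mono) auto
  finally show ?thesis by (simp add: power2_eq_square)
qed

section \<open>The main theorem\<close>

lemma omega_sum_lt_2:
  assumes "1 \<le> z" "z < 2"
  shows "omega_sum r z = 1"
proof -
  have "{n::nat. 1 \<le> n \<and> real n \<le> z} = {1}" using assms by auto
  then show ?thesis unfolding omega_sum_def by simp
qed

text \<open>For p > x/2 the inner sum is exactly 1, so these primes are merely counted. This is one
  source of the error x/log x.\<close>

lemma sum_omega_sum_large_primes:
  assumes x: "x \<ge> 4"
  shows "\<bar>(\<Sum>p\<in>primes_between y x. omega_sum r (x / real p)) - (\<Sum>p\<in>primes_between y (x / 2). omega_sum r (x / real p))\<bar> \<le> 8 * x / ln x"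
proof -
  let ?B = "{p \<in> primes_between y x. x / 2 < real p}"
  have "primes_between y x = primes_between y (x / 2) \<union> ?B"
    using x by (auto simp: primes_between_def)
  then have "(\<Sum>p\<in>primes_between y x. omega_sum r (x / real p)) = (\<Sum>p\<in>primes_between y (x / 2) \<union> ?B. omega_sum r (x / real p))"
    by simp
  also have "\<dots> = (\<Sum>p\<in>primes_between y (x / 2). omega_sum r (x / real p)) + (\<Sum>p\<in>?B. omega_sum r (x / real p))"
    by (rule sum.union_disjoint) (auto simp: primes_between_def intro: finite_subset[OF _ finite_primes_between[of y x]])
  also have "(\<Sum>p\<in>?B. omega_sum r (x / real p)) = (\<Sum>p\<in>?B. 1)"
  proof (rule sum.cong[OF refl])
    fix p assume "p \<in> ?B"
    then have "x / 2 < real p" "real p \<le> x" by (auto simp: primes_between_def)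
    then show "omega_sum r (x / real p) = 1" using x by (intro omega_sum_lt_2) (auto simp: field_simps)
  qed
  finally have "\<bar>(\<Sum>p\<in>primes_between y x. omega_sum r (x / real p)) - (\<Sum>p\<in>primes_between y (x / 2). omega_sum r (x / real p))\<bar> = real (card ?B)"
    by simp
  also have "card ?B \<le> card {p. prime p \<and> x / 2 < real p \<and> real p \<le> x}"
    by (rule card_mono) (auto simp: primes_between_def intro: finite_subset[OF _ finite_primes_upto[of x]] simp: primes_upto_def)
  then have "real (card ?B) \<le> real (card {p. prime p \<and> x / 2 < real p \<and> real p \<le> x})" by simp
  also have "\<dots> \<le> 8 * x / ln x" by (rule card_primes_le[OF x])
  finally show ?thesis .
qed

lemma ln2_powr_le:
  assumes "\<beta> \<ge> -2"
  shows "ln 2 powr \<beta> \<le> (4::real)"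
proof (cases "\<beta> \<ge> 0")
  case True
  have "ln 2 powr \<beta> \<le> (1::real) powr \<beta>" using True ln_2_less_1 by (intro powr_mono2) auto
  then show ?thesis by simp
next
  case False
  have "ln 2 powr \<beta> \<le> (1/2::real) powr \<beta>" using False ln2_ge_two_thirds by (intro powr_mono2') auto
  also have "\<dots> \<le> (1/2) powr (-2)" using assms by (intro powr_mono') auto
  also have "\<dots> = (4::real)" by (simp add: powr_minus_divide power2_eq_square)
  finally show ?thesis .
qed

theorem mainTheorem8:
  fixes R :: real
  assumes "R > 0"
  shows "\<exists>C>0. \<forall>x y r :: real.
    2 \<le> sqrt x \<longrightarrow> sqrt x \<le> y \<longrightarrow> y \<le> x \<longrightarrow> 0 < r \<longrightarrow> r \<le> R \<longrightarrow>
    \<bar>S_sum r x y - m_fun r (ln x / ln y) * (x / ln y powr (1 - r))\<bar>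
      \<le> C * (x / ln y powr (2 - r) + x / ln x)"
proof -
  obtain C1 where C1: "C1 > 0" "\<And>r x. 0 < r \<Longrightarrow> r \<le> R \<Longrightarrow> x \<ge> 2 \<Longrightarrow>
    \<bar>omega_sum r x - lead_coeff_omega r * x * ln x powr (r - 1)\<bar> \<le> C1 * x * (ln x powr (r - 2) + ln x powr (-2))"
    using omega_sum_asymptotic[OF assms] by meson
  obtain CL where CL: "CL > 0" "\<And>r. 0 < r \<Longrightarrow> r \<le> R \<Longrightarrow> \<bar>lead_coeff_omega r\<bar> \<le> CL * r"
    using lead_coeff_omega_le[OF assms] by meson
  obtain C2 where C2: "C2 > 0" "\<And>x y \<beta>. 2 \<le> y \<Longrightarrow> y \<le> x / 2 \<Longrightarrow>
    \<bar>(\<Sum>p\<in>primes_between y (x / 2). ln (x / real p) powr \<beta> / real p) - integral {ln y..ln (x / 2)} (\<lambda>v. (ln x - v) powr \<beta> / v)\<bar>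
     \<le> C2 * (ln 2 powr \<beta> + ln (x / y) powr \<beta>) / ln y"
    using sum_primes_powr_ln by meson
  \<comment> \<open>K1 collects the errors of inserting the asymptotics of the inner sums and of
    replacing the prime sum by an integral; K2 is for the missing end of the integral near u = 1. In
    K the remaining terms come from \<open>S_sum_approx\<close>, from the sum over all n \<le> x,
    and from the primes above x/2.\<close>
  define K1 where "K1 = (1 + R) * (CL * R * (18 * C2) + C1 * (2 * (18 + 18 * C2)) + C1 * (1 + R) * (2 * (18 + 18 * C2)))"
  define K2 where "K2 = (1 + R) * (CL * 2 powr R)"
  define K where "K = (1 + R)\<^sup>2 + C1 + (1 + R) * 8 + K1 + K2"
  have Kpos: "K1 > 0" "K2 > 0" "K > 0"
  proof -
    show 1: "K1 > 0" unfolding K1_def using assms C1 C2 CL by (intro mult_pos_pos add_pos_pos) auto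
    show 2: "K2 > 0" unfolding K2_def using assms CL by (intro mult_pos_pos add_pos_pos) auto
    show "K > 0" unfolding K_def using 1 2 assms C1 by (intro add_pos_pos) auto
  qed
  have "\<bar>S_sum r x y - m_fun r (ln x / ln y) * (x / ln y powr (1 - r))\<bar> \<le> (K * 2 powr R) * (x / ln y powr (2 - r) + x / ln x)"
    if h: "2 \<le> sqrt x" "sqrt x \<le> y" "y \<le> x" "0 < r" "r \<le> R" for x y r
  proof -
    note r = h(4,5)
    have x4: "x \<ge> 4"
    proof -
      have "sqrt 4 \<le> sqrt x" using h(1) by simp
      then show ?thesis by (simp only: real_sqrt_le_iff)
    qed
    have y2: "y \<ge> 2" using h by linarith
    define X Y c where "X = ln x" and "Y = ln y" and "c = lead_coeff_omega r"
    have X1: "X \<ge> 1"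
    proof -
      have "ln 4 \<le> ln x" using x4 by (intro ln_mono) auto
      moreover have "ln (4::real) = 2 * ln 2" using ln_realpow[of 2 2] by simp
      ultimately show ?thesis unfolding X_def using ln2_ge_two_thirds by linarith
    qed
    have YX: "Y \<le> X" "X \<le> 2 * Y" "Y > 0"
    proof -
      show "Y \<le> X" unfolding X_def Y_def using h(3) y2 by (intro ln_mono) auto
      have "x \<le> y\<^sup>2" using power_mono[OF h(2), of 2] x4 by simp
      then have "ln x \<le> ln (y\<^sup>2)" using x4 by (intro ln_mono) auto
      then show "X \<le> 2 * Y" unfolding X_def Y_def using y2 by (simp add: ln_realpow)
      show "Y > 0" unfolding Y_def using y2 by simp
    qed
    \<comment> \<open>The target error, written with ln x in place of ln y; the two are comparable
      as 1 \<le> X/Y \<le> 2, and the conversion comes at the end.\<close>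
    define e where "e = X powr (r - 2) + 1 / X"
    have e0: "e \<ge> 1 / X" "e > 0" using X1 by (auto simp: e_def add_nonneg_pos)
    have X2: "X powr (-2) \<le> 1 / X"
    proof -
      have "X powr (-2) \<le> X powr (-1)" using X1 by (intro powr_mono) auto
      then show ?thesis using X1 by (simp add: powr_minus_divide)
    qed
    have cle: "\<bar>c\<bar> \<le> CL * r" "\<bar>c\<bar> \<le> CL * R"
      using CL(2)[OF r] CL(1) r mult_left_mono[of r R CL] unfolding c_def by linarith+
    have r1: "\<bar>1 - r\<bar> \<le> 1 + R" using r by auto
    let ?T = "\<Sum>p\<in>primes_between y x. omega_sum r (x / real p)"
    let ?T1 = "\<Sum>p\<in>primes_between y (x / 2). omega_sum r (x / real p)"
    define I where "I = integral {1..X / Y} (m_integrand r)"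
    have s1: "\<bar>S_sum r x y - (omega_sum r x + (1 - r) * ?T)\<bar> \<le> (1 + R)\<^sup>2 * (x * e)"
    proof -
      have "\<bar>S_sum r x y - (omega_sum r x + (1 - r) * ?T)\<bar> \<le> (1 + R)\<^sup>2 * 1"
        using S_sum_approx[OF x4 h(2,3), of r R] r by simp
      moreover have "1 \<le> x * e"
      proof -
        have "X \<le> x" unfolding X_def using x4 ln_le_minus_one[of x] by linarith
        then have "1 \<le> x * (1 / X)" using X1 by (simp add: field_simps)
        also have "\<dots> \<le> x * e" using e0 x4 by (intro mult_left_mono) auto
        finally show ?thesis .
      qed
      then have "(1 + R)\<^sup>2 * 1 \<le> (1 + R)\<^sup>2 * (x * e)" by (intro mult_left_mono) auto
      ultimately show ?thesis by linarith
    qed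
    have s2: "\<bar>omega_sum r x - c * x * X powr (r - 1)\<bar> \<le> C1 * (x * e)"
    proof -
      have "\<bar>omega_sum r x - c * x * X powr (r - 1)\<bar> \<le> C1 * x * (X powr (r - 2) + X powr (-2))"
        using C1(2)[OF r, of x] x4 by (simp add: c_def X_def)
      also have "\<dots> \<le> C1 * x * e" unfolding e_def using X2 C1 x4 by (intro mult_left_mono add_left_mono) auto
      finally show ?thesis by (simp add: mult.assoc)
    qed
    have s3: "\<bar>?T - ?T1\<bar> \<le> 8 * (x * e)"
    proof -
      have "\<bar>?T - ?T1\<bar> \<le> 8 * (x * (1 / X))" using sum_omega_sum_large_primes[OF x4, of r y] by (simp add: X_def)
      also have "\<dots> \<le> 8 * (x * e)" using e0 x4 by (intro mult_left_mono) auto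
      finally show ?thesis .
    qed
    \<comment> \<open>Here |c| \<le> CL r cancels the 1/r of the integral, and X^(r-1) X^(-r) =
      1/X.\<close>
    have tail: "\<bar>(1 - r) * c * x * (X powr (r - 1) * ((b - 1) powr r / r))\<bar> \<le> K2 * (x * e)" if b: "1 \<le> b" "b - 1 \<le> 2 / X" for b
    proof -
      have "(b - 1) powr r \<le> (2 / X) powr r" using b r by (intro powr_mono2) auto
      also have "\<dots> = 2 powr r * X powr (- r)" using X1 by (simp add: powr_divide powr_minus_divide)
      also have "\<dots> \<le> 2 powr R * X powr (- r)" using r by (intro mult_right_mono powr_mono) auto
      finally have "X powr (r - 1) * ((b - 1) powr r / r) \<le> X powr (r - 1) * ((2 powr R * X powr (- r)) / r)"
        using r by (intro mult_left_mono divide_right_mono) auto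
      also have "\<dots> = 2 powr R / r * (X powr (r - 1) * X powr (- r))" by simp
      also have "X powr (r - 1) * X powr (- r) = 1 / X"
      proof -
        have "X powr (r - 1) * X powr (- r) = X powr (-1)" by (subst powr_add[symmetric]) simp
        then show ?thesis using X1 by (simp add: powr_minus_divide)
      qed
      finally have t: "X powr (r - 1) * ((b - 1) powr r / r) \<le> 2 powr R / r * (1 / X)" .
      have t0: "0 \<le> X powr (r - 1) * ((b - 1) powr r / r)" using r by simp
      have "\<bar>(1 - r) * c * x * (X powr (r - 1) * ((b - 1) powr r / r))\<bar> = \<bar>1 - r\<bar> * \<bar>c\<bar> * x * (X powr (r - 1) * ((b - 1) powr r / r))"
        using x4 unfolding abs_mult[of "(1 - r) * c * x"] abs_of_nonneg[OF t0] by (simp add: abs_mult)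
      also have "\<dots> \<le> (1 + R) * (CL * r) * x * (2 powr R / r * (1 / X))"
      proof (rule mult_mono[OF _ t])
        show A: "\<bar>1 - r\<bar> * \<bar>c\<bar> * x \<le> (1 + R) * (CL * r) * x"
          using r1 cle x4 by (intro mult_right_mono mult_mono) auto
        have "0 \<le> \<bar>1 - r\<bar> * \<bar>c\<bar> * x" using x4 by simp
        then show "0 \<le> (1 + R) * (CL * r) * x" using A by linarith
      qed (use t0 in auto)
      also have "\<dots> = K2 * (x * (1 / X))" using r by (simp add: K2_def)
      also have "\<dots> \<le> K2 * (x * e)" using e0 x4 Kpos by (intro mult_left_mono) auto
      finally show ?thesis .
    qed
    have s4: "\<bar>(1 - r) * ?T1 - (1 - r) * c * x * (X powr (r - 1) * I)\<bar> \<le> (K1 + K2) * (x * e)"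
    proof (cases "y \<le> x / 2")
      \<comment> \<open>There are no primes in [y, x/2], and the integral \<open>I\<close> is itself
        small: X/Y - 1 = ln(x/y)/Y \<le> 2/X.\<close>
      case False
      then have "primes_between y (x / 2) = {}" by (auto simp: primes_between_def)
      then have T0: "?T1 = 0" by simp
      have "X / Y - 1 = (X - Y) / Y" using YX by (simp add: field_simps)
      also have "X - Y = ln (x / y)" unfolding X_def Y_def using x4 y2 by (simp add: ln_div)
      also have "ln (x / y) \<le> 1"
      proof -
        have "ln (x / y) \<le> ln 2" using False x4 y2 by (intro ln_mono) (auto simp: field_simps)
        then show ?thesis using ln_2_less_1 by linarith
      qed
      then have "ln (x / y) / Y \<le> 1 / (X / 2)" using YX X1 by (intro frac_le) auto
      finally have b: "X / Y - 1 \<le> 2 / X" by simp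
      have b1: "1 \<le> X / Y" using YX by simp
      have "\<bar>(1 - r) * c * x * (X powr (r - 1) * I)\<bar> \<le> \<bar>(1 - r) * c * x * (X powr (r - 1) * ((X / Y - 1) powr r / r))\<bar>"
        unfolding abs_mult I_def using m_integrand_near_1[OF r(1) b1] r
        by (intro mult_left_mono) (auto simp: abs_mult)
      also have "\<dots> \<le> K2 * (x * e)" by (rule tail[OF b1 b])
      also have "\<dots> \<le> (K1 + K2) * (x * e)" using Kpos e0 x4 by (intro mult_right_mono) auto
      finally show ?thesis unfolding T0 by simp
    next
      case True
      define V where "V = ln (x / 2)"
      have V: "V = X - ln 2" unfolding V_def X_def using x4 by (simp add: ln_div)
      have XY: "ln (x / y) = X - Y" unfolding X_def Y_def using x4 y2 by (simp add: ln_div)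
      have YV: "Y \<le> V" unfolding V_def Y_def using True y2 by (intro ln_mono) auto
      have VX: "V < X" unfolding V by simp
      define P where "P = primes_between y (x / 2)"
      \<comment> \<open>Since ln 2 \<le> X - Y \<le> X and (ln 2)^\<beta> \<le> 4, the numerator is
        at most X^\<beta> + 8; with Y \<ge> X/2 this gives 2 X^(\<beta>-1) + 16/X, and 18 = 2 + 16
        covers both.\<close>
      have H: "(ln 2 powr \<beta> + (X - Y) powr \<beta>) / Y \<le> 18 * (X powr (\<beta> - 1) + 1 / X)" if "\<beta> \<ge> -2" for \<beta>
      proof -
        have "(X - Y) powr \<beta> \<le> ln 2 powr \<beta> + X powr \<beta>"
          by (rule powr_between_le) (use YV V YX in auto)
        then have "ln 2 powr \<beta> + (X - Y) powr \<beta> \<le> X powr \<beta> + 8" using ln2_powr_le[OF that] by linarith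
        then have "(ln 2 powr \<beta> + (X - Y) powr \<beta>) / Y \<le> (X powr \<beta> + 8) / (X / 2)"
          using YX X1 by (intro frac_le) auto
        also have "\<dots> = 2 * (X powr \<beta> / X) + 16 * (1 / X)" using X1 by (simp add: field_simps)
        also have "X powr \<beta> / X = X powr (\<beta> - 1)" using X1 by (simp add: powr_diff)
        also have "2 * X powr (\<beta> - 1) + 16 * (1 / X) \<le> 18 * (X powr (\<beta> - 1) + 1 / X)"
        proof -
          have "2 * a + 16 * z \<le> 18 * (a + z)" if "a \<ge> 0" "z \<ge> 0" for a z :: real using that by simp
          from this[of "X powr (\<beta> - 1)" "1 / X"] show ?thesis using X1 by (simp only: powr_ge_zero divide_nonneg_nonneg zero_le_one order_trans[OF zero_le_one X1])
        qed
        finally show ?thesis .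
      qed
      have Xm: "X powr \<gamma> + 1 / X \<le> 2 * e" if "\<gamma> \<le> r - 2 \<or> \<gamma> \<le> -1" for \<gamma>
      proof -
        have "X powr \<gamma> \<le> X powr (r - 2) + X powr (-1)"
        proof (cases "\<gamma> \<le> r - 2")
          case True
          then have "X powr \<gamma> \<le> X powr (r - 2)" using X1 by (intro powr_mono) auto
          then show ?thesis by (simp add: add_increasing2)
        next
          case False
          then have "X powr \<gamma> \<le> X powr (-1)" using X1 that by (intro powr_mono) auto
          then show ?thesis by (simp add: add_increasing)
        qed
        moreover have "X powr (-1) = 1 / X" using X1 by (simp add: powr_minus_divide)
        ultimately have "X powr \<gamma> \<le> X powr (r - 2) + 1 / X" by simp
        moreover have "a + z \<le> 2 * (b + z)" if "a \<le> b + z" "b \<ge> 0" for a b z :: real using that by simp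
        ultimately show ?thesis unfolding e_def by (meson powr_ge_zero)
      qed
      \<comment> \<open>Q is the sum over primes and J its integral counterpart, needed for \<beta>
        = r-1 in the main term and for \<beta> = r-2 and \<beta> = -2 in the error terms.\<close>
      define J where "J \<beta> = integral {Y..V} (\<lambda>v. (X - v) powr \<beta> / v)" for \<beta>
      define Q where "Q \<beta> = (\<Sum>p\<in>P. ln (x / real p) powr \<beta> / real p)" for \<beta>
      have QJ: "\<bar>Q \<beta> - J \<beta>\<bar> \<le> C2 * (18 * (X powr (\<beta> - 1) + 1 / X))" if "\<beta> \<ge> -2" for \<beta>
      proof -
        have "\<bar>Q \<beta> - J \<beta>\<bar> \<le> C2 * (ln 2 powr \<beta> + (X - Y) powr \<beta>) / Y"
          using C2(2)[OF y2 True, of \<beta>] unfolding XY unfolding Q_def J_def P_def V_def X_def Y_def .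
        also have "\<dots> = C2 * ((ln 2 powr \<beta> + (X - Y) powr \<beta>) / Y)" by simp
        also have "\<dots> \<le> C2 * (18 * (X powr (\<beta> - 1) + 1 / X))" using C2 H[OF that] by (intro mult_left_mono) auto
        finally show ?thesis .
      qed
      have J_le: "\<bar>\<beta> + 1\<bar> * J \<beta> \<le> 18 * (X powr \<beta> + 1 / X)" if "\<beta> \<ge> -2" for \<beta>
      proof -
        have "\<bar>\<beta> + 1\<bar> * J \<beta> \<le> ((X - V) powr (\<beta> + 1) + (X - Y) powr (\<beta> + 1)) / Y"
          unfolding J_def by (rule powr_integral_over_le[OF YX(3) YV VX])
        also have "X - V = ln 2" by (simp add: V)
        also have "(ln 2 powr (\<beta> + 1) + (X - Y) powr (\<beta> + 1)) / Y \<le> 18 * (X powr \<beta> + 1 / X)"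
          using H[of "\<beta> + 1"] that by simp
        finally show ?thesis .
      qed
      \<comment> \<open>For \<beta> = -2 the factor |\<beta>+1| is 1, so the integral is bounded
        without help from 1 - r.\<close>
      have Q2: "Q (-2) \<le> 2 * (18 + 18 * C2) * e"
      proof -
        have "J (-2) \<le> 18 * (X powr (-2) + 1 / X)" using J_le[of "-2"] by simp
        also have "\<dots> \<le> 18 * (2 * e)" using Xm[of "-2"] by (intro mult_left_mono) auto
        finally have 1: "J (-2) \<le> 18 * (2 * e)" .
        have "C2 * (18 * (X powr (-2 - 1) + 1 / X)) \<le> C2 * (18 * (2 * e))" using Xm[of "-2 - 1"] C2 by (intro mult_left_mono) auto
        then have "\<bar>Q (-2) - J (-2)\<bar> \<le> C2 * (18 * (2 * e))" using QJ[of "-2"] by linarith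
        then have "Q (-2) \<le> C2 * (18 * (2 * e)) + 18 * (2 * e)" using 1 by linarith
        also have "\<dots> = 2 * (18 + 18 * C2) * e" by (simp add: algebra_simps)
        finally show ?thesis .
      qed
      \<comment> \<open>For r close to 1 the integral J (r - 2) alone may carry a logarithm; only
        its product with |1-r| = |\<beta>+1| is bounded uniformly.\<close>
      have Qr: "\<bar>1 - r\<bar> * Q (r - 2) \<le> (1 + R) * (2 * (18 + 18 * C2)) * e"
      proof -
        have "\<bar>1 - r\<bar> * J (r - 2) \<le> 18 * (X powr (r - 2) + 1 / X)" using J_le[of "r - 2"] r by (simp add: abs_minus_commute)
        also have "\<dots> \<le> 18 * (2 * e)" using Xm[of "r - 2"] by (intro mult_left_mono) auto
        finally have 1: "\<bar>1 - r\<bar> * J (r - 2) \<le> 18 * (2 * e)" .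
        have "C2 * (18 * (X powr (r - 2 - 1) + 1 / X)) \<le> C2 * (18 * (2 * e))" using Xm[of "r - 2 - 1"] C2 by (intro mult_left_mono) auto
        then have "Q (r - 2) \<le> J (r - 2) + C2 * (18 * (2 * e))" using QJ[of "r - 2"] r by linarith
        then have "\<bar>1 - r\<bar> * Q (r - 2) \<le> \<bar>1 - r\<bar> * (J (r - 2) + C2 * (18 * (2 * e)))" by (intro mult_left_mono) auto
        also have "\<dots> \<le> 18 * (2 * e) + (1 + R) * (C2 * (18 * (2 * e)))"
          unfolding distrib_left using 1 r1 C2 e0 by (intro add_mono mult_right_mono) auto
        also have "\<dots> \<le> (1 + R) * (18 * (2 * e)) + (1 + R) * (C2 * (18 * (2 * e)))"
          using assms e0 mult_right_mono[of 1 "1 + R" "18 * (2 * e)"] by simp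
        also have "\<dots> = (1 + R) * (2 * (18 + 18 * C2)) * e" by (simp add: algebra_simps)
        finally show ?thesis .
      qed
      \<comment> \<open>The asymptotic formula is available termwise, as p \<le> x/2 means x/p \<ge>
        2.\<close>
      have a: "\<bar>?T1 - c * x * Q (r - 1)\<bar> \<le> C1 * x * (Q (r - 2) + Q (-2))"
      proof -
        have "\<bar>omega_sum r (x / real p) - c * x * (ln (x / real p) powr (r - 1) / real p)\<bar> \<le> C1 * x * (ln (x / real p) powr (r - 2) / real p + ln (x / real p) powr (-2) / real p)"
          if p: "p \<in> P" for p
        proof -
          have "real p \<le> x / 2" "real p \<ge> y" using p by (auto simp: P_def primes_between_def)
          then have "x / real p \<ge> 2" using y2 by (simp add: field_simps)
          from C1(2)[OF r this] show ?thesis unfolding c_def by (simp add: algebra_simps add_divide_distrib)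
        qed
        then have "\<bar>\<Sum>p\<in>P. omega_sum r (x / real p) - c * x * (ln (x / real p) powr (r - 1) / real p)\<bar>
            \<le> (\<Sum>p\<in>P. C1 * x * (ln (x / real p) powr (r - 2) / real p + ln (x / real p) powr (-2) / real p))"
          by (intro order_trans[OF sum_abs] sum_mono)
        then show ?thesis
          unfolding Q_def P_def[symmetric] sum_subtractf sum_distrib_left[symmetric] sum.distrib .
      qed
      have "\<bar>(1 - r) * (?T1 - c * x * Q (r - 1))\<bar> \<le> \<bar>1 - r\<bar> * (C1 * x * (Q (r - 2) + Q (-2)))"
        unfolding abs_mult using a by (intro mult_left_mono) auto
      also have "\<dots> = C1 * x * (\<bar>1 - r\<bar> * Q (r - 2)) + C1 * x * (\<bar>1 - r\<bar> * Q (-2))" by (simp add: algebra_simps)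
      also have "\<dots> \<le> C1 * x * ((1 + R) * (2 * (18 + 18 * C2)) * e) + C1 * x * ((1 + R) * (2 * (18 + 18 * C2) * e))"
      proof (intro add_mono mult_left_mono Qr)
        have "0 \<le> Q (-2)" unfolding Q_def by (intro sum_nonneg) auto
        then show "\<bar>1 - r\<bar> * Q (-2) \<le> (1 + R) * (2 * (18 + 18 * C2) * e)" using r1 Q2 assms by (intro mult_mono) auto
      qed (use C1 x4 in auto)
      finally have b1: "\<bar>(1 - r) * (?T1 - c * x * Q (r - 1))\<bar> \<le> C1 * x * ((1 + R) * (2 * (18 + 18 * C2)) * e) + C1 * x * ((1 + R) * (2 * (18 + 18 * C2) * e))" .
      have "\<bar>(1 - r) * c * x * (Q (r - 1) - J (r - 1))\<bar> \<le> (1 + R) * (CL * R) * x * (C2 * (18 * e))"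
      proof -
        have "\<bar>Q (r - 1) - J (r - 1)\<bar> \<le> C2 * (18 * e)" using QJ[of "r - 1"] r by (simp add: e_def)
        then show ?thesis unfolding abs_mult using r1 cle x4 assms CL(1) by (intro mult_mono) auto
      qed
      moreover have "\<bar>(1 - r) * c * x * (X powr (r - 1) * I - J (r - 1))\<bar> \<le> K2 * (x * e)"
      proof -
        have V0: "V > 0" using YX YV by linarith
        have "X / V - 1 = ln 2 / V" using V0 by (simp add: V field_simps)
        also have "\<dots> \<le> 1 / (X / 2)" using YX YV X1 ln_2_less_1 by (intro frac_le) auto
        finally have b: "X / V - 1 \<le> 2 / X" by simp
        have b1: "1 \<le> X / V" using VX V0 by simp
        have "\<bar>(1 - r) * c * x * (X powr (r - 1) * I - J (r - 1))\<bar> \<le> \<bar>(1 - r) * c * x * (X powr (r - 1) * ((X / V - 1) powr r / r))\<bar>"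
          using m_integral_approx[OF r(1) YX(3) YV VX] r unfolding I_def J_def abs_mult[of "(1 - r) * c * x"]
          by (intro mult_left_mono) (auto simp: abs_mult)
        also have "\<dots> \<le> K2 * (x * e)" by (rule tail[OF b1 b])
        finally show ?thesis .
      qed
      moreover have "(1 - r) * ?T1 - (1 - r) * c * x * (X powr (r - 1) * I) = (1 - r) * (?T1 - c * x * Q (r - 1))
          + (1 - r) * c * x * (Q (r - 1) - J (r - 1)) - (1 - r) * c * x * (X powr (r - 1) * I - J (r - 1))"
        by (simp add: algebra_simps)
      ultimately have "\<bar>(1 - r) * ?T1 - (1 - r) * c * x * (X powr (r - 1) * I)\<bar> \<le>
          C1 * x * ((1 + R) * (2 * (18 + 18 * C2)) * e) + C1 * x * ((1 + R) * (2 * (18 + 18 * C2) * e)) + (1 + R) * (CL * R) * x * (C2 * (18 * e)) + K2 * (x * e)"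
        using b1 by linarith
      also have "\<dots> = ((1 + R) * (CL * R * (18 * C2) + C1 * (2 * (18 + 18 * C2)) + C1 * (2 * (18 + 18 * C2)))) * (x * e) + K2 * (x * e)"
        by (simp add: algebra_simps)
      also have "\<dots> \<le> K1 * (x * e) + K2 * (x * e)"
      proof (intro add_right_mono mult_right_mono)
        have "C1 * 1 * (2 * (18 + 18 * C2)) \<le> C1 * (1 + R) * (2 * (18 + 18 * C2))"
          using C1 C2 assms by (intro mult_right_mono mult_left_mono) auto
        then show "(1 + R) * (CL * R * (18 * C2) + C1 * (2 * (18 + 18 * C2)) + C1 * (2 * (18 + 18 * C2))) \<le> K1"
          unfolding K1_def using assms by (intro mult_left_mono add_left_mono) auto
      qed (use x4 e0 in auto)
      finally show ?thesis by (simp add: algebra_simps)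
    qed
    have "\<bar>(1 - r) * (?T - ?T1)\<bar> \<le> (1 + R) * (8 * (x * e))"
      unfolding abs_mult using r1 s3 assms by (intro mult_mono) auto
    \<comment> \<open>Telescoping over the four replacements bounded in \<open>s1\<close>,
      \<open>s2\<close>, \<open>s3\<close> (times 1 - r) and \<open>s4\<close>.\<close>
    moreover have "S_sum r x y - c * x * X powr (r - 1) * (1 + (1 - r) * I) =
        (S_sum r x y - (omega_sum r x + (1 - r) * ?T)) + (omega_sum r x - c * x * X powr (r - 1)) + (1 - r) * (?T - ?T1)
        + ((1 - r) * ?T1 - (1 - r) * c * x * (X powr (r - 1) * I))"
      by (simp add: algebra_simps)
    ultimately have "\<bar>S_sum r x y - c * x * X powr (r - 1) * (1 + (1 - r) * I)\<bar> \<le>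
        (1 + R)\<^sup>2 * (x * e) + C1 * (x * e) + (1 + R) * (8 * (x * e)) + (K1 + K2) * (x * e)"
      using s1 s2 s4 by linarith
    also have "\<dots> = K * (x * e)" by (simp add: K_def algebra_simps)
    finally have fin: "\<bar>S_sum r x y - c * x * X powr (r - 1) * (1 + (1 - r) * I)\<bar> \<le> K * (x * e)" .
    \<comment> \<open>Multiplying \<alpha>^(r-1) by Y^(r-1) gives X^(r-1), so y survives only in the
      upper limit X/Y of the integral.\<close>
    have "m_fun r (ln x / ln y) * (x / ln y powr (1 - r)) = c * x * X powr (r - 1) * (1 + (1 - r) * I)"
    proof -
      have 1: "g_one r / Gamma r = c" by (simp add: c_def lead_coeff_omega_def rGamma_inverse_Gamma divide_inverse)
      have "(X / Y) powr (r - 1) / Y powr (1 - r) = X powr (r - 1) / (Y powr (r - 1) * Y powr (1 - r))"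
        using X1 YX by (simp add: powr_divide)
      also have "Y powr (r - 1) * Y powr (1 - r) = 1" using YX by (simp flip: powr_add)
      finally have 2: "(X / Y) powr (r - 1) / Y powr (1 - r) = X powr (r - 1)" by simp
      have "m_fun r (X / Y) * (x / Y powr (1 - r)) = c * ((X / Y) powr (r - 1) + (1 - r) * (X / Y) powr (r - 1) * I) * (x / Y powr (1 - r))"
        unfolding m_fun_def 1 I_def m_integrand_def ..
      also have "\<dots> = c * x * ((X / Y) powr (r - 1) / Y powr (1 - r)) * (1 + (1 - r) * I)" by (simp add: divide_inverse) (simp add: algebra_simps)
      finally show ?thesis unfolding 2 by (simp add: X_def Y_def)
    qed
    \<comment> \<open>From X^(r-2) = (X/Y)^(r-2) Y^(r-2): as 1 \<le> X/Y \<le> 2, the first factor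
      is at most 2^R whatever the sign of r - 2.\<close>
    moreover have "x * e \<le> 2 powr R * (x / ln y powr (2 - r) + x / ln x)"
    proof -
      have XY1: "1 \<le> X / Y" "X / Y \<le> 2" using YX by (auto simp: field_simps)
      have "X powr (r - 2) = (X / Y * Y) powr (r - 2)" using YX by simp
      also have "\<dots> = (X / Y) powr (r - 2) * Y powr (r - 2)" by (rule powr_mult)
      also have "\<dots> \<le> 2 powr R * Y powr (r - 2)"
      proof (rule mult_right_mono)
        have "(X / Y) powr (r - 2) \<le> (X / Y) powr R" using XY1 r by (intro powr_mono) auto
        also have "\<dots> \<le> 2 powr R" using XY1 assms by (intro powr_mono2) auto
        finally show "(X / Y) powr (r - 2) \<le> 2 powr R" .
      qed simp
      also have "Y powr (r - 2) = 1 / Y powr (2 - r)" using powr_minus_divide[of Y "2 - r"] by simp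
      finally have "x * X powr (r - 2) \<le> x * (2 powr R * (1 / Y powr (2 - r)))" using x4 by (intro mult_left_mono) auto
      moreover have "1 * (x / X) \<le> 2 powr R * (x / X)"
        using x4 X1 assms ge_one_powr_ge_zero[of 2 R] by (intro mult_right_mono) auto
      ultimately have "x * X powr (r - 2) + x / X \<le> 2 powr R * (x / Y powr (2 - r) + x / X)" by (simp add: algebra_simps)
      then show ?thesis by (simp add: e_def X_def Y_def algebra_simps)
    qed
    then have "K * (x * e) \<le> K * (2 powr R * (x / ln y powr (2 - r) + x / ln x))" using Kpos by (intro mult_left_mono) auto
    ultimately show ?thesis using fin by (simp only: mult.assoc)
  qed
  moreover have "K * 2 powr R > 0" using Kpos by simp
  ultimately show ?thesis by blast
qed

end
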